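(* Let $\delta>0$ be a fixed small constant and $B>0$ a constant. There are constants $c_1,c_2,C>0$ depending only on $\delta$ and $B$ such that the following holds. Let $H_N$ be a deterministic $N\times N$ real symmetric (resp. complex Hermitian) matrix and let $P_N$ be a deterministic $N\times N$ real symmetric (resp. complex Hermitian) matrix of rank $M=o(N)$, with $\|H_N\|\le B$ and $\|P_N\|\le B$. Let the nonzero eigenvalues of $P_N$ be $\theta_1\ge\dots\ge\theta_{M_1}>0>\theta_{M_1+1}\ge\dots\ge\theta_M$. Let $U$ be a Haar-distributed $N\times N$ orthogonal (resp. unitary) matrix, let $\tilde W_N=U^*H_NU+P_N$, and denote its eigenvalues by $\lambda_1(\tilde W_N)\ge\dots\ge\lambda_N(\tilde W_N)$. Let $0<\epsilon\le\delta$ ($\epsilon$ may depend on $M$ and $N$) and let $1\le i\le M$ be such that $$m_N^{-1}\Big(\frac1{\theta_i}\Big)\ge\lambda_1(H_N)+2\delta\ \text{ if }\theta_i>0,\qquad m_N^{-1}\Big(\frac1{\theta_i}\Big)\le\lambda_N(H_N)-2\delta\ \text{ if }\theta_i<0 .$$ Set $\tilde\lambda_i=\lambda_i(\tilde W_N)$ if $\theta_i>0$ and $\tilde\lambda_i=\lambda_{N-M+i}(\tilde W_N)$ if $\theta_i<0$. Then $$\mathbb P\left(m_N^{-1}\Big(\frac1{\theta_i}\Big)-\epsilon\le\tilde\lambda_i\le m_N^{-1}\Big(\frac1{\theta_i}\Big)+\epsilon\right)\ge 1-Ce^{-c_1N\epsilon^2+c_2M}.$$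
   Context: $\|\cdot\|$ is the operator norm. The ordered eigenvalues of $H_N$ are $\lambda_1(H_N)\ge\dots\ge\lambda_N(H_N)$. The Stieltjes transform of the empirical eigenvalue distribution of $H_N$ is $$m_N(z)=\frac1N\sum_{k=1}^N\frac1{z-\lambda_k(H_N)},\qquad z\in(-\infty,\lambda_N(H_N))\cup(\lambda_1(H_N),\infty).$$ It is strictly decreasing on each of the two intervals, and $m_N^{-1}:\mathbb R\setminus\{0\}\to\mathbb R$ denotes its inverse, mapping $(0,\infty)$ onto $(\lambda_1(H_N),\infty)$ and $(-\infty,0)$ onto $(-\infty,\lambda_N(H_N))$. The rank $M=M(N)$ may grow with $N$; the assumption $M=o(N)$ refers to the sequence $N\to\infty$, and the constants do not depend on $N$, $M$, $\epsilon$, $i$ or on the matrices. *)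

theory Defs
  imports
    "HOL-Probability.Probability"
    "HOL-Library.Landau_Symbols"
    "Jordan_Normal_Form.Schur_Decomposition"
    "Jordan_Normal_Form.DL_Rank"
begin

definition symmetric_mats :: "nat \<Rightarrow> real mat set" where
  "symmetric_mats n = {A \<in> carrier_mat n n. transpose_mat A = A}"

definition hermitian_mats :: "nat \<Rightarrow> complex mat set" where
  "hermitian_mats n = {A \<in> carrier_mat n n. mat_adjoint A = A}"

definition orthogonal_group :: "nat \<Rightarrow> real mat set" where
  "orthogonal_group n = {U \<in> carrier_mat n n. transpose_mat U * U = 1\<^sub>m n}"

definition unitary_group :: "nat \<Rightarrow> complex mat set" where
  "unitary_group n = {U \<in> carrier_mat n n. mat_adjoint U * U = 1\<^sub>m n}"

definition eucl_norm :: "'a::real_normed_field vec \<Rightarrow> real" where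
  "eucl_norm v = L2_set (\<lambda>i. norm (vec_index v i)) {..<dim_vec v}"

definition op_norm :: "'a::real_normed_field mat \<Rightarrow> real" where
  "op_norm A = (SUP v \<in> {v \<in> carrier_vec (dim_col A). eucl_norm v \<le> 1}. eucl_norm (A *\<^sub>v v))"

(* The eigenvalues with multiplicity in decreasing order.  This is meaningful only
   when the characteristic polynomial splits with real roots, as it does for
   symmetric and Hermitian matrices; eigvals_eqI gives uniqueness. *)
definition eigvals :: "'a::real_normed_field mat \<Rightarrow> real list" where
  "eigvals A = (THE xs. sorted_wrt (\<ge>) xs \<and> char_poly A = (\<Prod>x\<leftarrow>xs. [:- of_real x, 1:]))"

lemma order_prod_linear_of_real:
  "Polynomial.order (of_real a :: 'a::real_normed_field) (\<Prod>x\<leftarrow>xs. [:- of_real x, 1:])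
     = count (mset xs) a"
proof (induction xs)
  case Nil
  then show ?case by (simp add: order_1_eq_0)
next
  case (Cons b xs)
  have "(\<Prod>x\<leftarrow>ys. [:- of_real x, 1:]) \<noteq> (0 :: 'a poly)" for ys :: "real list"
    by (auto simp: prod_list_zero_iff)
  from this[of "b # xs"] have nz:
    "[:- of_real b, 1:] * (\<Prod>x\<leftarrow>xs. [:- of_real x, 1:]) \<noteq> (0 :: 'a poly)"
    by simp
  have 1: "Polynomial.order (of_real a :: 'a) [:- of_real b, 1:] = (if a = b then 1 else 0)"
  proof (cases "a = b")
    case True
    then show ?thesis using order_power_n_n[of "of_real b :: 'a" 1] by simp
  next
    case False
    then have "poly [:- of_real b, 1:] (of_real a :: 'a) \<noteq> 0" by simp
    then show ?thesis using False order_0I by (metis (full_types))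
  qed
  show ?case using Cons.IH order_mult[OF nz, of "of_real a"] 1 by simp
qed

lemma eigvals_eqI:
  fixes A :: "'a::real_normed_field mat"
  assumes s: "sorted_wrt (\<ge>) xs" and p: "char_poly A = (\<Prod>x\<leftarrow>xs. [:- of_real x, 1:])"
  shows "eigvals A = xs"
  unfolding eigvals_def
proof (rule the_equality)
  show "sorted_wrt (\<ge>) xs \<and> char_poly A = (\<Prod>x\<leftarrow>xs. [:- of_real x, 1:])"
    using s p by blast
next
  fix ys :: "real list"
  assume ys: "sorted_wrt (\<ge>) ys \<and> char_poly A = (\<Prod>x\<leftarrow>ys. [:- of_real x, 1:])"
  have "count (mset ys) a = count (mset xs) a" for a
    using order_prod_linear_of_real[of a ys, where 'a = 'a]
      order_prod_linear_of_real[of a xs, where 'a = 'a] ys p by simp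
  then have "mset ys = mset xs" by (rule multiset_eqI)
  then have "mset (rev ys) = mset (rev xs)" by simp
  moreover have "sorted (rev ys)" "sorted (rev xs)"
    using s ys by (auto simp: sorted_wrt_rev)
  ultimately have "rev ys = rev xs" by (metis properties_for_sort)
  then show "ys = xs" by simp
qed

(* The k-th largest eigenvalue, counted from k = 1. *)
definition nth_eigval :: "nat \<Rightarrow> 'a::real_normed_field mat \<Rightarrow> real" where
  "nth_eigval k A = eigvals A ! (k - 1)"

(* The k-th largest among the nonzero eigenvalues, counted from k = 1. *)
definition nth_nonzero_eigval :: "nat \<Rightarrow> 'a::real_normed_field mat \<Rightarrow> real" where
  "nth_nonzero_eigval k A = filter (\<lambda>x. x \<noteq> 0) (eigvals A) ! (k - 1)"

definition stieltjes :: "'a::real_normed_field mat \<Rightarrow> real \<Rightarrow> real" where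
  "stieltjes A z = (1 / real (dim_row A)) * (\<Sum>k = 1..dim_row A. 1 / (z - nth_eigval k A))"

definition stieltjes_dom :: "'a::real_normed_field mat \<Rightarrow> real set" where
  "stieltjes_dom A = {..<nth_eigval (dim_row A) A} \<union> {nth_eigval 1 A<..}"

definition stieltjes_inv :: "'a::real_normed_field mat \<Rightarrow> real \<Rightarrow> real" where
  "stieltjes_inv A = the_inv_into (stieltjes_dom A) (stieltjes A)"

(* The sigma-algebra generated by the matrix entries, i.e. the Borel sets of the
   n x n matrices over a second countable field. *)
definition mat_borel :: "nat \<Rightarrow> 'a::topological_space mat measure" where
  "mat_borel n = vimage_algebra (carrier_mat n n)
     (\<lambda>A. \<lambda>ij \<in> {..<n} \<times> {..<n}. A $$ ij) (\<Pi>\<^sub>M ij \<in> {..<n} \<times> {..<n}. borel)"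

(* The translation invariant probability measure on a compact group G of n x n matrices. *)
definition haar_prob ::
  "nat \<Rightarrow> 'a::{topological_space, semiring_0} mat set \<Rightarrow> 'a mat measure \<Rightarrow> bool" where
  "haar_prob n G \<mu> \<longleftrightarrow>
     prob_space \<mu> \<and> sets \<mu> = sets (restrict_space (mat_borel n) G) \<and>
     (\<forall>V\<in>G. distr \<mu> \<mu> (\<lambda>U. V * U) = \<mu> \<and> distr \<mu> \<mu> (\<lambda>U. U * V) = \<mu>)"

end

(* Conjugating by eigenbases of H and P and using the two-sided invariance of the Haar measure, one
   may assume that H and P are diagonal.  By the variational characterization of the eigenvalues,
   lambda_i lies between rho - eps and rho + eps as soon as, at the two points
   z = rho - eps and z = rho + eps, the quadratic form of (z - U* H U)^(-1), restricted to the
   range of P, is within a small multiple of eps of m(z) times the identity: to bound lambda_i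
   from below use the trial space (z - U* H U)^(-1) span(e_1, ..., e_i), and to bound it from above
   the orthogonal complement of e_1, ..., e_(i-1), where e_j are the eigenvectors of P.  For a
   fixed vector v the form q(U) = sum_i l_i |(U v)_i|^2 with sum_i l_i = 0 is, up to a factor, an
   eigenfunction of the Laplacian of the group; differentiating the invariance under plane rotations
   at the identity gives n E[q exp(t q)] <= C t E[exp(t q)], hence a Gaussian bound for the moment
   generating function.  A union bound over a net of the unit sphere of the range of P, of size
   exp(O(M)), finishes the proof. *)

theory Submission
  imports Defs
begin

unbundle no vec_syntax
unbundle no inner_syntax

section \<open>Real and complex matrices\<close>

text \<open>Both cases are handled at once over a class of fields containing \<open>real\<close> and
  \<open>complex\<close>. Keeping only the real part of the Hermitian product makes every quadratic
  form real-valued, and plane rotations with real entries lie in both groups, so one concentration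
  argument serves both. The obstacle in the lower bound is that \<open>P\<close> is indefinite: the
  resolvent applied to leading eigenvectors of \<open>P\<close> also has components along the other
  eigenvectors, where the form of \<open>P\<close> can be as low as -B. Control of the resolvent
  form on the whole range of \<open>P\<close>, which by polarization includes its off-diagonal part,
  keeps these components of order \<epsilon>. The margin comes from the slope of the Stieltjes
  transform: on moving from \<rho> to either side by \<epsilon>, its value leaves 1/\<theta> by at
  least a constant multiple of \<epsilon>. That constant depends only on B and \<delta> because
  \<rho> cannot lie further than B from the top eigenvalue of \<open>H\<close>. Negative \<theta> is
  reduced to positive \<theta> by changing the sign of both matrices.\<close>

class rcfield = conjugatable_ordered_field + real_normed_field + euclidean_space +
  assumes inner_mult_conjugate: "inner (a * x) y = inner x (conjugate a * y)"
    and mult_conjugate_scaleR: "x * conjugate x = scaleR ((norm x)\<^sup>2) 1"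

instance real :: rcfield
  by standard (auto simp: power2_eq_square)

instance complex :: rcfield
proof
  fix a x y :: complex
  show "inner (a * x) y = inner x (conjugate a * y)"
    by (simp add: inner_complex_def algebra_simps)
  show "x * conjugate x = scaleR ((norm x)\<^sup>2) 1"
    by (simp add: scaleR_conv_of_real complex_norm_square del: of_real_power)
qed

lemma mult_conjugate:
  fixes x :: "'a::rcfield"
  shows "x * conjugate x = of_real ((norm x)\<^sup>2)"
  using mult_conjugate_scaleR[of x] by (simp add: of_real_def)

text \<open>The inner product determines the conjugate: multiplication by \<open>of_real r\<close>
  is its own adjoint, so the difference \<open>d\<close> of the two sides is orthogonal to
  itself.\<close>

lemma conjugate_of_real [simp]: "conjugate (of_real r :: 'a::rcfield) = of_real r"
proof -
  define d where "d = conjugate (of_real r :: 'a) - of_real r"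
  have "inner x (conjugate (of_real r) * y) = inner x (of_real r * y)" for x y :: 'a
  proof -
    have "inner x (conjugate (of_real r) * y) = inner (of_real r * x) y"
      by (rule inner_mult_conjugate[symmetric])
    also have "\<dots> = r * inner x y"
      by (metis inner_scaleR_left scaleR_conv_of_real)
    also have "\<dots> = inner x (of_real r * y)"
      by (metis inner_scaleR_right scaleR_conv_of_real)
    finally show ?thesis .
  qed
  from this[of d 1] have "inner d d = 0"
    by (simp add: d_def inner_diff_right)
  then show ?thesis by (simp add: d_def)
qed

lemma conjugate_one [simp]: "conjugate (1 :: 'a::rcfield) = 1"
  using conjugate_of_real[of 1, where 'a = 'a] by simp

lemma inner_of_real_mult:
  fixes x y :: "'a::rcfield"
  shows "inner (of_real r * x) y = r * inner x y" "inner x (of_real r * y) = r * inner x y"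
  by (metis inner_scaleR_left scaleR_conv_of_real, metis inner_scaleR_right scaleR_conv_of_real)

text \<open>The real part of the Hermitian inner product; with it all quadratic forms are real-valued over
  both fields.\<close>

definition rip :: "'a::rcfield vec \<Rightarrow> 'a vec \<Rightarrow> real" where
  "rip x y = (\<Sum>i<dim_vec x. inner (x $ i) (y $ i))"

lemma rip_commute: "dim_vec x = dim_vec y \<Longrightarrow> rip x y = rip y x"
  by (simp add: rip_def inner_commute)

lemma rip_self: "rip x x = (\<Sum>i<dim_vec x. (norm (x $ i))\<^sup>2)"
  by (simp add: rip_def power2_norm_eq_inner)

lemma rip_nonneg [simp]: "rip x x \<ge> 0"
  by (simp add: rip_self sum_nonneg)

lemma rip_eq_0_iff:
  fixes x :: "'a::rcfield vec"
  shows "x \<in> carrier_vec n \<Longrightarrow> rip x x = 0 \<longleftrightarrow> x = 0\<^sub>v n"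
  by (auto simp: rip_self sum_nonneg_eq_0_iff)

lemma rip_pos:
  fixes x :: "'a::rcfield vec"
  shows "x \<in> carrier_vec n \<Longrightarrow> x \<noteq> 0\<^sub>v n \<Longrightarrow> rip x x > 0"
  using rip_eq_0_iff[of x n] rip_nonneg[of x] by linarith

lemma cscalar_self:
  fixes x :: "'a::rcfield vec"
  shows "x \<bullet>c x = of_real (rip x x)"
  by (simp add: scalar_prod_def rip_self mult_conjugate lessThan_atLeast0)

section \<open>Adjoint matrices\<close>

lemma dim_mat_adjoint [simp]:
  "dim_row (mat_adjoint A) = dim_col A" "dim_col (mat_adjoint A) = dim_row A"
  by (auto simp: mat_adjoint_def)

lemma mat_adjoint_index [simp]:
  "i < dim_col A \<Longrightarrow> j < dim_row A \<Longrightarrow> mat_adjoint A $$ (i, j) = conjugate (A $$ (j, i))"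
  by (simp add: mat_adjoint_def mat_of_rows_def)

lemma mat_adjoint_carrier [simp]:
  "A \<in> carrier_mat m n \<Longrightarrow> mat_adjoint A \<in> carrier_mat n m"
  by (intro carrier_matI) simp_all

lemma mat_adjoint_adjoint [simp]:
  "mat_adjoint (mat_adjoint A) = A"
  by (rule eq_matI) auto

lemma mat_adjoint_one [simp]: "mat_adjoint (1\<^sub>m n :: 'a::rcfield mat) = 1\<^sub>m n"
  by (rule eq_matI) auto

lemma mat_adjoint_mult:
  assumes "A \<in> carrier_mat m n" "B \<in> carrier_mat n k"
  shows "mat_adjoint (A * B) = mat_adjoint B * mat_adjoint A"
proof (rule eq_matI)
  fix i j
  assume "i < dim_row (mat_adjoint B * mat_adjoint A)" "j < dim_col (mat_adjoint B * mat_adjoint A)"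
  then have ij: "i < k" "j < m" using assms by auto
  then show "mat_adjoint (A * B) $$ (i, j) = (mat_adjoint B * mat_adjoint A) $$ (i, j)"
    using assms
    by (simp add: scalar_prod_def sum_conjugate conjugate_dist_mul mult.commute)
qed (use assms in auto)

lemma mat_adjoint_add:
  assumes "A \<in> carrier_mat m n" "B \<in> carrier_mat m n"
  shows "mat_adjoint (A + B) = mat_adjoint A + mat_adjoint B"
  by (rule eq_matI) (use assms in \<open>auto simp: conjugate_dist_add\<close>)

lemma mat_adjoint_uminus: "mat_adjoint (- A) = - mat_adjoint A"
  by (rule eq_matI) (auto simp: conjugate_neg)

lemma mat_adjoint_real: "mat_adjoint (A :: real mat) = transpose_mat A"
  by (rule eq_matI) auto

lemma mult_mat_vec_index:
  assumes "A \<in> carrier_mat m n" "x \<in> carrier_vec n" "i < m"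
  shows "(A *\<^sub>v x) $ i = (\<Sum>j<n. A $$ (i, j) * x $ j)"
  using assms by (simp add: scalar_prod_def lessThan_atLeast0)

lemma mat_mult_unit_vec:
  fixes A :: "'a::rcfield mat"
  assumes "A \<in> carrier_mat n n" "i < n"
  shows "A *\<^sub>v unit_vec n i = col A i"
proof (rule eq_vecI)
  fix j assume "j < dim_vec (col A i)"
  then have j: "j < n" using assms by simp
  have "(A *\<^sub>v unit_vec n i) $ j = (\<Sum>k<n. if k = i then A $$ (j, k) else 0)"
    using assms j by (simp add: mult_mat_vec_index[of _ n n] mult_delta_right del: index_mult_mat_vec)
  then show "(A *\<^sub>v unit_vec n i) $ j = col A i $ j" using assms j by simp
qed (use assms in simp)

lemma rip_adjoint:
  assumes "A \<in> carrier_mat m n" "x \<in> carrier_vec n" "y \<in> carrier_vec m"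
  shows "rip (A *\<^sub>v x) y = rip x (mat_adjoint A *\<^sub>v y)"
proof -
  have "rip (A *\<^sub>v x) y = (\<Sum>i<m. inner (\<Sum>j<n. A $$ (i, j) * x $ j) (y $ i))"
    using assms by (simp add: rip_def mult_mat_vec_index[OF assms(1,2)] del: index_mult_mat_vec)
  also have "\<dots> = (\<Sum>i<m. \<Sum>j<n. inner (x $ j) (conjugate (A $$ (i, j)) * y $ i))"
    by (simp add: inner_sum_left inner_mult_conjugate)
  also have "\<dots> = (\<Sum>j<n. \<Sum>i<m. inner (x $ j) (conjugate (A $$ (i, j)) * y $ i))"
    by (rule sum.swap)
  also have "\<dots> = rip x (mat_adjoint A *\<^sub>v y)"
    using assms mult_mat_vec_index[OF mat_adjoint_carrier[OF assms(1)] assms(3)]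
    by (simp add: rip_def inner_sum_right del: index_mult_mat_vec)
  finally show ?thesis .
qed

lemma rip_add_left:
  assumes "x \<in> carrier_vec n" "y \<in> carrier_vec n" "z \<in> carrier_vec n"
  shows "rip (x + y) z = rip x z + rip y z"
  using assms by (simp add: rip_def inner_add_left sum.distrib)

lemma rip_add_right:
  assumes "x \<in> carrier_vec n" "y \<in> carrier_vec n" "z \<in> carrier_vec n"
  shows "rip z (x + y) = rip z x + rip z y"
  using assms by (simp add: rip_def inner_add_right sum.distrib)

lemma rip_smult_left:
  assumes "x \<in> carrier_vec n" "y \<in> carrier_vec n"
  shows "rip (of_real r \<cdot>\<^sub>v x) y = r * rip x y"
  using assms by (simp add: rip_def inner_of_real_mult sum_distrib_left)

lemma rip_smult_right:
  assumes "x \<in> carrier_vec n" "y \<in> carrier_vec n"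
  shows "rip x (of_real r \<cdot>\<^sub>v y) = r * rip x y"
  using assms by (simp add: rip_def inner_of_real_mult sum_distrib_left)

lemma rip_smult_self:
  fixes x :: "'a::rcfield vec"
  shows "rip (of_real c \<cdot>\<^sub>v x) (of_real c \<cdot>\<^sub>v x) = c\<^sup>2 * rip x x"
  by (simp add: rip_self norm_mult power_mult_distrib sum_distrib_left)

lemma normalize_vec:
  fixes x :: "'a::rcfield vec"
  assumes x: "x \<in> carrier_vec n" "x \<noteq> 0\<^sub>v n"
  obtains b c where "rip (of_real b \<cdot>\<^sub>v x) (of_real b \<cdot>\<^sub>v x) = 1" "x = of_real c \<cdot>\<^sub>v (of_real b \<cdot>\<^sub>v x)"
proof
  define c where "c = sqrt (rip x x)"
  have c: "c > 0" "c\<^sup>2 = rip x x" using rip_pos[OF x] by (auto simp: c_def)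
  show "rip (of_real (1 / c) \<cdot>\<^sub>v x) (of_real (1 / c) \<cdot>\<^sub>v x) = 1"
    unfolding rip_smult_self using c(1) by (simp add: power_divide flip: c(2))
  show "x = of_real c \<cdot>\<^sub>v (of_real (1 / c) \<cdot>\<^sub>v x)"
    using c x(1) by (simp add: smult_smult_assoc flip: of_real_mult)
qed

text \<open>Zero rows pad \<open>B\<close> to a square matrix; expanding its determinant along the
  zero row \<open>r\<close> gives 0, hence a kernel vector. The dimension counts in the variational
  arguments are all instances of this.\<close>

lemma homogeneous_system_nontrivial:
  fixes B :: "'a::field mat"
  assumes B: "B \<in> carrier_mat r n" and rn: "r < n"
  shows "\<exists>x\<in>carrier_vec n. x \<noteq> 0\<^sub>v n \<and> B *\<^sub>v x = 0\<^sub>v r"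
proof -
  define C where "C = mat n n (\<lambda>(i, j). if i < r then B $$ (i, j) else 0)"
  have C: "C \<in> carrier_mat n n" by (simp add: C_def)
  have "det C = (\<Sum>j<n. C $$ (r, j) * cofactor C r j)"
    by (rule laplace_expansion_row[OF C rn])
  also have "\<dots> = 0" using rn by (simp add: C_def)
  finally obtain x where x: "x \<in> carrier_vec n" "x \<noteq> 0\<^sub>v n" "C *\<^sub>v x = 0\<^sub>v n"
    using det_0_iff_vec_prod_zero_field[OF C] by blast
  have "B *\<^sub>v x = 0\<^sub>v r"
  proof (rule eq_vecI)
    fix i assume "i < dim_vec (0\<^sub>v r :: 'a vec)"
    then have i: "i < r" by simp
    then have "(B *\<^sub>v x) $ i = (C *\<^sub>v x) $ i"
      using B C rn x(1) by (simp add: scalar_prod_def C_def)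
    then show "(B *\<^sub>v x) $ i = 0\<^sub>v r $ i" using x(3) i rn by simp
  qed (use B in simp)
  then show ?thesis using x by blast
qed

text \<open>Vanishing of the first variation at a maximum. It is applied on a line through a
  maximizer of the Rayleigh quotient.\<close>

lemma quadratic_linear_coeff_zero:
  fixes a b :: real
  assumes "\<And>t. t * a + t\<^sup>2 * b \<le> 0"
  shows "a = 0"
proof (rule ccontr)
  assume a: "a \<noteq> 0"
  \<comment> \<open>The test value \<open>t = a / D\<close> turns the expression into
    \<open>a\<^sup>2 * (D + b) / D\<^sup>2\<close>; this \<open>D\<close> keeps \<open>D + b\<close>
    positive for either sign of \<open>b\<close>.\<close>
  define D where "D = 1 + \<bar>b\<bar>"
  have D: "D > 0" "D + b > 0" by (auto simp: D_def)
  have "a / D * a + (a / D)\<^sup>2 * b = a\<^sup>2 * (D + b) / D\<^sup>2"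
    using D(1) by (simp add: power2_eq_square field_simps)
  also have "\<dots> > 0" using a D by simp
  finally show False using assms[of "a / D"] by simp
qed

text \<open>A continuous form attains its maximum on the compact unit sphere of a subspace, and
  homogeneity extends the bound to all of its vectors. The subspace is given as a kernel, so that
  \<open>r < n\<close> already makes it nonzero.\<close>

lemma rayleigh_maximizer:
  fixes A :: "'a::rcfield mat"
  assumes A: "A \<in> carrier_mat n n" and C: "C \<in> carrier_mat r n" and rn: "r < n"
  shows "\<exists>v\<in>carrier_vec n. C *\<^sub>v v = 0\<^sub>v r \<and> rip v v = 1 \<and>
    (\<forall>x\<in>carrier_vec n. C *\<^sub>v x = 0\<^sub>v r \<longrightarrow> rip x (A *\<^sub>v x) \<le> rip v (A *\<^sub>v v) * rip x x)"
proof -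
  \<comment> \<open>Vectors are encoded as functions on all of \<open>nat\<close> that vanish from
    \<open>n\<close> on. The box \<open>K\<close> is a product of closed balls and points, compact
    by Tychonoff, and closed conditions cut the sphere \<open>S\<close> out of it.\<close>
  define K :: "(nat \<Rightarrow> 'a) set" where "K = PiE UNIV (\<lambda>i. if i < n then cball 0 1 else {0})"
  define S where "S = {f \<in> K. (\<Sum>i<n. (norm (f i))\<^sup>2) = 1 \<and> (\<forall>i<r. (\<Sum>j<n. C $$ (i, j) * f j) = 0)}"
  define R where "R f = (\<Sum>i<n. inner (f i) (\<Sum>j<n. A $$ (i, j) * f j))" for f :: "nat \<Rightarrow> 'a"
  have "compactin (product_topology (\<lambda>i. euclidean) UNIV) K"
    unfolding K_def by (subst compactin_PiE) auto
  then have K: "compact K"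
    by (simp add: euclidean_product_topology compactin_euclidean_iff)
  have S_eq: "S = K \<inter> ({f. (\<Sum>i<n. (norm (f i))\<^sup>2) = 1} \<inter> (\<Inter>i\<in>{..<r}. {f. (\<Sum>j<n. C $$ (i, j) * f j) = 0}))"
    by (auto simp: S_def)
  have coord: "continuous_on T (\<lambda>f :: nat \<Rightarrow> 'a. f i)" for i T
    by (rule continuous_on_subset[OF continuous_on_product_coordinates]) simp
  have "closed {f :: nat \<Rightarrow> 'a. (\<Sum>i<n. (norm (f i))\<^sup>2) = 1}"
    by (intro closed_Collect_eq continuous_on_sum continuous_on_power continuous_on_norm coord
        continuous_on_const)
  moreover have "closed {f. (\<Sum>j<n. C $$ (i, j) * f j) = 0}" for i
    by (intro closed_Collect_eq continuous_on_sum continuous_on_mult coord continuous_on_const)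
  ultimately have "compact S"
    unfolding S_eq by (intro compact_Int_closed K closed_Int closed_INT ballI)
  have contR: "continuous_on S R"
    unfolding R_def
    by (intro continuous_on_sum continuous_on_inner continuous_on_mult coord continuous_on_const)
  have inS: "(\<lambda>i. if i < n then y $ i else 0) \<in> S"
    if y: "y \<in> carrier_vec n" "rip y y = 1" "C *\<^sub>v y = 0\<^sub>v r" for y
  proof -
    have s1: "(\<Sum>i<n. (norm (y $ i))\<^sup>2) = 1" using y by (simp add: rip_self)
    have "norm (y $ i) \<le> 1" if "i < n" for i
    proof -
      have "(norm (y $ i))\<^sup>2 \<le> (\<Sum>i<n. (norm (y $ i))\<^sup>2)"
        using that by (intro member_le_sum) auto
      then show ?thesis using s1 by (simp add: power_le_one_iff abs_square_le_1)
    qed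
    moreover have "(\<Sum>j<n. C $$ (i, j) * y $ j) = 0" if "i < r" for i
      using mult_mat_vec_index[OF C y(1) that] y(3) that by simp
    ultimately show ?thesis using s1 by (auto simp: S_def K_def PiE_def)
  qed
  have normalize: "\<exists>y\<in>carrier_vec n. \<exists>c. rip y y = 1 \<and> C *\<^sub>v y = 0\<^sub>v r \<and> x = of_real c \<cdot>\<^sub>v y"
    if x: "x \<in> carrier_vec n" "x \<noteq> 0\<^sub>v n" "C *\<^sub>v x = 0\<^sub>v r" for x
  proof -
    obtain b c where bc: "rip (of_real b \<cdot>\<^sub>v x) (of_real b \<cdot>\<^sub>v x) = 1" "x = of_real c \<cdot>\<^sub>v (of_real b \<cdot>\<^sub>v x)"
      using normalize_vec[OF x(1,2)] by blast
    moreover have "C *\<^sub>v (of_real b \<cdot>\<^sub>v x) = 0\<^sub>v r"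
      by (subst mult_mat_vec[OF C x(1)]) (auto simp: x(3))
    ultimately show ?thesis using x(1) by (metis smult_carrier_vec)
  qed
  have rR: "rip y (A *\<^sub>v y) = R (\<lambda>i. if i < n then y $ i else 0)" if y: "y \<in> carrier_vec n" for y
    using y A by (simp add: rip_def R_def mult_mat_vec_index[OF A y] del: index_mult_mat_vec)
  have "S \<noteq> {}"
    using homogeneous_system_nontrivial[OF C rn] normalize inS by blast
  then obtain f where f: "f \<in> S" "\<And>g. g \<in> S \<Longrightarrow> R g \<le> R f"
    using continuous_attains_sup[OF \<open>compact S\<close> _ contR] by blast
  define v where "v = vec n f"
  have v: "v \<in> carrier_vec n" by (simp add: v_def)
  have fv: "f = (\<lambda>i. if i < n then v $ i else 0)"
  proof
    fix i
    have "f i \<in> (if i < n then cball 0 1 else {0})"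
      using f(1) unfolding S_def K_def by blast
    then show "f i = (if i < n then v $ i else 0)" by (auto simp: v_def split: if_splits)
  qed
  have Cv: "C *\<^sub>v v = 0\<^sub>v r"
  proof (rule eq_vecI)
    fix i assume "i < dim_vec (0\<^sub>v r :: 'a vec)"
    then show "(C *\<^sub>v v) $ i = 0\<^sub>v r $ i"
      using f(1) mult_mat_vec_index[OF C v, of i] by (simp add: S_def v_def)
  qed (use C in simp)
  have vv: "rip v v = 1" using f(1) by (simp add: rip_self v_def S_def)
  have "rip x (A *\<^sub>v x) \<le> rip v (A *\<^sub>v v) * rip x x"
    if x: "x \<in> carrier_vec n" "C *\<^sub>v x = 0\<^sub>v r" for x
  proof (cases "x = 0\<^sub>v n")
    case True
    then show ?thesis using A by (simp add: rip_def)
  next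
    case False
    then obtain y c where y: "y \<in> carrier_vec n" "rip y y = 1" "C *\<^sub>v y = 0\<^sub>v r" "x = of_real c \<cdot>\<^sub>v y"
      using normalize x by blast
    have Ay: "A *\<^sub>v y \<in> carrier_vec n" using A y by simp
    have "rip y (A *\<^sub>v y) \<le> rip v (A *\<^sub>v v)"
      unfolding rR[OF y(1)] rR[OF v] fv[symmetric] by (rule f(2)[OF inS[OF y(1-3)]])
    moreover have "rip x (A *\<^sub>v x) = c * (c * rip y (A *\<^sub>v y))"
      unfolding y(4) mult_mat_vec[OF A y(1)] using y(1) Ay
      by (simp add: rip_smult_left[of _ n] rip_smult_right[of _ n])
    moreover have "rip x x = c * c"
      unfolding y(4) using y(1,2) by (simp add: rip_smult_left[of _ n] rip_smult_right[of _ n])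
    ultimately show ?thesis
      using mult_left_mono[of "rip y (A *\<^sub>v y)" "rip v (A *\<^sub>v v)" "c * c"] by (simp add: mult_ac)
  qed
  then show ?thesis using v Cv vv by blast
qed

section \<open>Spectral theorem\<close>

definition unitary_mats :: "nat \<Rightarrow> 'a::rcfield mat set" where
  "unitary_mats n = {U \<in> carrier_mat n n. mat_adjoint U * U = 1\<^sub>m n}"

definition selfadjoint_mats :: "nat \<Rightarrow> 'a::rcfield mat set" where
  "selfadjoint_mats n = {A \<in> carrier_mat n n. mat_adjoint A = A}"

definition real_diag :: "nat \<Rightarrow> (nat \<Rightarrow> real) \<Rightarrow> 'a::rcfield mat" where
  "real_diag n d = mat n n (\<lambda>(i, j). if i = j then of_real (d i) else 0)"

lemma unitary_matsD:
  assumes "U \<in> unitary_mats n"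
  shows "U \<in> carrier_mat n n" "mat_adjoint U * U = 1\<^sub>m n" "U * mat_adjoint U = 1\<^sub>m n"
proof -
  show U: "U \<in> carrier_mat n n" "mat_adjoint U * U = 1\<^sub>m n"
    using assms by (auto simp: unitary_mats_def)
  then show "U * mat_adjoint U = 1\<^sub>m n"
    using mat_mult_left_right_inverse[of "mat_adjoint U" n U] by simp
qed

lemma unitary_mats_adjoint:
  assumes "U \<in> unitary_mats n"
  shows "mat_adjoint U \<in> unitary_mats n"
  using unitary_matsD[OF assms] by (simp add: unitary_mats_def[of n])

lemma unitary_mats_mult:
  assumes "U \<in> unitary_mats n" "V \<in> unitary_mats n"
  shows "U * V \<in> unitary_mats n"
proof -
  note U = unitary_matsD[OF assms(1)] and V = unitary_matsD[OF assms(2)]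
  have "mat_adjoint (U * V) * (U * V) = mat_adjoint V * (mat_adjoint U * U) * V"
    using U(1) V(1) mat_adjoint_carrier[OF U(1)] mat_adjoint_carrier[OF V(1)]
    by (simp add: mat_adjoint_mult[OF U(1) V(1)] assoc_mult_mat[of _ n n _ n _ n]
        mult_carrier_mat[of _ n n _ n])
  also have "\<dots> = 1\<^sub>m n"
    using U V mat_adjoint_carrier[OF V(1)] by simp
  finally show ?thesis using U(1) V(1) by (simp add: unitary_mats_def)
qed

lemma unitary_cancel_vec:
  assumes U: "U \<in> unitary_mats n" and x: "x \<in> carrier_vec n"
  shows "mat_adjoint U *\<^sub>v (U *\<^sub>v x) = x" "U *\<^sub>v (mat_adjoint U *\<^sub>v x) = x"
  using unitary_matsD[OF U] mat_adjoint_carrier[OF unitary_matsD(1)[OF U]] x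
  by (simp_all flip: assoc_mult_mat_vec[of _ n n _ n])

lemma rip_unitary:
  assumes U: "U \<in> unitary_mats n" and "x \<in> carrier_vec n" "y \<in> carrier_vec n"
  shows "rip (U *\<^sub>v x) (U *\<^sub>v y) = rip x y"
  using unitary_matsD[OF U] assms
  by (simp add: rip_adjoint[of U n n] unitary_cancel_vec(1))

lemma real_diag_carrier [simp]: "real_diag n d \<in> carrier_mat n n"
  by (simp add: real_diag_def)

lemma dim_real_diag [simp]: "dim_row (real_diag n d) = n" "dim_col (real_diag n d) = n"
  by (simp_all add: real_diag_def)

lemma mat_adjoint_real_diag [simp]: "mat_adjoint (real_diag n d) = real_diag n d"
  by (rule eq_matI) (auto simp: real_diag_def)

lemma real_diag_mult_vec:
  assumes "x \<in> carrier_vec n"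
  shows "real_diag n d *\<^sub>v x = vec n (\<lambda>i. of_real (d i) * x $ i)"
proof (rule eq_vecI)
  fix i assume "i < dim_vec (vec n (\<lambda>i. of_real (d i) * x $ i))"
  then have i: "i < n" by simp
  have "(real_diag n d *\<^sub>v x) $ i = (\<Sum>j<n. (if i = j then of_real (d i) * x $ j else 0))"
    using assms i
    by (simp add: mult_mat_vec_index[of _ n n] real_diag_def mult_delta_left del: index_mult_mat_vec)
  then show "(real_diag n d *\<^sub>v x) $ i = vec n (\<lambda>i. of_real (d i) * x $ i) $ i"
    using i by simp
qed (simp add: real_diag_def)

lemma rip_real_diag:
  assumes "x \<in> carrier_vec n"
  shows "rip x (real_diag n d *\<^sub>v x) = (\<Sum>i<n. d i * (norm (x $ i))\<^sup>2)"
  using assms by (simp add: real_diag_mult_vec rip_def inner_of_real_mult power2_norm_eq_inner)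

lemma rip_conjugated_real_diag:
  assumes Q: "Q \<in> unitary_mats n" and x: "x \<in> carrier_vec n"
  shows "rip x (Q * real_diag n d * mat_adjoint Q *\<^sub>v x) = (\<Sum>i<n. d i * (norm ((mat_adjoint Q *\<^sub>v x) $ i))\<^sup>2)"
proof -
  note Qc = unitary_matsD(1)[OF Q]
  define b where "b = mat_adjoint Q *\<^sub>v x"
  have b: "b \<in> carrier_vec n" using mat_adjoint_carrier[OF Qc] x by (simp add: b_def)
  have D: "real_diag n d *\<^sub>v b \<in> carrier_vec n" using b by (simp add: real_diag_mult_vec)
  have "Q * real_diag n d * mat_adjoint Q *\<^sub>v x = Q *\<^sub>v (real_diag n d *\<^sub>v b)"
    using Qc mat_adjoint_carrier[OF Qc] x
    by (simp add: b_def assoc_mult_mat_vec[of _ n n _ n] mult_carrier_mat[of _ n n _ n]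
        mult_mat_vec_carrier[of _ n n])
  moreover have "x = Q *\<^sub>v b" using unitary_cancel_vec(2)[OF Q x] by (simp add: b_def)
  ultimately have "rip x (Q * real_diag n d * mat_adjoint Q *\<^sub>v x) = rip b (real_diag n d *\<^sub>v b)"
    using rip_unitary[OF Q b D] by simp
  then show ?thesis using rip_real_diag[OF b, of d] by (simp add: b_def)
qed

text \<open>This evaluates the definite description in \<open>eigvals\<close>: the characteristic
  polynomial is a similarity invariant, and that of a diagonal matrix is already factored.\<close>

lemma eigvals_conjugated_real_diag:
  assumes Q: "Q \<in> unitary_mats n" and d: "\<And>i j. i \<le> j \<Longrightarrow> j < n \<Longrightarrow> d j \<le> d i"
  shows "eigvals (Q * real_diag n d * mat_adjoint Q) = map d [0..<n]"
proof (rule eigvals_eqI)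
  note Qu = unitary_matsD[OF Q]
  show "sorted_wrt (\<ge>) (map d [0..<n])"
    using d by (auto simp: sorted_wrt_iff_nth_less)
  have "similar_mat_wit (Q * real_diag n d * mat_adjoint Q) (real_diag n d) Q (mat_adjoint Q)"
    using Qu by (intro similar_mat_witI[of _ _ n]) auto
  then have "char_poly (Q * real_diag n d * mat_adjoint Q) = char_poly (real_diag n d)"
    by (intro char_poly_similar) (auto simp: similar_mat_def)
  also have "\<dots> = (\<Prod>a\<leftarrow>diag_mat (real_diag n d :: 'a mat). [:- a, 1:])"
    by (rule char_poly_upper_triangular[of _ n]) (auto simp: real_diag_def)
  also have "diag_mat (real_diag n d :: 'a mat) = map (\<lambda>i. of_real (d i)) [0..<n]"
    by (simp add: diag_mat_def real_diag_def)
  finally show "char_poly (Q * real_diag n d * mat_adjoint Q) = (\<Prod>x\<leftarrow>map d [0..<n]. [:- of_real x, 1:])"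
    by (simp add: comp_def)
qed

lemma selfadjointD:
  assumes "A \<in> selfadjoint_mats n"
  shows "A \<in> carrier_mat n n" "mat_adjoint A = A"
  using assms by (auto simp: selfadjoint_mats_def)

lemma selfadjoint_congruence:
  fixes A :: "'a::rcfield mat"
  assumes A: "A \<in> selfadjoint_mats n" and U: "U \<in> carrier_mat n n"
  shows "mat_adjoint U * A * U \<in> selfadjoint_mats n"
proof -
  note Ad = selfadjointD[OF A]
  have c: "mat_adjoint U \<in> carrier_mat n n" "mat_adjoint U * A \<in> carrier_mat n n"
    "mat_adjoint U * A * U \<in> carrier_mat n n"
    using U Ad(1) by (auto intro: mult_carrier_mat[of _ n n])
  have "mat_adjoint (mat_adjoint U * A * U) = mat_adjoint U * A * U"
    unfolding mat_adjoint_mult[OF c(2) U] mat_adjoint_mult[OF c(1) Ad(1)] Ad(2)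
    using U c(1) Ad(1) by (simp add: assoc_mult_mat[of _ n n _ n _ n])
  then show ?thesis using c(3) by (simp add: selfadjoint_mats_def)
qed

lemma selfadjoint_add:
  assumes "A \<in> selfadjoint_mats n" "B \<in> selfadjoint_mats n"
  shows "A + B \<in> selfadjoint_mats n"
  using assms by (simp add: selfadjoint_mats_def mat_adjoint_add[of _ n n])

lemma selfadjoint_real_diag: "real_diag n d \<in> selfadjoint_mats n"
  by (simp add: selfadjoint_mats_def)

lemma cscalar_selfadjoint:
  fixes A :: "'a::rcfield mat"
  assumes A: "A \<in> selfadjoint_mats n" and x: "x \<in> carrier_vec n" and y: "y \<in> carrier_vec n"
  shows "(A *\<^sub>v x) \<bullet>c y = x \<bullet>c (A *\<^sub>v y)"
proof -
  note Ad = selfadjointD[OF A]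
  have Aij: "conjugate (A $$ (i, j)) = A $$ (j, i)" if "i < n" "j < n" for i j
    using mat_adjoint_index[of j A i] Ad that by simp
  have "(A *\<^sub>v x) \<bullet>c y = (\<Sum>i<n. \<Sum>j<n. A $$ (i, j) * x $ j * conjugate (y $ i))"
    using Ad x y mult_mat_vec_index[OF Ad(1) x]
    by (simp add: scalar_prod_def[of _ "conjugate _"] sum_distrib_right lessThan_atLeast0 del: index_mult_mat_vec)
  also have "\<dots> = (\<Sum>j<n. \<Sum>i<n. A $$ (i, j) * x $ j * conjugate (y $ i))"
    by (rule sum.swap)
  also have "\<dots> = (\<Sum>j<n. x $ j * conjugate (\<Sum>i<n. A $$ (j, i) * y $ i))"
    by (simp add: sum_conjugate sum_distrib_left conjugate_dist_mul Aij mult_ac)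
  also have "\<dots> = x \<bullet>c (A *\<^sub>v y)"
    using Ad x y mult_mat_vec_index[OF Ad(1) y]
    by (simp add: scalar_prod_def[of _ "conjugate _"] lessThan_atLeast0 del: index_mult_mat_vec)
  finally show ?thesis .
qed

text \<open>Orthogonality to finitely many vectors becomes a matrix kernel, the form in which
  subspaces enter the maximization of the Rayleigh quotient.\<close>

lemma orthogonal_constraints:
  fixes v :: "nat \<Rightarrow> 'a::rcfield vec"
  assumes "\<And>i. i < k \<Longrightarrow> v i \<in> carrier_vec n"
  defines "C \<equiv> mat k n (\<lambda>(i, j). conjugate (v i $ j))"
  assumes x: "x \<in> carrier_vec n"
  shows "C *\<^sub>v x = 0\<^sub>v k \<longleftrightarrow> (\<forall>i<k. x \<bullet>c v i = 0)"
proof -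
  have C: "C \<in> carrier_mat k n" by (simp add: C_def)
  have "(C *\<^sub>v x) $ i = x \<bullet>c v i" if "i < k" for i
    using that assms(1)[OF that] x mult_mat_vec_index[OF C x that]
    by (simp add: scalar_prod_def[of _ "conjugate _"] C_def lessThan_atLeast0 mult.commute del: index_mult_mat_vec)
  moreover have "C *\<^sub>v x = 0\<^sub>v k \<longleftrightarrow> (\<forall>i<k. (C *\<^sub>v x) $ i = 0)"
  proof
    assume r: "\<forall>i<k. (C *\<^sub>v x) $ i = 0"
    show "C *\<^sub>v x = 0\<^sub>v k"
      by (rule eq_vecI) (use C r in \<open>auto simp del: index_mult_mat_vec\<close>)
  qed (simp del: index_mult_mat_vec)
  ultimately show ?thesis by auto
qed

lemma rip_selfadjoint:
  fixes A :: "'a::rcfield mat"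
  assumes A: "A \<in> selfadjoint_mats n" and x: "x \<in> carrier_vec n" and y: "y \<in> carrier_vec n"
  shows "rip (A *\<^sub>v x) y = rip x (A *\<^sub>v y)"
  using rip_adjoint[OF selfadjointD(1)[OF A] x y] selfadjointD[OF A] by simp

text \<open>A maximizer of the Rayleigh quotient on an invariant subspace is an eigenvector, because
  the first variation vanishes in every direction of the subspace.\<close>

lemma eigenvector_in_subspace:
  fixes A :: "'a::rcfield mat"
  assumes A: "A \<in> selfadjoint_mats n" and C: "C \<in> carrier_mat r n" and rn: "r < n"
    and inv: "\<And>x. x \<in> carrier_vec n \<Longrightarrow> C *\<^sub>v x = 0\<^sub>v r \<Longrightarrow> C *\<^sub>v (A *\<^sub>v x) = 0\<^sub>v r"
  shows "\<exists>v\<in>carrier_vec n. \<exists>l. C *\<^sub>v v = 0\<^sub>v r \<and> rip v v = 1 \<and> A *\<^sub>v v = of_real l \<cdot>\<^sub>v v \<and>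
    (\<forall>x\<in>carrier_vec n. C *\<^sub>v x = 0\<^sub>v r \<longrightarrow> rip x (A *\<^sub>v x) \<le> l * rip x x)"
proof -
  note Ac = selfadjointD(1)[OF A]
  obtain v where v: "v \<in> carrier_vec n" "C *\<^sub>v v = 0\<^sub>v r" "rip v v = 1"
    and max: "\<And>x. x \<in> carrier_vec n \<Longrightarrow> C *\<^sub>v x = 0\<^sub>v r \<Longrightarrow>
      rip x (A *\<^sub>v x) \<le> rip v (A *\<^sub>v v) * rip x x"
    using rayleigh_maximizer[OF Ac C rn] by blast
  define l where "l = rip v (A *\<^sub>v v)"
  \<comment> \<open>The residual \<open>w\<close> lies in the subspace because the subspace is
    invariant. Moving from \<open>v\<close> in the direction of \<open>w\<close> itself has first
    variation \<open>2 * rip w w\<close>, so maximality forces \<open>w\<close> to vanish.\<close>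
  define w where "w = A *\<^sub>v v + of_real (- l) \<cdot>\<^sub>v v"
  have Av: "A *\<^sub>v v \<in> carrier_vec n" using Ac v by simp
  have w: "w \<in> carrier_vec n" using Av v by (simp add: w_def)
  have Aw: "A *\<^sub>v w \<in> carrier_vec n" using Ac w by simp
  have "C *\<^sub>v w = C *\<^sub>v (A *\<^sub>v v) + of_real (- l) \<cdot>\<^sub>v (C *\<^sub>v v)"
    unfolding w_def using C Av v(1) mult_mat_vec[OF C v(1)]
    by (simp add: mult_add_distrib_mat_vec[OF C Av] del: of_real_minus)
  then have Cw: "C *\<^sub>v w = 0\<^sub>v r" using inv[OF v(1,2)] v(2) by auto
  have "t * (2 * rip w w) + t\<^sup>2 * (rip w (A *\<^sub>v w) - l * rip w w) \<le> 0" for t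
  proof -
    define x where "x = v + of_real t \<cdot>\<^sub>v w"
    have x: "x \<in> carrier_vec n" using v w by (simp add: x_def)
    have tw: "of_real t \<cdot>\<^sub>v w \<in> carrier_vec n" using w by simp
    have "C *\<^sub>v x = 0\<^sub>v r"
      unfolding x_def mult_add_distrib_mat_vec[OF C v(1) tw] mult_mat_vec[OF C w]
      by (auto simp: v(2) Cw)
    from max[OF x this] have le: "rip x (A *\<^sub>v x) \<le> l * rip x x" by (simp add: l_def)
    have Ax: "A *\<^sub>v x = A *\<^sub>v v + of_real t \<cdot>\<^sub>v (A *\<^sub>v w)"
      unfolding x_def mult_add_distrib_mat_vec[OF Ac v(1) tw] mult_mat_vec[OF Ac w] ..
    have sy: "rip v (A *\<^sub>v w) = rip w (A *\<^sub>v v)"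
      using rip_selfadjoint[OF A v(1) w] rip_commute[of "A *\<^sub>v v" w] Av w Ac by simp
    have e1: "rip x (A *\<^sub>v x) = l + 2 * t * rip w (A *\<^sub>v v) + t\<^sup>2 * rip w (A *\<^sub>v w)"
      unfolding Ax l_def unfolding x_def using v(1) w Av Aw tw
      by (simp add: rip_add_left[of _ n] rip_add_right[of _ n] rip_smult_left[of _ n]
          rip_smult_right[of _ n] sy algebra_simps power2_eq_square)
    have e2: "rip x x = 1 + 2 * t * rip w v + t\<^sup>2 * rip w w"
      unfolding x_def using v(1,3) w tw rip_commute[of v w]
      by (simp add: rip_add_left[of _ n] rip_add_right[of _ n] rip_smult_left[of _ n]
          rip_smult_right[of _ n] algebra_simps power2_eq_square)
    have e3: "rip w w = rip w (A *\<^sub>v v) - l * rip w v"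
    proof -
      have "rip w w = rip w (A *\<^sub>v v + of_real (- l) \<cdot>\<^sub>v v)" by (simp only: w_def)
      also have "\<dots> = rip w (A *\<^sub>v v) + (- l) * rip w v"
        using v(1) w Av by (simp only: rip_add_right[of _ n] smult_carrier_vec rip_smult_right[of _ n])
      finally show ?thesis by simp
    qed
    have "rip x (A *\<^sub>v x) - l * rip x x =
        t * (2 * rip w w) + t\<^sup>2 * (rip w (A *\<^sub>v w) - l * rip w w)"
      unfolding e1 e2 e3 by (simp add: algebra_simps)
    then show ?thesis using le by linarith
  qed
  from quadratic_linear_coeff_zero[OF this] have "w = 0\<^sub>v n"
    using rip_eq_0_iff[OF w] by simp
  have "A *\<^sub>v v = of_real l \<cdot>\<^sub>v v"
  proof (rule eq_vecI)
    fix i assume "i < dim_vec (of_real l \<cdot>\<^sub>v v)"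
    then have i: "i < n" using v(1) by simp
    have "w $ i = 0" using \<open>w = 0\<^sub>v n\<close> i by simp
    then show "(A *\<^sub>v v) $ i = (of_real l \<cdot>\<^sub>v v) $ i"
      using i v(1) Av unfolding w_def by (simp del: index_mult_mat_vec)
  qed (use Ac v in simp)
  then show ?thesis using v max by (auto simp: l_def)
qed

text \<open>The maximality conjunct is kept because it orders the eigenvalues: for \<open>j\<close>
  beyond \<open>i\<close>, the vector \<open>v j\<close> is admissible in the maximization with
  value \<open>l i\<close>.\<close>

definition greedy_eigenpair ::
  "nat \<Rightarrow> 'a::rcfield mat \<Rightarrow> (nat \<Rightarrow> 'a vec) \<Rightarrow> (nat \<Rightarrow> real) \<Rightarrow> nat \<Rightarrow> bool" where
  "greedy_eigenpair n A v l i \<longleftrightarrow>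
    v i \<in> carrier_vec n \<and> A *\<^sub>v v i = of_real (l i) \<cdot>\<^sub>v v i \<and> rip (v i) (v i) = 1 \<and>
    (\<forall>j<i. v i \<bullet>c v j = 0) \<and>
    (\<forall>x\<in>carrier_vec n. (\<forall>j<i. x \<bullet>c v j = 0) \<longrightarrow> rip x (A *\<^sub>v x) \<le> l i * rip x x)"

lemma greedy_eigenpairs_exist:
  fixes A :: "'a::rcfield mat"
  assumes A: "A \<in> selfadjoint_mats n"
  shows "k \<le> n \<Longrightarrow> \<exists>v l. \<forall>i<k. greedy_eigenpair n A v l i"
proof (induction k)
  case 0
  then show ?case by simp
next
  case (Suc k)
  then obtain v l where vl0: "greedy_eigenpair n A v l i" if "i < k" for i
    by (meson Suc_leD)
  then have vl: "v i \<in> carrier_vec n" "A *\<^sub>v v i = of_real (l i) \<cdot>\<^sub>v v i" "rip (v i) (v i) = 1"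
    "\<forall>j<i. v i \<bullet>c v j = 0"
    "\<forall>x\<in>carrier_vec n. (\<forall>j<i. x \<bullet>c v j = 0) \<longrightarrow> rip x (A *\<^sub>v x) \<le> l i * rip x x"
    if "i < k" for i
    using that by (auto simp: greedy_eigenpair_def)
  define C where "C = mat k n (\<lambda>(i, j). conjugate (v i $ j))"
  have C: "C \<in> carrier_mat k n" by (simp add: C_def)
  have Ciff: "C *\<^sub>v x = 0\<^sub>v k \<longleftrightarrow> (\<forall>i<k. x \<bullet>c v i = 0)" if "x \<in> carrier_vec n" for x
    unfolding C_def by (rule orthogonal_constraints) (use vl(1) that in auto)
  \<comment> \<open>A self-adjoint matrix preserves the orthogonal complement of its
    eigenvectors.\<close>
  have inv: "C *\<^sub>v (A *\<^sub>v x) = 0\<^sub>v k" if x: "x \<in> carrier_vec n" and Cx: "C *\<^sub>v x = 0\<^sub>v k" for x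
  proof -
    have "(A *\<^sub>v x) \<bullet>c v i = 0" if i: "i < k" for i
    proof -
      have "(A *\<^sub>v x) \<bullet>c v i = x \<bullet>c (of_real (l i) \<cdot>\<^sub>v v i)"
        using cscalar_selfadjoint[OF A x vl(1)[OF i]] vl(2)[OF i] by simp
      also have "\<dots> = of_real (l i) * (x \<bullet>c v i)"
        using x vl(1)[OF i] by (simp add: conjugate_smult_vec)
      also have "\<dots> = 0" using Cx Ciff[OF x] i by simp
      finally show ?thesis .
    qed
    then show ?thesis using Ciff[of "A *\<^sub>v x"] selfadjointD(1)[OF A] x by simp
  qed
  obtain u m where u: "u \<in> carrier_vec n" "C *\<^sub>v u = 0\<^sub>v k" "rip u u = 1" "A *\<^sub>v u = of_real m \<cdot>\<^sub>v u"
    "\<forall>x\<in>carrier_vec n. C *\<^sub>v x = 0\<^sub>v k \<longrightarrow> rip x (A *\<^sub>v x) \<le> m * rip x x"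
    using eigenvector_in_subspace[OF A C _ inv] Suc.prems by (metis Suc_le_eq)
  show ?case
  proof (intro exI[of _ "v(k := u)"] exI[of _ "l(k := m)"] allI impI)
    fix i assume "i < Suc k"
    then consider "i < k" | "i = k" by linarith
    then show "greedy_eigenpair n A (v(k := u)) (l(k := m)) i"
    proof cases
      case 1
      \<comment> \<open>At index \<open>i\<close> the predicate reads \<open>v\<close> and
        \<open>l\<close> only up to \<open>i\<close>, so the update at \<open>k\<close> does not
        affect it.\<close>
      then show ?thesis using vl0[OF 1] by (auto simp: greedy_eigenpair_def)
    next
      case 2
      then show ?thesis using u Ciff by (auto simp: greedy_eigenpair_def)
    qed
  qed
qed

theorem spectral_decomposition:
  fixes A :: "'a::rcfield mat"
  assumes A: "A \<in> selfadjoint_mats n"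
  obtains Q d where "Q \<in> unitary_mats n" "\<And>i j. i \<le> j \<Longrightarrow> j < n \<Longrightarrow> d j \<le> d i"
    "A = Q * real_diag n d * mat_adjoint Q"
proof -
  note Ac = selfadjointD(1)[OF A]
  obtain v l where "\<And>i. i < n \<Longrightarrow> greedy_eigenpair n A v l i"
    using greedy_eigenpairs_exist[OF A, of n] by auto
  then have vl: "v i \<in> carrier_vec n" "A *\<^sub>v v i = of_real (l i) \<cdot>\<^sub>v v i" "rip (v i) (v i) = 1"
    "\<forall>j<i. v i \<bullet>c v j = 0"
    "\<forall>x\<in>carrier_vec n. (\<forall>j<i. x \<bullet>c v j = 0) \<longrightarrow> rip x (A *\<^sub>v x) \<le> l i * rip x x"
    if "i < n" for i
    using that by (auto simp: greedy_eigenpair_def)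
  have orth: "v i \<bullet>c v j = (if i = j then 1 else 0)" if "i < n" "j < n" for i j
  proof (cases i j rule: linorder_cases)
    case less
    then have "v j \<bullet>c v i = 0" using vl(4)[OF that(2)] by simp
    then show ?thesis
      using conjugate_conjugate_sprod[of "v j" n "v i"] conjugate_vec_sprod_comm[OF vl(1)[OF that(1)] vl(1)[OF that(2)]]
        vl(1) that less by auto
  qed (use vl that in \<open>auto simp: cscalar_self\<close>)
  define Q where "Q = mat n n (\<lambda>(i, j). v j $ i)"
  have Qc: "Q \<in> carrier_mat n n" by (simp add: Q_def)
  have "mat_adjoint Q * Q = 1\<^sub>m n"
  proof (rule eq_matI)
    fix i j assume "i < dim_row (1\<^sub>m n :: 'a mat)" "j < dim_col (1\<^sub>m n :: 'a mat)"
    then have ij: "i < n" "j < n" by auto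
    have "(mat_adjoint Q * Q) $$ (i, j) = (\<Sum>k<n. conjugate (v i $ k) * v j $ k)"
      using Qc ij by (simp add: scalar_prod_def Q_def lessThan_atLeast0)
    also have "\<dots> = v j \<bullet>c v i"
      using vl(1)[OF ij(1)] vl(1)[OF ij(2)]
      by (simp add: scalar_prod_def[of _ "conjugate _"] lessThan_atLeast0 mult.commute)
    finally show "(mat_adjoint Q * Q) $$ (i, j) = 1\<^sub>m n $$ (i, j)"
      using orth ij by simp
  qed (use Qc in auto)
  then have Q: "Q \<in> unitary_mats n" using Qc by (simp add: unitary_mats_def)
  have mono: "l j \<le> l i" if "i \<le> j" "j < n" for i j
  proof -
    have i: "i < n" using that by simp
    have "\<forall>m<i. v j \<bullet>c v m = 0" using vl(4)[OF that(2)] that(1) by simp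
    then have "rip (v j) (A *\<^sub>v v j) \<le> l i * rip (v j) (v j)"
      using vl(5)[OF i] vl(1)[OF that(2)] by blast
    then show ?thesis
      using vl(1-3)[OF that(2)] by (simp add: rip_smult_right[of _ n])
  qed
  have "A * Q = Q * real_diag n l"
  proof (rule eq_matI)
    fix i j assume "i < dim_row (Q * real_diag n l)" "j < dim_col (Q * real_diag n l)"
    then have ij: "i < n" "j < n" using Qc real_diag_carrier[of n l, where 'a = 'a] by auto
    have "(A * Q) $$ (i, j) = (A *\<^sub>v v j) $ i"
      using Ac Qc ij vl(1)[OF ij(2)] by (simp add: scalar_prod_def Q_def)
    also have "\<dots> = of_real (l j) * v j $ i"
      using vl(1,2)[OF ij(2)] ij by simp
    also have "\<dots> = (\<Sum>k<n. (if k = j then v k $ i * of_real (l k) else 0))"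
      using ij by simp
    also have "\<dots> = (Q * real_diag n l) $$ (i, j)"
      using Qc ij by (auto simp: scalar_prod_def Q_def real_diag_def lessThan_atLeast0 mult_delta_right)
    finally show "(A * Q) $$ (i, j) = (Q * real_diag n l) $$ (i, j)" .
  qed (use Ac Qc in \<open>auto simp: real_diag_def\<close>)
  then have "Q * real_diag n l * mat_adjoint Q = A * (Q * mat_adjoint Q)"
    using Ac Qc mat_adjoint_carrier[OF Qc] by (metis assoc_mult_mat)
  also have "\<dots> = A" using unitary_matsD(3)[OF Q] Ac by simp
  finally show ?thesis using that[OF Q, of l] mono by simp
qed

text \<open>The diagonal \<open>d\<close> is indexed from 0 and \<open>nth_eigval\<close> counts
  from 1, hence the shift in the last conclusion.\<close>

lemma spectral_nth_eigval:
  fixes A :: "'a::rcfield mat"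
  assumes A: "A \<in> selfadjoint_mats n"
  obtains Q d where "Q \<in> unitary_mats n" "\<And>i j. i \<le> j \<Longrightarrow> j < n \<Longrightarrow> d j \<le> d i"
    "A = Q * real_diag n d * mat_adjoint Q" "eigvals A = map d [0..<n]"
    "\<And>k. 1 \<le> k \<Longrightarrow> k \<le> n \<Longrightarrow> nth_eigval k A = d (k - 1)"
proof -
  obtain Q d where Qd: "Q \<in> unitary_mats n" "\<And>i j. i \<le> j \<Longrightarrow> j < n \<Longrightarrow> d j \<le> d i"
    "A = Q * real_diag n d * mat_adjoint Q"
    using spectral_decomposition[OF A] by metis
  have e: "eigvals A = map d [0..<n]"
    using eigvals_conjugated_real_diag[OF Qd(1), of d] Qd(2,3) by simp
  have "nth_eigval k A = d (k - 1)" if "1 \<le> k" "k \<le> n" for k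
    using that by (simp add: nth_eigval_def e)
  from that[OF Qd e this] show ?thesis by simp
qed

section \<open>Variational characterization of the eigenvalues\<close>

lemma rip_eq_adjoint_coords:
  assumes Q: "Q \<in> unitary_mats n" and x: "x \<in> carrier_vec n"
  shows "rip x x = (\<Sum>i<n. (norm ((mat_adjoint Q *\<^sub>v x) $ i))\<^sup>2)"
proof -
  have "rip x x = rip (mat_adjoint Q *\<^sub>v x) (mat_adjoint Q *\<^sub>v x)"
    using rip_unitary[OF unitary_mats_adjoint[OF Q] x x] by simp
  then show ?thesis using unitary_matsD(1)[OF Q] by (simp add: rip_self del: index_mult_mat_vec)
qed

text \<open>These are the optimal constraints in the min-max principle: \<open>C\<close> reads off
  the leading \<open>k - 1\<close> eigencoordinates, and on its kernel only eigenvalues up to the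
  \<open>k\<close>-th contribute.\<close>

lemma eigenbasis_constraints:
  fixes A :: "'a::rcfield mat"
  assumes A: "A \<in> selfadjoint_mats n" and k: "1 \<le> k" "k \<le> n"
  obtains C where "C \<in> carrier_mat (k - 1) n"
    "\<And>x. x \<in> carrier_vec n \<Longrightarrow> C *\<^sub>v x = 0\<^sub>v (k - 1) \<Longrightarrow> rip x (A *\<^sub>v x) \<le> nth_eigval k A * rip x x"
proof -
  obtain Q d where Q: "Q \<in> unitary_mats n" and d: "\<And>i j. i \<le> j \<Longrightarrow> j < n \<Longrightarrow> d j \<le> d i"
    and AQ: "A = Q * real_diag n d * mat_adjoint Q" and ev: "nth_eigval k A = d (k - 1)"
    using spectral_nth_eigval[OF A] k by metis
  note Qc = unitary_matsD(1)[OF Q]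
  define C where "C = mat (k - 1) n (\<lambda>(i, j). mat_adjoint Q $$ (i, j))"
  have C: "C \<in> carrier_mat (k - 1) n" by (simp add: C_def)
  have "rip x (A *\<^sub>v x) \<le> nth_eigval k A * rip x x"
    if x: "x \<in> carrier_vec n" and Cx: "C *\<^sub>v x = 0\<^sub>v (k - 1)" for x
  proof -
    define b where "b = mat_adjoint Q *\<^sub>v x"
    have b0: "b $ i = 0" if i: "i < k - 1" for i
    proof -
      have "b $ i = (C *\<^sub>v x) $ i"
        using i k Qc x C unfolding b_def
        by (simp add: mult_mat_vec_index[of _ n n] mult_mat_vec_index[of _ "k - 1" n] C_def del: index_mult_mat_vec)
      then show ?thesis using Cx i by simp
    qed
    have "rip x (A *\<^sub>v x) = (\<Sum>i<n. d i * (norm (b $ i))\<^sup>2)"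
      unfolding AQ b_def by (rule rip_conjugated_real_diag[OF Q x])
    also have "\<dots> \<le> (\<Sum>i<n. d (k - 1) * (norm (b $ i))\<^sup>2)"
    proof (rule sum_mono)
      fix i assume "i \<in> {..<n}"
      then show "d i * (norm (b $ i))\<^sup>2 \<le> d (k - 1) * (norm (b $ i))\<^sup>2"
        using b0[of i] d[of "k - 1" i] by (cases "i < k - 1") (auto intro: mult_right_mono)
    qed
    also have "\<dots> = nth_eigval k A * rip x x"
      unfolding rip_eq_adjoint_coords[OF Q x] b_def ev by (simp add: sum_distrib_left)
    finally show ?thesis .
  qed
  with C show ?thesis by (rule that)
qed

text \<open>A space of dimension \<open>k\<close> meets the kernel of the \<open>k - 1\<close>
  optimal constraints. The trial space is the image of \<open>X\<close>, and its dimension is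
  secured by demanding that \<open>X\<close> kill no nonzero vector.\<close>

lemma nth_eigval_ge:
  fixes A :: "'a::rcfield mat"
  assumes A: "A \<in> selfadjoint_mats n" and k: "1 \<le> k" "k \<le> n" and X: "X \<in> carrier_mat n k"
    and ge: "\<And>a. a \<in> carrier_vec k \<Longrightarrow> a \<noteq> 0\<^sub>v k \<Longrightarrow> X *\<^sub>v a \<noteq> 0\<^sub>v n \<and>
      z * rip (X *\<^sub>v a) (X *\<^sub>v a) \<le> rip (X *\<^sub>v a) (A *\<^sub>v (X *\<^sub>v a))"
  shows "z \<le> nth_eigval k A"
proof -
  obtain C where C: "C \<in> carrier_mat (k - 1) n" and le: "\<And>x. x \<in> carrier_vec n \<Longrightarrow>
      C *\<^sub>v x = 0\<^sub>v (k - 1) \<Longrightarrow> rip x (A *\<^sub>v x) \<le> nth_eigval k A * rip x x"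
    by (rule eigenbasis_constraints[OF A k]) blast
  obtain a where a: "a \<in> carrier_vec k" "a \<noteq> 0\<^sub>v k" "C * X *\<^sub>v a = 0\<^sub>v (k - 1)"
    using homogeneous_system_nontrivial[of "C * X" "k - 1" k] C X k by auto
  define x where "x = X *\<^sub>v a"
  have x: "x \<in> carrier_vec n" using X a by (simp add: x_def)
  have "C *\<^sub>v x = 0\<^sub>v (k - 1)"
    using a(3) assoc_mult_mat_vec[OF C X a(1)] by (simp add: x_def)
  then have "z * rip x x \<le> nth_eigval k A * rip x x"
    using le[OF x] ge[OF a(1,2)] unfolding x_def[symmetric] by linarith
  moreover have "0 < rip x x" using rip_pos[OF x] ge[OF a(1,2)] by (simp add: x_def)
  ultimately show ?thesis by simp
qed

text \<open>The dual count: the span of the top \<open>k\<close> eigenvectors, the columns of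
  \<open>Y\<close>, meets the kernel of any \<open>k - 1\<close> constraints.\<close>

lemma nth_eigval_le:
  fixes A :: "'a::rcfield mat"
  assumes A: "A \<in> selfadjoint_mats n" and k: "1 \<le> k" "k \<le> n" and C: "C \<in> carrier_mat (k - 1) n"
    and le: "\<And>x. x \<in> carrier_vec n \<Longrightarrow> C *\<^sub>v x = 0\<^sub>v (k - 1) \<Longrightarrow> rip x (A *\<^sub>v x) \<le> z * rip x x"
  shows "nth_eigval k A \<le> z"
proof -
  obtain Q d where Q: "Q \<in> unitary_mats n" and d: "\<And>i j. i \<le> j \<Longrightarrow> j < n \<Longrightarrow> d j \<le> d i"
    and AQ: "A = Q * real_diag n d * mat_adjoint Q" and ev: "nth_eigval k A = d (k - 1)"
    using spectral_nth_eigval[OF A] k by metis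
  note Qc = unitary_matsD(1)[OF Q]
  define Y where "Y = mat n k (\<lambda>(i, j). Q $$ (i, j))"
  have Y: "Y \<in> carrier_mat n k" by (simp add: Y_def)
  obtain a where a: "a \<in> carrier_vec k" "a \<noteq> 0\<^sub>v k" "C * Y *\<^sub>v a = 0\<^sub>v (k - 1)"
    using homogeneous_system_nontrivial[of "C * Y" "k - 1" k] C Y k by auto
  \<comment> \<open>Padding \<open>a\<close> by zeros gives the eigencoordinates of the common
    vector \<open>x\<close> of the two spaces.\<close>
  define b where "b = vec n (\<lambda>i. if i < k then a $ i else 0)"
  have b: "b \<in> carrier_vec n" by (simp add: b_def)
  have b0: "b \<noteq> 0\<^sub>v n"
  proof
    assume z: "b = 0\<^sub>v n"
    have "a $ i = 0" if "i < k" for i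
    proof -
      have "b $ i = 0" using z that k by simp
      then show ?thesis using that k by (simp add: b_def)
    qed
    then have "a = 0\<^sub>v k" using a(1) by (intro eq_vecI) auto
    then show False using a(2) by simp
  qed
  define x where "x = Q *\<^sub>v b"
  have x: "x \<in> carrier_vec n" using Qc b by (simp add: x_def)
  have xY: "x = Y *\<^sub>v a"
  proof (rule eq_vecI)
    fix i assume "i < dim_vec (Y *\<^sub>v a)"
    then have i: "i < n" using Y by simp
    have "x $ i = (\<Sum>j<n. Q $$ (i, j) * b $ j)"
      using i b Qc by (simp add: x_def mult_mat_vec_index[of _ n n] del: index_mult_mat_vec)
    also have "\<dots> = (\<Sum>j<k. Q $$ (i, j) * b $ j)"
      using k by (intro sum.mono_neutral_right) (auto simp: b_def)
    also have "\<dots> = (\<Sum>j<k. Y $$ (i, j) * a $ j)"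
      using k i by (intro sum.cong) (auto simp: b_def Y_def)
    also have "\<dots> = (Y *\<^sub>v a) $ i"
      using i a Y by (simp add: mult_mat_vec_index[of _ n k] del: index_mult_mat_vec)
    finally show "x $ i = (Y *\<^sub>v a) $ i" .
  qed (use x Y in simp)
  have bx: "mat_adjoint Q *\<^sub>v x = b" unfolding x_def by (rule unitary_cancel_vec(1)[OF Q b])
  have "C *\<^sub>v x = 0\<^sub>v (k - 1)"
    using a(3) assoc_mult_mat_vec[OF C Y a(1)] by (simp add: xY)
  from le[OF x this] have le': "rip x (A *\<^sub>v x) \<le> z * rip x x" .
  have xx: "rip x x = rip b b" unfolding x_def by (rule rip_unitary[OF Q b b])
  have "d (k - 1) * rip b b = (\<Sum>i<n. d (k - 1) * (norm (b $ i))\<^sup>2)"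
    using b by (simp add: rip_self sum_distrib_left)
  also have "\<dots> \<le> (\<Sum>i<n. d i * (norm (b $ i))\<^sup>2)"
  proof (rule sum_mono)
    fix i assume "i \<in> {..<n}"
    then show "d (k - 1) * (norm (b $ i))\<^sup>2 \<le> d i * (norm (b $ i))\<^sup>2"
      using d[of i "k - 1"] k by (cases "i < k") (auto simp: b_def intro!: mult_right_mono)
  qed
  also have "\<dots> = rip x (A *\<^sub>v x)"
    unfolding AQ rip_conjugated_real_diag[OF Q x] bx ..
  finally have "d (k - 1) * rip b b \<le> z * rip b b" using le' xx by simp
  then show ?thesis using rip_pos[OF b b0] ev by simp
qed

text \<open>Weyl's inequality: the constraints that are optimal for \<open>B\<close> are tested on
  \<open>A\<close>.\<close>

lemma nth_eigval_mono:
  fixes A B :: "'a::rcfield mat"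
  assumes A: "A \<in> selfadjoint_mats n" and B: "B \<in> selfadjoint_mats n" and k: "1 \<le> k" "k \<le> n"
    and le: "\<And>x. x \<in> carrier_vec n \<Longrightarrow> rip x (A *\<^sub>v x) \<le> rip x (B *\<^sub>v x) + \<eta> * rip x x"
  shows "nth_eigval k A \<le> nth_eigval k B + \<eta>"
proof -
  obtain C where C: "C \<in> carrier_mat (k - 1) n" and leB: "\<And>x. x \<in> carrier_vec n \<Longrightarrow>
      C *\<^sub>v x = 0\<^sub>v (k - 1) \<Longrightarrow> rip x (B *\<^sub>v x) \<le> nth_eigval k B * rip x x"
    by (rule eigenbasis_constraints[OF B k]) blast
  show ?thesis
  proof (rule nth_eigval_le[OF A k C])
    show "rip x (A *\<^sub>v x) \<le> (nth_eigval k B + \<eta>) * rip x x"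
      if "x \<in> carrier_vec n" "C *\<^sub>v x = 0\<^sub>v (k - 1)" for x
      using le[OF that(1)] leB[OF that] by (simp add: distrib_right)
  qed
qed

lemma norm_conjugate [simp]:
  fixes x :: "'a::rcfield"
  shows "norm (conjugate x) = norm x"
proof (cases "x = 0")
  case False
  have "norm x * norm (conjugate x) = norm x * norm x"
    using arg_cong[OF mult_conjugate[of x], of norm] by (simp add: norm_mult power2_eq_square)
  then show ?thesis using False by simp
qed simp

lemma conjugate_diff: "conjugate (a - b :: 'a::rcfield) = conjugate a - conjugate b"
  by (metis conjugate_dist_add conjugate_neg diff_conv_add_uminus)

text \<open>A crude entrywise bound suffices, since it only serves to make eigenvalues continuous in
  the entries.\<close>

lemma rip_mult_le:
  fixes x :: "'a::rcfield vec"
  assumes E: "E \<in> carrier_mat n n" and x: "x \<in> carrier_vec n"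
  shows "rip x (E *\<^sub>v x) \<le> (\<Sum>i<n. \<Sum>j<n. norm (E $$ (i, j))) * rip x x"
proof -
  have nx: "norm (x $ i) * norm (x $ j) \<le> rip x x" if "i < n" "j < n" for i j
  proof -
    have "(norm (x $ k))\<^sup>2 \<le> rip x x" if "k < n" for k
      using x that unfolding rip_self by (intro member_le_sum) auto
    from this[OF that(1)] this[OF that(2)] show ?thesis
      using sum_squares_bound[of "norm (x $ i)" "norm (x $ j)"] by linarith
  qed
  have "rip x (E *\<^sub>v x) = (\<Sum>i<n. \<Sum>j<n. inner (x $ i) (E $$ (i, j) * x $ j))"
    using x mult_mat_vec_index[OF E x] by (simp add: rip_def inner_sum_right del: index_mult_mat_vec)
  also have "\<dots> \<le> (\<Sum>i<n. \<Sum>j<n. norm (E $$ (i, j)) * rip x x)"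
  proof (intro sum_mono)
    fix i j assume ij: "i \<in> {..<n}" "j \<in> {..<n}"
    have "inner (x $ i) (E $$ (i, j) * x $ j) \<le> norm (x $ i) * norm (E $$ (i, j) * x $ j)"
      by (rule norm_cauchy_schwarz)
    also have "\<dots> = norm (E $$ (i, j)) * (norm (x $ i) * norm (x $ j))"
      by (simp add: norm_mult)
    also have "\<dots> \<le> norm (E $$ (i, j)) * rip x x"
      using nx ij by (intro mult_left_mono) auto
    finally show "inner (x $ i) (E $$ (i, j) * x $ j) \<le> norm (E $$ (i, j)) * rip x x" .
  qed
  finally show ?thesis by (simp add: sum_distrib_right)
qed

section \<open>Continuity and measurability of eigenvalues\<close>

lemma nth_eigval_perturbation:
  fixes A B :: "'a::rcfield mat"
  assumes A: "A \<in> selfadjoint_mats n" and B: "B \<in> selfadjoint_mats n" and k: "1 \<le> k" "k \<le> n"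
  shows "\<bar>nth_eigval k A - nth_eigval k B\<bar> \<le> (\<Sum>i<n. \<Sum>j<n. norm (A $$ (i, j) - B $$ (i, j)))"
proof -
  have le: "nth_eigval k A \<le> nth_eigval k B + (\<Sum>i<n. \<Sum>j<n. norm (A $$ (i, j) - B $$ (i, j)))"
    if A: "A \<in> selfadjoint_mats n" and B: "B \<in> selfadjoint_mats n" for A B :: "'a mat"
  proof (rule nth_eigval_mono[OF A B k])
    fix x :: "'a vec" assume x: "x \<in> carrier_vec n"
    note c = selfadjointD(1)[OF A] selfadjointD(1)[OF B]
    have "A = B + (A - B)" using c by (intro eq_matI) auto
    then have "A *\<^sub>v x = (B + (A - B)) *\<^sub>v x" by simp
    also have "\<dots> = B *\<^sub>v x + (A - B) *\<^sub>v x"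
      using c x by (intro add_mult_distrib_mat_vec[of _ n n]) auto
    finally have "rip x (A *\<^sub>v x) = rip x (B *\<^sub>v x) + rip x ((A - B) *\<^sub>v x)"
      using c x by (simp add: rip_add_right[of _ n] mult_mat_vec_carrier[of _ n n] minus_carrier_mat)
    also have "rip x ((A - B) *\<^sub>v x) \<le> (\<Sum>i<n. \<Sum>j<n. norm ((A - B) $$ (i, j))) * rip x x"
      using c x by (intro rip_mult_le) auto
    also have "(\<Sum>i<n. \<Sum>j<n. norm ((A - B) $$ (i, j))) = (\<Sum>i<n. \<Sum>j<n. norm (A $$ (i, j) - B $$ (i, j)))"
      using c by (intro sum.cong refl) auto
    finally show "rip x (A *\<^sub>v x) \<le> rip x (B *\<^sub>v x) + (\<Sum>i<n. \<Sum>j<n. norm (A $$ (i, j) - B $$ (i, j))) * rip x x"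
      by simp
  qed
  have "(\<Sum>i<n. \<Sum>j<n. norm (A $$ (i, j) - B $$ (i, j))) = (\<Sum>i<n. \<Sum>j<n. norm (B $$ (i, j) - A $$ (i, j)))"
    by (simp add: norm_minus_commute)
  then show ?thesis using le[OF A B] le[OF B A] by linarith
qed

text \<open>Symmetrizing first turns the \<open>k\<close>-th eigenvalue into a function that is continuous on the
  whole space of entry tuples.\<close>

lemma borel_measurable_nth_eigval:
  fixes F :: "'w \<Rightarrow> 'a::rcfield mat"
  assumes meas: "\<And>i j. i < n \<Longrightarrow> j < n \<Longrightarrow> (\<lambda>w. F w $$ (i, j)) \<in> borel_measurable M"
    and F: "\<And>w. w \<in> space M \<Longrightarrow> F w \<in> selfadjoint_mats n" and k: "1 \<le> k" "k \<le> n"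
  shows "(\<lambda>w. nth_eigval k (F w)) \<in> borel_measurable M"
proof -
  define c :: real where "c = 1/2"
  define S where "S f = mat n n (\<lambda>(i, j). of_real c * (f (i, j) + conjugate (f (j, i))))"
    for f :: "nat \<times> nat \<Rightarrow> 'a"
  have S: "S f \<in> selfadjoint_mats n" for f
    unfolding selfadjoint_mats_def
  proof (intro CollectI conjI)
    show "mat_adjoint (S f) = S f"
      by (rule eq_matI) (auto simp: S_def conjugate_dist_mul conjugate_dist_add add.commute)
  qed (simp add: S_def)
  define g where "g f = nth_eigval k (S f)" for f
  have bound: "\<bar>g f - g h\<bar> \<le> (\<Sum>i<n. \<Sum>j<n. norm (f (i, j) - h (i, j)) + norm (f (j, i) - h (j, i)))" for f h
  proof -
    have "\<bar>g f - g h\<bar> \<le> (\<Sum>i<n. \<Sum>j<n. norm (S f $$ (i, j) - S h $$ (i, j)))"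
      unfolding g_def by (rule nth_eigval_perturbation[OF S S k])
    also have "\<dots> \<le> (\<Sum>i<n. \<Sum>j<n. norm (f (i, j) - h (i, j)) + norm (f (j, i) - h (j, i)))"
    proof (intro sum_mono)
      fix i j assume "i \<in> {..<n}" "j \<in> {..<n}"
      then have "S f $$ (i, j) - S h $$ (i, j) =
          of_real c * ((f (i, j) - h (i, j)) + conjugate (f (j, i) - h (j, i)))"
        by (simp add: S_def algebra_simps conjugate_diff)
      then have "norm (S f $$ (i, j) - S h $$ (i, j)) =
          c * norm ((f (i, j) - h (i, j)) + conjugate (f (j, i) - h (j, i)))"
        by (simp only: norm_mult norm_of_real) (simp add: c_def)
      also have "\<dots> \<le> c * (norm (f (i, j) - h (i, j)) + norm (f (j, i) - h (j, i)))"
        using norm_triangle_ineq[of "f (i, j) - h (i, j)" "conjugate (f (j, i) - h (j, i))"] by (simp add: c_def)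
      also have "\<dots> \<le> norm (f (i, j) - h (i, j)) + norm (f (j, i) - h (j, i))" by (simp add: c_def)
      finally show "norm (S f $$ (i, j) - S h $$ (i, j)) \<le> norm (f (i, j) - h (i, j)) + norm (f (j, i) - h (j, i))" .
    qed
    finally show ?thesis .
  qed
  have "continuous_on UNIV g"
    unfolding continuous_on_def
  proof
    fix h :: "nat \<times> nat \<Rightarrow> 'a"
    have coord: "((\<lambda>f. f p) \<longlongrightarrow> h p) (at h)" for p
      using continuous_on_product_coordinates[of p] unfolding continuous_on_def by blast
    have "((\<lambda>f. \<Sum>i<n. \<Sum>j<n. norm (f (i, j) - h (i, j)) + norm (f (j, i) - h (j, i))) \<longlongrightarrow>
        (\<Sum>i<n. \<Sum>j<n. norm (h (i, j) - h (i, j)) + norm (h (j, i) - h (j, i)))) (at h)"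
      by (intro tendsto_sum tendsto_add tendsto_norm tendsto_diff coord tendsto_const)
    then have "((\<lambda>f. \<Sum>i<n. \<Sum>j<n. norm (f (i, j) - h (i, j)) + norm (f (j, i) - h (j, i))) \<longlongrightarrow> 0) (at h)"
      by simp
    then have "((\<lambda>f. g f - g h) \<longlongrightarrow> 0) (at h)"
      by (rule Lim_null_comparison[rotated]) (use bound in \<open>auto intro!: always_eventually\<close>)
    then show "(g \<longlongrightarrow> g h) (at h)" using LIM_zero_iff by blast
  qed
  then have g: "g \<in> borel_measurable borel" by (rule borel_measurable_continuous_onI)
  \<comment> \<open>Entries outside the \<open>n\<close> by \<open>n\<close> block are set to 0, so
    that \<open>e\<close> takes values in the full product space on which \<open>g\<close> is
    continuous.\<close>
  define e where "e w = (\<lambda>(i, j). if i < n \<and> j < n then F w $$ (i, j) else 0)" for w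
  have "e \<in> measurable M (Pi\<^sub>M UNIV (\<lambda>_. borel))"
  proof (rule measurable_PiM_single')
    fix p :: "nat \<times> nat"
    show "(\<lambda>w. e w p) \<in> borel_measurable M"
    proof (cases "fst p < n \<and> snd p < n")
      case True
      then have "(\<lambda>w. e w p) = (\<lambda>w. F w $$ (fst p, snd p))" by (auto simp: e_def split_beta)
      then show ?thesis using meas[of "fst p" "snd p"] True by simp
    next
      case False
      then have "(\<lambda>w. e w p) = (\<lambda>w. 0)" by (auto simp: e_def split_beta)
      then show ?thesis by simp
    qed
  qed auto
  then have e: "e \<in> measurable M borel"
    using sets_PiM_equal_borel measurable_cong_sets by blast
  have "nth_eigval k (F w) = g (e w)" if "w \<in> space M" for w
  proof -
    note Fw = selfadjointD[OF F[OF that]]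
    have "S (e w) = F w"
    proof (rule eq_matI)
      fix i j assume "i < dim_row (F w)" "j < dim_col (F w)"
      then have ij: "i < n" "j < n" using Fw by auto
      have "conjugate (F w $$ (j, i)) = F w $$ (i, j)"
        using mat_adjoint_index[of i "F w" j] Fw ij by simp
      then show "S (e w) $$ (i, j) = F w $$ (i, j)"
        using ij by (simp add: S_def e_def c_def field_simps)
    qed (use Fw in \<open>auto simp: S_def\<close>)
    then show ?thesis by (simp add: g_def)
  qed
  moreover have "(\<lambda>w. g (e w)) \<in> borel_measurable M" using g e by measurable
  ultimately show ?thesis by (simp cong: measurable_cong)
qed

section \<open>Operator norm, conjugation and change of sign\<close>

lemma eucl_norm_eq: "eucl_norm (v :: 'a::rcfield vec) = sqrt (rip v v)"
  by (simp add: eucl_norm_def L2_set_def rip_self)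

lemma abs_nth_eigval_le_op_norm:
  fixes A :: "'a::rcfield mat"
  assumes A: "A \<in> selfadjoint_mats n" and k: "1 \<le> k" "k \<le> n"
  shows "\<bar>nth_eigval k A\<bar> \<le> op_norm A"
proof -
  obtain Q d where Q: "Q \<in> unitary_mats n" and d: "\<And>i j. i \<le> j \<Longrightarrow> j < n \<Longrightarrow> d j \<le> d i"
    and AQ: "A = Q * real_diag n d * mat_adjoint Q" and ev: "nth_eigval k A = d (k - 1)"
    using spectral_nth_eigval[OF A] k by metis
  note Qc = unitary_matsD(1)[OF Q] and Ac = selfadjointD(1)[OF A]
  define K where "K = (\<Sum>i<n. \<bar>d i\<bar>)"
  have K: "\<bar>d i\<bar> \<le> K" if "i < n" for i
    using that unfolding K_def by (intro member_le_sum) auto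
  have norm_eq: "rip (A *\<^sub>v x) (A *\<^sub>v x) = (\<Sum>i<n. (d i)\<^sup>2 * (norm ((mat_adjoint Q *\<^sub>v x) $ i))\<^sup>2)"
    if x: "x \<in> carrier_vec n" for x
  proof -
    define b where "b = mat_adjoint Q *\<^sub>v x"
    have b: "b \<in> carrier_vec n" using mat_adjoint_carrier[OF Qc] x by (simp add: b_def)
    have D: "real_diag n d *\<^sub>v b \<in> carrier_vec n" using b by (simp add: real_diag_mult_vec)
    have "A *\<^sub>v x = Q *\<^sub>v (real_diag n d *\<^sub>v b)"
      using Qc mat_adjoint_carrier[OF Qc] x unfolding AQ
      by (simp add: b_def assoc_mult_mat_vec[of _ n n _ n] mult_carrier_mat[of _ n n _ n]
          mult_mat_vec_carrier[of _ n n])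
    then have "rip (A *\<^sub>v x) (A *\<^sub>v x) = rip (real_diag n d *\<^sub>v b) (real_diag n d *\<^sub>v b)"
      using rip_unitary[OF Q D D] by simp
    then show ?thesis
      using b by (simp add: real_diag_mult_vec rip_self norm_mult power_mult_distrib b_def[symmetric])
  qed
  \<comment> \<open>A supremum of reals dominates its members only once the set is known to be
    bounded above; the coarse bound \<open>K\<close> is enough for that. The claim itself comes from
    evaluating at a unit eigenvector.\<close>
  have bdd: "bdd_above ((\<lambda>v. eucl_norm (A *\<^sub>v v)) ` {v \<in> carrier_vec (dim_col A). eucl_norm v \<le> 1})"
  proof (rule bdd_aboveI2)
    fix v :: "'a vec" assume "v \<in> {v \<in> carrier_vec (dim_col A). eucl_norm v \<le> 1}"
    then have v: "v \<in> carrier_vec n" "rip v v \<le> 1" using Ac by (auto simp: eucl_norm_eq)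
    have "rip (A *\<^sub>v v) (A *\<^sub>v v) \<le> (\<Sum>i<n. K\<^sup>2 * (norm ((mat_adjoint Q *\<^sub>v v) $ i))\<^sup>2)"
      unfolding norm_eq[OF v(1)]
    proof (intro sum_mono mult_right_mono)
      fix i assume "i \<in> {..<n}"
      then show "(d i)\<^sup>2 \<le> K\<^sup>2" using K[of i] by (intro power2_le_iff_abs_le[THEN iffD2]) auto
    qed simp
    also have "\<dots> = K\<^sup>2 * rip v v"
      unfolding rip_eq_adjoint_coords[OF Q v(1)] by (simp add: sum_distrib_left)
    also have "\<dots> \<le> K\<^sup>2" using v(2) by (simp add: mult_left_le)
    finally show "eucl_norm (A *\<^sub>v v) \<le> sqrt (K\<^sup>2)" unfolding eucl_norm_eq by (rule real_sqrt_le_mono)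
  qed
  define m where "m = k - 1"
  have m: "m < n" using k by (simp add: m_def)
  define v where "v = Q *\<^sub>v unit_vec n (m)"
  have v: "v \<in> carrier_vec n" using Qc by (simp add: v_def)
  have av: "mat_adjoint Q *\<^sub>v v = unit_vec n (m)"
    unfolding v_def by (rule unitary_cancel_vec(1)[OF Q]) simp
  have u: "(norm (unit_vec n (m) $ i :: 'a))\<^sup>2 = (if i = m then 1 else 0)" if "i < n" for i
    using that m by simp
  have vv: "rip v v = 1"
    unfolding rip_eq_adjoint_coords[OF Q v] av using m by (simp add: u del: index_unit_vec)
  have "rip (A *\<^sub>v v) (A *\<^sub>v v) = (d (m))\<^sup>2"
    unfolding norm_eq[OF v] av using m by (simp add: u mult_delta_right del: index_unit_vec)
  then have "\<bar>d (m)\<bar> = eucl_norm (A *\<^sub>v v)" by (simp add: eucl_norm_eq)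
  also have "\<dots> \<le> op_norm A"
    unfolding op_norm_def using v vv Ac by (intro cSUP_upper[OF _ bdd]) (simp add: eucl_norm_eq)
  finally show ?thesis using ev by (simp add: m_def)
qed

lemma eigvals_unitary_conj:
  fixes A :: "'a::rcfield mat"
  assumes A: "A \<in> selfadjoint_mats n" and U: "U \<in> unitary_mats n"
  shows "eigvals (U * A * mat_adjoint U) = eigvals A"
proof -
  obtain Q d where Q: "Q \<in> unitary_mats n" and d: "\<And>i j. i \<le> j \<Longrightarrow> j < n \<Longrightarrow> d j \<le> d i"
    and AQ: "A = Q * real_diag n d * mat_adjoint Q" and ev: "eigvals A = map d [0..<n]"
    using spectral_nth_eigval[OF A] by metis
  note Qc = unitary_matsD(1)[OF Q] and Uc = unitary_matsD(1)[OF U]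
  have "U * A * mat_adjoint U = (U * Q) * real_diag n d * mat_adjoint (U * Q)"
    unfolding AQ mat_adjoint_mult[OF Uc Qc]
    using Qc Uc mat_adjoint_carrier[OF Qc] mat_adjoint_carrier[OF Uc]
    by (simp add: assoc_mult_mat[of _ n n _ n _ n] mult_carrier_mat[of _ n n _ n])
  then show ?thesis
    using eigvals_conjugated_real_diag[OF unitary_mats_mult[OF U Q], of d] d ev by simp
qed

text \<open>Negation reverses the order, hence \<open>rev\<close>. This carries outliers below the
  spectrum to outliers above it.\<close>

lemma eigvals_uminus:
  fixes A :: "'a::rcfield mat"
  assumes A: "A \<in> selfadjoint_mats n"
  shows "eigvals (- A) = rev (map uminus (eigvals A))"
proof -
  obtain Q d where Q: "Q \<in> unitary_mats n" and d: "\<And>i j. i \<le> j \<Longrightarrow> j < n \<Longrightarrow> d j \<le> d i"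
    and AQ: "A = Q * real_diag n d * mat_adjoint Q" and ev: "eigvals A = map d [0..<n]"
    using spectral_nth_eigval[OF A] by metis
  note Qc = unitary_matsD(1)[OF Q]
  show ?thesis
  proof (rule eigvals_eqI)
    show "sorted_wrt (\<ge>) (rev (map uminus (eigvals A)))"
      using d unfolding ev by (auto simp: sorted_wrt_iff_nth_less rev_nth)
    have "- A = Q * real_diag n (\<lambda>i. - d i) * mat_adjoint Q"
    proof -
      have "- real_diag n d = (real_diag n (\<lambda>i. - d i) :: 'a mat)"
        by (rule eq_matI) (auto simp: real_diag_def)
      then have "Q * real_diag n (\<lambda>i. - d i) * mat_adjoint Q = Q * (- real_diag n d) * mat_adjoint Q"
        by simp
      also have "\<dots> = - (Q * real_diag n d) * mat_adjoint Q"
        using Qc by (subst uminus_mult_right_mat) auto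
      also have "\<dots> = - (Q * real_diag n d * mat_adjoint Q)"
        using Qc by (subst uminus_mult_left_mat) auto
      finally show ?thesis unfolding AQ by simp
    qed
    moreover have "similar_mat_wit (Q * real_diag n (\<lambda>i. - d i) * mat_adjoint Q)
        (real_diag n (\<lambda>i. - d i)) Q (mat_adjoint Q)"
      using unitary_matsD[OF Q] by (intro similar_mat_witI[of _ _ n]) auto
    ultimately have "char_poly (- A) = char_poly (real_diag n (\<lambda>i. - d i) :: 'a mat)"
      by (intro char_poly_similar) (auto simp: similar_mat_def)
    also have "\<dots> = (\<Prod>a\<leftarrow>diag_mat (real_diag n (\<lambda>i. - d i) :: 'a mat). [:- a, 1:])"
      by (rule char_poly_upper_triangular[of _ n]) (auto simp: real_diag_def)
    also have "diag_mat (real_diag n (\<lambda>i. - d i) :: 'a mat) = map (\<lambda>i. of_real (- d i)) [0..<n]"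
      by (simp add: diag_mat_def real_diag_def)
    also have "(\<Prod>a\<leftarrow>map (\<lambda>i. of_real (- d i)) [0..<n]. [:- a, 1:]) =
        (\<Prod>x\<leftarrow>rev (map uminus (eigvals A)). [:- of_real x, 1:] :: 'a poly)"
      unfolding ev rev_map[symmetric] prod_list.rev by (simp add: comp_def)
    finally show "char_poly (- A) = (\<Prod>x\<leftarrow>rev (map uminus (eigvals A)). [:- of_real x, 1:])" .
  qed
qed

section \<open>Diagonal perturbations\<close>

text \<open>On the coordinates with \<open>d i\<close> nonzero, scaling by \<open>d i\<close> is
  invertible, so \<open>A\<close> has the same column space as \<open>R\<close>, in which the
  nonzero eigenvalues are replaced by 1. The nonzero columns of \<open>R\<close> are columns of the
  invertible matrix \<open>Q\<close>, hence independent.\<close>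

lemma rank_eq_card_nonzero_eigvals:
  fixes A :: "'a::rcfield mat"
  assumes A: "A \<in> selfadjoint_mats n"
  shows "vec_space.rank n A = length (filter (\<lambda>x. x \<noteq> 0) (eigvals A))"
proof -
  interpret vec_space "TYPE('a)" n .
  obtain Q d where Q: "Q \<in> unitary_mats n" and AQ: "A = Q * real_diag n d * mat_adjoint Q"
    and ev: "eigvals A = map d [0..<n]"
    using spectral_nth_eigval[OF A] by metis
  note Qc = unitary_matsD(1)[OF Q] and Ac = selfadjointD(1)[OF A]
  define I where "I = {i. i < n \<and> d i \<noteq> 0}"
  define R where "R = Q * real_diag n (\<lambda>i. if d i = 0 then 0 else 1)"
  have R: "R \<in> carrier_mat n n" using Qc by (simp add: R_def mult_carrier_mat[of _ n n])
  have Rv: "R *\<^sub>v x = Q *\<^sub>v vec n (\<lambda>i. if d i = 0 then 0 else x $ i)" if x: "x \<in> carrier_vec n" for x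
  proof -
    have "R *\<^sub>v x = Q *\<^sub>v (real_diag n (\<lambda>i. if d i = 0 then 0 else 1) *\<^sub>v x)"
      unfolding R_def using Qc x by (intro assoc_mult_mat_vec[of _ n n _ n]) auto
    also have "real_diag n (\<lambda>i. if d i = 0 then 0 else 1) *\<^sub>v x = vec n (\<lambda>i. if d i = 0 then 0 else x $ i)"
      using x by (auto simp: real_diag_mult_vec)
    finally show ?thesis .
  qed
  have Av: "A *\<^sub>v (Q *\<^sub>v x) = Q *\<^sub>v vec n (\<lambda>i. of_real (d i) * x $ i)" if x: "x \<in> carrier_vec n" for x
  proof -
    have "A *\<^sub>v (Q *\<^sub>v x) = Q *\<^sub>v (real_diag n d *\<^sub>v (mat_adjoint Q *\<^sub>v (Q *\<^sub>v x)))"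
      unfolding AQ using Qc mat_adjoint_carrier[OF Qc] x
      by (simp add: assoc_mult_mat_vec[of _ n n _ n] mult_carrier_mat[of _ n n _ n]
          mult_mat_vec_carrier[of _ n n])
    then show ?thesis
      using x by (simp add: unitary_cancel_vec[OF Q x] real_diag_mult_vec)
  qed
  have "col_space A = col_space R"
    unfolding col_space_eq[OF Ac] col_space_eq[OF R]
  proof (intro Set.set_eqI iffI)
    fix y assume "y \<in> {y \<in> carrier_vec (dim_row A). \<exists>x\<in>carrier_vec (dim_col A). A *\<^sub>v x = y}"
    then obtain x where x: "x \<in> carrier_vec n" "y = A *\<^sub>v x" "y \<in> carrier_vec n" using Ac by auto
    define u where "u = mat_adjoint Q *\<^sub>v x"
    have u: "u \<in> carrier_vec n" using Qc x by (simp add: u_def mult_mat_vec_carrier[of _ n n])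
    have "y = A *\<^sub>v (Q *\<^sub>v u)" using unitary_cancel_vec(2)[OF Q x(1)] x(2) by (simp add: u_def)
    also have "\<dots> = R *\<^sub>v vec n (\<lambda>i. of_real (d i) * u $ i)"
      unfolding Av[OF u] by (subst Rv) (auto intro!: arg_cong[where f = "\<lambda>v. Q *\<^sub>v v"])
    finally show "y \<in> {y \<in> carrier_vec (dim_row R). \<exists>x\<in>carrier_vec (dim_col R). R *\<^sub>v x = y}"
      using R x(3) by auto
  next
    fix y assume "y \<in> {y \<in> carrier_vec (dim_row R). \<exists>x\<in>carrier_vec (dim_col R). R *\<^sub>v x = y}"
    then obtain x where x: "x \<in> carrier_vec n" "y = R *\<^sub>v x" "y \<in> carrier_vec n" using R by auto
    \<comment> \<open>Division by \<open>d i = 0\<close> is harmless: that coordinate is multiplied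
      by \<open>d i\<close> again.\<close>
    define u where "u = vec n (\<lambda>i. of_real (1 / d i) * x $ i)"
    have u: "u \<in> carrier_vec n" by (simp add: u_def)
    have "y = A *\<^sub>v (Q *\<^sub>v u)"
      unfolding Av[OF u] x(2) Rv[OF x(1)]
      by (auto simp: u_def intro!: arg_cong[where f = "\<lambda>v. Q *\<^sub>v v"])
    then show "y \<in> {y \<in> carrier_vec (dim_row A). \<exists>x\<in>carrier_vec (dim_col A). A *\<^sub>v x = y}"
      using Ac Qc u x(3) by (auto simp: mult_mat_vec_carrier[of _ n n])
  qed
  then have "rank A = rank R" unfolding rank_def col_space_def by simp
  have colR: "col R i = (if d i = 0 then 0\<^sub>v n else col Q i)" if "i < n" for i
  proof -
    have "col R i = R *\<^sub>v unit_vec n i" using mat_mult_unit_vec[OF R that] by simp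
    also have "\<dots> = Q *\<^sub>v (if d i = 0 then 0\<^sub>v n else unit_vec n i)"
      by (subst Rv) (use that in \<open>auto intro!: arg_cong[where f = "\<lambda>v. Q *\<^sub>v v"]\<close>)
    also have "\<dots> = (if d i = 0 then 0\<^sub>v n else col Q i)"
      using mat_mult_unit_vec[OF Qc that] Qc by (auto intro!: eq_vecI)
    finally show ?thesis .
  qed
  have cols_R: "set (cols R) = col R ` {..<n}" using R by (auto simp: cols_def)
  have "det (mat_adjoint Q) * det Q = 1"
    using det_mult[of "mat_adjoint Q" n Q] Qc unitary_matsD(2)[OF Q] by simp
  then have liQ: "lin_indpt (set (cols Q))"
    using lin_dep_cols_imp_det_0[OF Qc] by auto
  have IQ: "col Q ` I \<subseteq> set (cols Q)" using Qc by (auto simp: cols_def I_def)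
  have liI: "lin_indpt (col Q ` I)" by (rule subset_li_is_li[OF liQ IQ])
  have "maximal (col Q ` I) (\<lambda>T. T \<subseteq> set (cols R) \<and> lin_indpt T)"
    unfolding maximal_def
  proof (intro conjI allI impI)
    have "col Q i \<in> set (cols R)" if "i \<in> I" for i
      using that colR[of i] unfolding cols_R I_def by (intro image_eqI[of _ _ i]) auto
    then show "col Q ` I \<subseteq> set (cols R)" by auto
    show "lin_indpt (col Q ` I)" by (rule liI)
    \<comment> \<open>An independent set omits the zero vector, and every nonzero column of
      \<open>R\<close> has its index in \<open>I\<close>; nothing can be added.\<close>
    fix T assume T: "col Q ` I \<subseteq> T \<and> T \<subseteq> set (cols R) \<and> lin_indpt T"
    have "T \<subseteq> carrier_vec n" using T R cols_dim[of R] by auto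
    then have "0\<^sub>v n \<notin> T" using T zero_nin_lin_indpt[of T] by auto
    moreover have "v \<in> col Q ` I" if v: "v \<in> set (cols R)" "v \<noteq> 0\<^sub>v n" for v
    proof -
      obtain i where i: "i < n" "v = col R i" using v(1) unfolding cols_R by auto
      then show ?thesis using colR[OF i(1)] v(2) by (auto simp: I_def split: if_splits)
    qed
    ultimately have "T \<subseteq> col Q ` I" using T by blast
    then show "T = col Q ` I" using T by auto
  qed
  then have "rank R = card (col Q ` I)" by (rule rank_card_indpt[OF R])
  also have "\<dots> = card I"
  proof (rule card_image, rule inj_onI)
    fix i j assume ij: "i \<in> I" "j \<in> I" "col Q i = col Q j"
    have "unit_vec n i = (unit_vec n j :: 'a vec)"
      using ij unitary_cancel_vec(1)[OF Q, of "unit_vec n i"] unitary_cancel_vec(1)[OF Q, of "unit_vec n j"]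
        mat_mult_unit_vec[OF Qc, of i] mat_mult_unit_vec[OF Qc, of j] by (simp add: I_def)
    then have "unit_vec n i $ i = (unit_vec n j $ i :: 'a)" by simp
    then show "i = j" using ij by (simp add: I_def split: if_splits)
  qed
  also have "card I = length (filter (\<lambda>x. x \<noteq> 0) (eigvals A))"
    unfolding ev by (simp add: length_filter_conv_card I_def) (intro arg_cong[where f = card], auto)
  finally show ?thesis using \<open>rank A = rank R\<close> by simp
qed

section \<open>Trial vectors for the deterministic diagonal model\<close>

lemma inner_quadratic_bound:
  fixes e c :: "'a::real_inner"
  assumes "r > 0"
  shows "2 * \<alpha> * inner e c \<le> r * (norm c)\<^sup>2 + \<alpha>\<^sup>2 * ((norm e)\<^sup>2 / r)"
proof -
  \<comment> \<open>Young's inequality with weight \<open>r\<close>. Since \<alpha> may be negative,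
    it bounds the inner product from both sides.\<close>
  have "0 \<le> (norm (r *\<^sub>R c - \<alpha> *\<^sub>R e))\<^sup>2" by simp
  also have "\<dots> = r\<^sup>2 * (norm c)\<^sup>2 - 2 * r * \<alpha> * inner e c + \<alpha>\<^sup>2 * (norm e)\<^sup>2"
    unfolding power2_norm_eq_inner
    by (simp add: inner_diff_left inner_diff_right inner_commute[of c e] power2_eq_square algebra_simps)
  also have "\<dots> = r * (r * (norm c)\<^sup>2 - 2 * \<alpha> * inner e c + \<alpha>\<^sup>2 * ((norm e)\<^sup>2 / r))"
    using assms by (simp add: field_simps power2_eq_square[of r])
  finally show ?thesis using assms by (simp add: zero_le_mult_iff)
qed

text \<open>Here \<open>V\<close> is one fixed realization of the random matrix and everything is
  deterministic. Since \<open>p\<close> decreases and \<theta> is its entry at \<open>k - 1\<close>,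
  the first \<open>k\<close> entries are all at least \<theta>.\<close>

locale diagonal_perturbation =
  fixes n :: nat and V :: "'a::rcfield mat" and d p :: "nat \<Rightarrow> real" and k :: nat and \<theta> :: real
  assumes V: "V \<in> unitary_mats n" and p: "\<And>i j. i \<le> j \<Longrightarrow> j < n \<Longrightarrow> p j \<le> p i"
    and k: "1 \<le> k" "k \<le> n" and \<theta>: "\<theta> = p (k - 1)" "\<theta> > 0"
begin

definition W :: "'a mat" where
  "W = mat_adjoint V * real_diag n d * V + real_diag n p"

text \<open>These vectors form the range of \<open>real_diag n p\<close>, the only space on which
  the perturbation acts.\<close>

definition supported :: "'a vec \<Rightarrow> bool" where
  "supported a \<longleftrightarrow> a \<in> carrier_vec n \<and> (\<forall>j<n. p j = 0 \<longrightarrow> a $ j = 0)"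

text \<open>The quadratic form of the inverse of \<open>z - V* D V\<close> with
  \<open>D = real_diag n d\<close>, written in the coordinates where \<open>D\<close> is diagonal,
  so that no matrix has to be inverted.\<close>

definition resolvent_form :: "real \<Rightarrow> 'a vec \<Rightarrow> real" where
  "resolvent_form z a = (\<Sum>i<n. (norm ((V *\<^sub>v a) $ i))\<^sup>2 / (z - d i))"

lemma k_less: "k - 1 < n"
  using k by simp

lemma p_ge: "j < k \<Longrightarrow> \<theta> \<le> p j"
  using p[of j "k - 1"] k_less \<theta>(1) by simp

lemma Vc: "V \<in> carrier_mat n n"
  by (rule unitary_matsD(1)[OF V])

lemma W_selfadjoint: "W \<in> selfadjoint_mats n"
  unfolding W_def by (intro selfadjoint_add selfadjoint_congruence selfadjoint_real_diag Vc)

lemma rip_W: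
  assumes x: "x \<in> carrier_vec n"
  shows "rip x (W *\<^sub>v x) = (\<Sum>i<n. d i * (norm ((V *\<^sub>v x) $ i))\<^sup>2) + (\<Sum>j<n. p j * (norm (x $ j))\<^sup>2)"
proof -
  have c: "mat_adjoint V * real_diag n d * V \<in> carrier_mat n n"
    using Vc by (auto intro: mult_carrier_mat[of _ n n])
  have "W *\<^sub>v x = (mat_adjoint V * real_diag n d * V) *\<^sub>v x + real_diag n p *\<^sub>v x"
    unfolding W_def using c x by (intro add_mult_distrib_mat_vec[of _ n n]) auto
  then have "rip x (W *\<^sub>v x) = rip x ((mat_adjoint V * real_diag n d * V) *\<^sub>v x) + rip x (real_diag n p *\<^sub>v x)"
    using c x by (simp add: rip_add_right[of _ n] mult_mat_vec_carrier[of _ n n])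
  then show ?thesis
    using rip_conjugated_real_diag[OF unitary_mats_adjoint[OF V] x, of d] rip_real_diag[OF x, of p] by simp
qed

lemma rip_V: "x \<in> carrier_vec n \<Longrightarrow> rip x x = (\<Sum>i<n. (norm ((V *\<^sub>v x) $ i))\<^sup>2)"
  using rip_unitary[OF V, of x x] Vc by (simp add: rip_self del: index_mult_mat_vec)

text \<open>Let \<open>y\<close> be the part of \<open>x\<close> in the range of the perturbation.
  Its form at \<open>x\<close> is at most \<theta> times \<open>rip y y\<close>, while pairing
  \<open>y\<close> with \<open>x\<close> through the resolvent shows that \<open>rip y y / m\<close>
  is at most the form of \<open>z - V* D V\<close> at \<open>x\<close>. The condition
  \<open>\<theta> * m \<le> 1\<close> compares the two.\<close>

lemma nth_eigval_upper:
  assumes z: "\<And>i. i < n \<Longrightarrow> d i < z" and m: "m > 0" "\<theta> * m \<le> 1"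
    and form: "\<And>a. supported a \<Longrightarrow> resolvent_form z a \<le> m * rip a a"
  shows "nth_eigval k W \<le> z"
proof -
  define C :: "'a mat" where "C = mat (k - 1) n (\<lambda>(i, j). if i = j then 1 else 0)"
  have C: "C \<in> carrier_mat (k - 1) n" by (simp add: C_def)
  show ?thesis
  proof (rule nth_eigval_le[OF W_selfadjoint k C])
    fix x :: "'a vec" assume x: "x \<in> carrier_vec n" and Cx: "C *\<^sub>v x = 0\<^sub>v (k - 1)"
    have x0: "x $ i = 0" if i: "i < k - 1" for i
    proof -
      have "(C *\<^sub>v x) $ i = x $ i"
        using i k x C by (simp add: mult_mat_vec_index[of _ "k - 1" n] C_def mult_delta_left del: index_mult_mat_vec)
      then show ?thesis using Cx i by simp
    qed
    define y where "y = vec n (\<lambda>j. if p j = 0 then 0 else x $ j)"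
    have y: "y \<in> carrier_vec n" "supported y" by (auto simp: y_def supported_def)
    define c where "c = V *\<^sub>v x"
    define e where "e = V *\<^sub>v y"
    \<comment> \<open>The constraints remove the indices below \<open>k - 1\<close>; from there on
      \<open>p j\<close> is at most \<theta>, and negative entries only help.\<close>
    have "(\<Sum>j<n. p j * (norm (x $ j))\<^sup>2) \<le> (\<Sum>j<n. \<theta> * (norm (y $ j))\<^sup>2)"
    proof (rule sum_mono)
      fix j assume "j \<in> {..<n}"
      then show "p j * (norm (x $ j))\<^sup>2 \<le> \<theta> * (norm (y $ j))\<^sup>2"
        using p[of "k - 1" j] x0[of j] \<theta>(1) by (cases "j < k - 1") (auto simp: y_def intro: mult_right_mono)
    qed
    then have px: "(\<Sum>j<n. p j * (norm (x $ j))\<^sup>2) \<le> \<theta> * rip y y"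
      using y by (simp add: rip_self sum_distrib_left)
    have "rip y y = rip y x"
      using y by (auto simp: rip_def y_def intro!: sum.cong)
    also have "\<dots> = rip e c" unfolding e_def c_def by (rule rip_unitary[OF V y(1) x, symmetric])
    finally have yy: "rip y y = (\<Sum>i<n. inner (e $ i) (c $ i))"
      using Vc by (simp add: rip_def e_def del: index_mult_mat_vec)
    \<comment> \<open>Young's inequality with weight \<open>z - d i\<close> and \<alpha> = 1/m: the
      resolvent form costs one of the two copies of \<open>rip y y / m\<close> and leaves the
      other.\<close>
    have "2 * (1 / m) * rip y y = (\<Sum>i<n. 2 * (1 / m) * inner (e $ i) (c $ i))"
      unfolding yy by (rule sum_distrib_left)
    also have "\<dots> \<le> (\<Sum>i<n. (z - d i) * (norm (c $ i))\<^sup>2 + (1 / m)\<^sup>2 * ((norm (e $ i))\<^sup>2 / (z - d i)))"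
      by (intro sum_mono inner_quadratic_bound) (use z in auto)
    also have "\<dots> = (\<Sum>i<n. (z - d i) * (norm (c $ i))\<^sup>2) + (1 / m)\<^sup>2 * resolvent_form z y"
      by (simp add: sum.distrib resolvent_form_def e_def sum_distrib_left del: index_mult_mat_vec)
    also have "(1 / m)\<^sup>2 * resolvent_form z y \<le> (1 / m)\<^sup>2 * (m * rip y y)"
      by (intro mult_left_mono form y) simp
    also have "(1 / m)\<^sup>2 * (m * rip y y) = (1 / m) * rip y y"
      using m by (simp add: power2_eq_square)
    finally have "(1 / m) * rip y y \<le> (\<Sum>i<n. (z - d i) * (norm (c $ i))\<^sup>2)" by (simp add: field_simps)
    moreover have "\<theta> * rip y y \<le> (1 / m) * rip y y"
      using m by (intro mult_right_mono) (auto simp: field_simps)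
    moreover have "(\<Sum>i<n. (z - d i) * (norm (c $ i))\<^sup>2) = z * rip x x - (\<Sum>i<n. d i * (norm (c $ i))\<^sup>2)"
      unfolding rip_V[OF x] c_def by (simp add: left_diff_distrib sum_subtractf sum_distrib_left)
    ultimately show "rip x (W *\<^sub>v x) \<le> z * rip x x"
      using px unfolding rip_W[OF x] c_def by linarith
  qed
qed

text \<open>Polarization turns bounds on the quadratic form into bounds on its bilinear form. The
  scale \<open>l\<close> is free in order to balance \<open>f\<close> and \<open>y\<close> when
  their sizes differ.\<close>

lemma resolvent_form_polarization:
  assumes f: "f \<in> carrier_vec n" and y: "y \<in> carrier_vec n"
  shows "resolvent_form z (of_real l \<cdot>\<^sub>v f + y) - resolvent_form z (of_real l \<cdot>\<^sub>v f - y) =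
    4 * l * (\<Sum>i<n. inner ((V *\<^sub>v f) $ i) ((V *\<^sub>v y) $ i) / (z - d i))"
proof -
  have lf: "of_real l \<cdot>\<^sub>v f \<in> carrier_vec n" using f by simp
  have pol: "(norm (of_real l * a + b))\<^sup>2 - (norm (of_real l * a - b))\<^sup>2 = 4 * l * inner a b" for a b :: 'a
    unfolding power2_norm_eq_inner
    by (simp add: inner_add_left inner_add_right inner_diff_left inner_diff_right
        inner_of_real_mult inner_commute[of b a] right_diff_distrib distrib_left)
  have "V *\<^sub>v (of_real l \<cdot>\<^sub>v f + y) = of_real l \<cdot>\<^sub>v (V *\<^sub>v f) + V *\<^sub>v y"
    using mult_add_distrib_mat_vec[OF Vc lf y] mult_mat_vec[OF Vc f] by simp
  moreover have "V *\<^sub>v (of_real l \<cdot>\<^sub>v f - y) = of_real l \<cdot>\<^sub>v (V *\<^sub>v f) - V *\<^sub>v y"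
    using mult_minus_distrib_mat_vec[OF Vc lf y] mult_mat_vec[OF Vc f] by simp
  ultimately have "resolvent_form z (of_real l \<cdot>\<^sub>v f + y) - resolvent_form z (of_real l \<cdot>\<^sub>v f - y) =
      (\<Sum>i<n. ((norm (of_real l * (V *\<^sub>v f) $ i + (V *\<^sub>v y) $ i))\<^sup>2 - (norm (of_real l * (V *\<^sub>v f) $ i - (V *\<^sub>v y) $ i))\<^sup>2) / (z - d i))"
    using Vc f y unfolding resolvent_form_def
    by (simp add: diff_divide_distrib sum_subtractf del: index_mult_mat_vec)
  then show ?thesis unfolding pol by (simp add: sum_distrib_left mult.assoc)
qed

lemma rip_polarization:
  assumes f: "f \<in> carrier_vec n" and y: "y \<in> carrier_vec n"
  shows "rip (of_real l \<cdot>\<^sub>v f + y) (of_real l \<cdot>\<^sub>v f + y) = l\<^sup>2 * rip f f + 2 * l * rip f y + rip y y"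
    "rip (of_real l \<cdot>\<^sub>v f - y) (of_real l \<cdot>\<^sub>v f - y) = l\<^sup>2 * rip f f - 2 * l * rip f y + rip y y"
  using f y
  by (simp_all add: rip_def inner_add_left inner_add_right inner_diff_left inner_diff_right
        inner_of_real_mult inner_commute[of "y $ i" "f $ i" for i] sum.distrib sum_subtractf sum_distrib_left
        power2_eq_square algebra_simps)

text \<open>For \<open>y\<close> in the span of the first \<open>k\<close> basis vectors let
  \<open>x\<close> be the resolvent applied to \<open>y\<close>. Then \<open>z * rip x x\<close>
  exceeds the form of \<open>V* D V\<close> at \<open>x\<close> by the resolvent form of
  \<open>y\<close>, at most \<open>(m + \<eta>) * rip y y\<close>. On the range of the perturbation
  \<open>x\<close> is \<open>m * y\<close> plus an error \<open>f\<close> of relative size \<eta>,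
  so its perturbation form is at least \<open>m\<^sup>2 * \<theta> - 2 * m * B * \<eta> - B *
  \<eta>\<^sup>2\<close> times \<open>rip y y\<close>. The hypothesis \<open>gap\<close> says that
  this suffices.\<close>

lemma nth_eigval_lower:
  assumes z: "\<And>i. i < n \<Longrightarrow> d i < z" and B: "\<And>j. j < n \<Longrightarrow> \<bar>p j\<bar> \<le> B" and m: "m > 0" and \<eta>: "\<eta> > 0"
    and form: "\<And>a. supported a \<Longrightarrow> \<bar>resolvent_form z a - m * rip a a\<bar> \<le> \<eta> * rip a a"
    and gap: "m + \<eta> + 2 * m * B * \<eta> + B * \<eta>\<^sup>2 \<le> m\<^sup>2 * \<theta>"
  shows "z \<le> nth_eigval k W"
proof -
  define E :: "'a mat" where "E = mat n k (\<lambda>(i, j). if i = j then 1 else 0)"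
  define R :: "'a mat" where "R = real_diag n (\<lambda>i. 1 / (z - d i))"
  define X where "X = mat_adjoint V * R * V * E"
  have E: "E \<in> carrier_mat n k" by (simp add: E_def)
  have R: "R \<in> carrier_mat n n" by (simp add: R_def)
  have X: "X \<in> carrier_mat n k" using Vc E R by (auto simp: X_def intro!: mult_carrier_mat[of _ n n])
  show ?thesis
  proof (rule nth_eigval_ge[OF W_selfadjoint k X])
    fix a :: "'a vec" assume a: "a \<in> carrier_vec k" "a \<noteq> 0\<^sub>v k"
    define y where "y = E *\<^sub>v a"
    have y: "y \<in> carrier_vec n" using E a by (simp add: y_def)
    have y_index: "y $ j = (if j < k then a $ j else 0)" if "j < n" for j
      using that E a by (simp add: y_def mult_mat_vec_index[of _ n k] E_def mult_delta_left del: index_mult_mat_vec)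
    have supp: "supported y"
      unfolding supported_def
    proof (intro conjI allI impI y)
      fix j assume j: "j < n" "p j = 0"
      then show "y $ j = 0" using p_ge[of j] \<theta>(2) y_index[of j] by (cases "j < k") auto
    qed
    have y0: "y \<noteq> 0\<^sub>v n"
    proof
      assume "y = 0\<^sub>v n"
      then have "a = 0\<^sub>v k" using a(1) k y_index by (intro eq_vecI) (auto, metis index_zero_vec(1) order_less_le_trans)
      then show False using a(2) by simp
    qed
    define e where "e = V *\<^sub>v y"
    have e: "e \<in> carrier_vec n" using Vc y by (simp add: e_def)
    define c where "c = R *\<^sub>v e"
    have c: "c \<in> carrier_vec n" using R e by (simp add: c_def)
    have ci: "c $ i = of_real (1 / (z - d i)) * e $ i" if "i < n" for i
      using that e by (simp add: c_def R_def real_diag_mult_vec)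
    define x where "x = mat_adjoint V *\<^sub>v c"
    have x: "x \<in> carrier_vec n" using mat_adjoint_carrier[OF Vc] c by (simp add: x_def)
    have Vx: "V *\<^sub>v x = c" unfolding x_def by (rule unitary_cancel_vec(2)[OF V c])
    have Xa: "X *\<^sub>v a = x"
      unfolding X_def x_def c_def e_def y_def using Vc R E a mat_adjoint_carrier[OF Vc]
      by (simp add: assoc_mult_mat_vec[of _ n n _ n] assoc_mult_mat_vec[of _ n n _ k]
          mult_carrier_mat[of _ n n _ n] mult_mat_vec_carrier[of _ n n] mult_mat_vec_carrier[of _ n k])
    define t where "t = rip y y"
    have t: "t > 0" unfolding t_def by (rule rip_pos[OF y y0])
    have zc: "(\<Sum>i<n. (z - d i) * (norm (c $ i))\<^sup>2) = resolvent_form z y"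
      unfolding resolvent_form_def e_def[symmetric]
    proof (rule sum.cong[OF refl])
      fix i assume "i \<in> {..<n}"
      then show "(z - d i) * (norm (c $ i))\<^sup>2 = (norm (e $ i))\<^sup>2 / (z - d i)"
        using z[of i] by (simp add: ci norm_mult norm_divide power_divide power2_eq_square del: of_real_divide)
    qed
    \<comment> \<open>The error of \<open>x\<close> against \<open>m * y\<close> is recorded only
      where \<open>p\<close> is nonzero; the other coordinates do not enter the perturbation
      form.\<close>
    define f where "f = vec n (\<lambda>j. if p j = 0 then 0 else x $ j - of_real m * y $ j)"
    have f: "f \<in> carrier_vec n" "supported f" by (auto simp: f_def supported_def)
    define s where "s = rip f f"
    have "s = rip f x - m * rip f y"
      using f(1) by (auto simp: s_def rip_def f_def inner_diff_right inner_of_real_mult sum_subtractf sum_distrib_left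
          simp flip: sum_subtractf intro!: sum.cong)
    also have "rip f x = rip (V *\<^sub>v f) c" using rip_unitary[OF V f(1) x] Vx by simp
    also have "\<dots> = (\<Sum>i<n. inner ((V *\<^sub>v f) $ i) (e $ i) / (z - d i))"
      using Vc by (simp add: rip_def ci inner_of_real_mult del: index_mult_mat_vec of_real_divide)
    finally have s_eq: "s = (\<Sum>i<n. inner ((V *\<^sub>v f) $ i) ((V *\<^sub>v y) $ i) / (z - d i)) - m * rip f y"
      by (simp add: e_def)
    have s: "s \<le> \<eta>\<^sup>2 * t"
    proof -
      \<comment> \<open>This scale gives \<open>f\<close> and \<open>y\<close> comparable weight.
        The resulting inequality bounds \<open>s\<close> by half of itself plus a multiple of
        \<open>t\<close>, and solving it yields \<eta> squared times \<open>t\<close>.\<close>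
      define l where "l = 1 / \<eta>"
      define u v where "u = of_real l \<cdot>\<^sub>v f + y" and "v = of_real l \<cdot>\<^sub>v f - y"
      have uv: "supported u" "supported v"
        using f supp by (auto simp: supported_def u_def v_def)
      have "4 * l * s = (resolvent_form z u - m * rip u u) - (resolvent_form z v - m * rip v v)"
        unfolding s_eq u_def v_def rip_polarization[OF f(1) y]
        using resolvent_form_polarization[OF f(1) y, of z l] by (simp add: algebra_simps)
      also have "\<dots> \<le> \<eta> * (rip u u + rip v v)"
        using form[OF uv(1)] form[OF uv(2)] by (simp add: abs_le_iff algebra_simps)
      also have "rip u u + rip v v = 2 * (l\<^sup>2 * s + t)"
        unfolding u_def v_def rip_polarization[OF f(1) y] by (simp add: s_def t_def)
      finally have "4 * (s / \<eta>) \<le> 2 * (s / \<eta>) + 2 * \<eta> * t"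
        using \<eta> by (simp add: l_def power2_eq_square field_simps)
      then have "s / \<eta> \<le> \<eta> * t" by simp
      then show ?thesis using \<eta> by (simp add: field_simps power2_eq_square)
    qed
    \<comment> \<open>The cross term between \<open>m * y\<close> and \<open>f\<close> is split by
      Young's inequality with weight \<eta>. Because \<open>p j\<close> may have either sign, the
      inner product is bounded from both sides.\<close>
    have summand: "m\<^sup>2 * \<theta> * (norm (y $ j))\<^sup>2 - m * B * (\<eta> * (norm (y $ j))\<^sup>2 + (norm (f $ j))\<^sup>2 / \<eta>) - B * (norm (f $ j))\<^sup>2
        \<le> p j * (norm (x $ j))\<^sup>2" if j: "j < n" for j
    proof (cases "p j = 0")
      case True
      then have "y $ j = 0" "f $ j = 0" using supp f(2) j by (auto simp: supported_def)
      then show ?thesis using True by simp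
    next
      case False
      then have xj: "x $ j = of_real m * y $ j + f $ j" using j by (simp add: f_def)
      have sq: "(norm (x $ j))\<^sup>2 = m\<^sup>2 * (norm (y $ j))\<^sup>2 + 2 * m * inner (y $ j) (f $ j) + (norm (f $ j))\<^sup>2"
        unfolding xj power2_norm_eq_inner by (simp add: inner_add_left inner_add_right inner_of_real_mult
            inner_commute[of "f $ j" "y $ j"] power2_eq_square algebra_simps)
      have 1: "\<theta> * (norm (y $ j))\<^sup>2 \<le> p j * (norm (y $ j))\<^sup>2"
        using p_ge[of j] y_index[OF j] by (cases "j < k") (auto intro!: mult_right_mono)
      have "2 * inner (y $ j) (f $ j) \<le> \<eta> * (norm (y $ j))\<^sup>2 + (norm (f $ j))\<^sup>2 / \<eta>"
        using inner_quadratic_bound[OF \<eta>, of 1 "f $ j" "y $ j"] by (simp add: inner_commute[of "f $ j" "y $ j"])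
      moreover have "- (2 * inner (y $ j) (f $ j)) \<le> \<eta> * (norm (y $ j))\<^sup>2 + (norm (f $ j))\<^sup>2 / \<eta>"
        using inner_quadratic_bound[OF \<eta>, of "-1" "f $ j" "y $ j"] by (simp add: inner_commute[of "f $ j" "y $ j"])
      ultimately have "\<bar>2 * inner (y $ j) (f $ j)\<bar> \<le> \<eta> * (norm (y $ j))\<^sup>2 + (norm (f $ j))\<^sup>2 / \<eta>" by linarith
      then have "\<bar>p j\<bar> * \<bar>2 * inner (y $ j) (f $ j)\<bar> \<le> B * (\<eta> * (norm (y $ j))\<^sup>2 + (norm (f $ j))\<^sup>2 / \<eta>)"
        using B[OF j] by (intro mult_mono) auto
      then have "\<bar>p j * (2 * inner (y $ j) (f $ j))\<bar> \<le> B * (\<eta> * (norm (y $ j))\<^sup>2 + (norm (f $ j))\<^sup>2 / \<eta>)"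
        by (simp only: abs_mult)
      then have 2: "- (B * (\<eta> * (norm (y $ j))\<^sup>2 + (norm (f $ j))\<^sup>2 / \<eta>)) \<le> p j * (2 * inner (y $ j) (f $ j))"
        by linarith
      have 3: "- (B * (norm (f $ j))\<^sup>2) \<le> p j * (norm (f $ j))\<^sup>2"
        using B[OF j] mult_right_mono[of "- B" "p j" "(norm (f $ j))\<^sup>2"] by simp
      have "m\<^sup>2 * (\<theta> * (norm (y $ j))\<^sup>2) + m * (- (B * (\<eta> * (norm (y $ j))\<^sup>2 + (norm (f $ j))\<^sup>2 / \<eta>))) - B * (norm (f $ j))\<^sup>2
          \<le> m\<^sup>2 * (p j * (norm (y $ j))\<^sup>2) + m * (p j * (2 * inner (y $ j) (f $ j))) + p j * (norm (f $ j))\<^sup>2"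
        using mult_left_mono[OF 1 zero_le_power2[of m]] mult_left_mono[OF 2 less_imp_le[OF m]] 3
        by linarith
      also have "\<dots> = p j * (norm (x $ j))\<^sup>2" unfolding sq by (simp add: algebra_simps)
      finally show ?thesis by (simp add: algebra_simps)
    qed
    have "m\<^sup>2 * \<theta> * t - m * B * (\<eta> * t + s / \<eta>) - B * s \<le> (\<Sum>j<n. p j * (norm (x $ j))\<^sup>2)"
    proof -
      have "m\<^sup>2 * \<theta> * t - m * B * (\<eta> * t + s / \<eta>) - B * s =
        (\<Sum>j<n. m\<^sup>2 * \<theta> * (norm (y $ j))\<^sup>2 - m * B * (\<eta> * (norm (y $ j))\<^sup>2 + (norm (f $ j))\<^sup>2 / \<eta>) - B * (norm (f $ j))\<^sup>2)"
        using y f(1)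
        by (simp add: t_def s_def rip_self sum_subtractf sum.distrib sum_distrib_left sum_divide_distrib distrib_left)
      also have "\<dots> \<le> (\<Sum>j<n. p j * (norm (x $ j))\<^sup>2)"
        by (intro sum_mono summand) simp
      finally show ?thesis .
    qed
    moreover have "m * B * (\<eta> * t + s / \<eta>) \<le> m * B * (2 * \<eta> * t)"
    proof (rule mult_left_mono)
      have "s / \<eta> \<le> \<eta> * t" using s \<eta> by (simp add: field_simps power2_eq_square)
      then show "\<eta> * t + s / \<eta> \<le> 2 * \<eta> * t" by simp
      have "0 \<le> B" using B[of "k - 1"] k by force
      then show "0 \<le> m * B" using m by simp
    qed
    moreover have "B * s \<le> B * (\<eta>\<^sup>2 * t)"
    proof (rule mult_left_mono[OF s])
      show "0 \<le> B" using B[of "k - 1"] k by force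
    qed
    moreover have "resolvent_form z y \<le> (m + \<eta>) * t"
      using form[OF supp] by (simp add: abs_le_iff t_def algebra_simps)
    moreover have "(m + \<eta> + 2 * m * B * \<eta> + B * \<eta>\<^sup>2) * t \<le> m\<^sup>2 * \<theta> * t"
      using gap t by (intro mult_right_mono) auto
    ultimately have key: "resolvent_form z y \<le> (\<Sum>j<n. p j * (norm (x $ j))\<^sup>2)"
      by (simp add: algebra_simps)
    have "z * rip x x - (\<Sum>i<n. d i * (norm (c $ i))\<^sup>2) = (\<Sum>i<n. (z - d i) * (norm (c $ i))\<^sup>2)"
      unfolding rip_V[OF x] Vx by (simp add: left_diff_distrib sum_subtractf sum_distrib_left)
    then have le: "z * rip x x \<le> rip x (W *\<^sub>v x)"
      using key zc unfolding rip_W[OF x] Vx by linarith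
    have "x \<noteq> 0\<^sub>v n"
    proof
      assume "x = 0\<^sub>v n"
      then have "c = 0\<^sub>v n" using Vx Vc by auto
      then have "e $ i = 0" if "i < n" for i using ci[OF that] z[OF that] that by simp
      then have "rip e e = 0" using e by (simp add: rip_self)
      then show False using rip_unitary[OF V y y] t by (simp add: e_def t_def)
    qed
    then show "X *\<^sub>v a \<noteq> 0\<^sub>v n \<and> z * rip (X *\<^sub>v a) (X *\<^sub>v a) \<le> rip (X *\<^sub>v a) (W *\<^sub>v (X *\<^sub>v a))"
      using le unfolding Xa by simp
  qed
qed

end

section \<open>Haar measure\<close>

text \<open>The mean value theorem bounds all difference quotients on the unit ball by
  \<open>C\<close>, which makes dominated convergence along sequences applicable.\<close>

lemma has_real_derivative_integral:
  fixes F F' :: "real \<Rightarrow> 'w \<Rightarrow> real"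
  assumes "finite_measure M"
    and int: "\<And>y. integrable M (F y)" and meas: "F' a \<in> borel_measurable M"
    and deriv: "\<And>w y. w \<in> space M \<Longrightarrow> y \<in> ball a 1 \<Longrightarrow> ((\<lambda>y. F y w) has_real_derivative F' y w) (at y)"
    and bound: "\<And>w y. w \<in> space M \<Longrightarrow> y \<in> ball a 1 \<Longrightarrow> \<bar>F' y w\<bar> \<le> C"
  shows "((\<lambda>y. \<integral>w. F y w \<partial>M) has_real_derivative (\<integral>w. F' a w \<partial>M)) (at a)"
  unfolding has_field_derivative_iff LIMSEQ_SEQ_conv[symmetric]
proof (intro allI impI, elim conjE)
  interpret finite_measure M by fact
  fix S :: "nat \<Rightarrow> real" assume S: "\<forall>n. S n \<noteq> a" "S \<longlonglongrightarrow> a"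
  \<comment> \<open>The sequence is shifted by \<open>N\<close> so that all of its terms lie where
    the derivative bound holds.\<close>
  have "eventually (\<lambda>n. S n \<in> ball a 1) sequentially"
    using S(2) by (rule topological_tendstoD) auto
  then obtain N where N: "\<And>n. n \<ge> N \<Longrightarrow> S n \<in> ball a 1"
    by (auto simp: eventually_sequentially)
  have lip: "\<bar>F y w - F a w\<bar> \<le> C * \<bar>y - a\<bar>" if "w \<in> space M" "y \<in> ball a 1" for y w
  proof -
    have "norm (F y w - F a w) \<le> C * norm (y - a)"
    proof (rule field_differentiable_bound[OF convex_ball])
      show "((\<lambda>y. F y w) has_field_derivative F' z w) (at z within ball a 1)" if "z \<in> ball a 1" for z
        using deriv[OF \<open>w \<in> space M\<close> that] by (rule has_field_derivative_at_within)
      show "norm (F' z w) \<le> C" if "z \<in> ball a 1" for z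
        using bound[OF \<open>w \<in> space M\<close> that] by simp
    qed (use that in auto)
    then show ?thesis by simp
  qed
  have "(\<lambda>n. \<integral>w. (F (S (n + N)) w - F a w) / (S (n + N) - a) \<partial>M) \<longlonglongrightarrow> (\<integral>w. F' a w \<partial>M)"
  proof (rule integral_dominated_convergence[where w = "\<lambda>_. C"])
    show "(\<lambda>w. (F (S (n + N)) w - F a w) / (S (n + N) - a)) \<in> borel_measurable M" for n
      using borel_measurable_integrable[OF int] by measurable
    show "AE w in M. (\<lambda>n. (F (S (n + N)) w - F a w) / (S (n + N) - a)) \<longlonglongrightarrow> F' a w"
    proof (rule AE_I2)
      fix w assume "w \<in> space M"
      then have "((\<lambda>y. (F y w - F a w) / (y - a)) \<longlongrightarrow> F' a w) (at a)"
        using deriv[of w a] by (simp add: has_field_derivative_iff)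
      then have "(\<lambda>n. (F (S n) w - F a w) / (S n - a)) \<longlonglongrightarrow> F' a w"
        unfolding LIMSEQ_SEQ_conv[symmetric] using S by blast
      then show "(\<lambda>n. (F (S (n + N)) w - F a w) / (S (n + N) - a)) \<longlonglongrightarrow> F' a w"
        by (rule LIMSEQ_ignore_initial_segment)
    qed
    show "AE w in M. norm ((F (S (n + N)) w - F a w) / (S (n + N) - a)) \<le> C" for n
    proof (rule AE_I2)
      fix w assume "w \<in> space M"
      then show "norm ((F (S (n + N)) w - F a w) / (S (n + N) - a)) \<le> C"
        using lip[of w "S (n + N)"] N[of "n + N"] S(1) by (simp add: abs_divide field_simps)
    qed
  qed (use meas in auto)
  moreover have eqn: "(\<integral>w. (F (S n) w - F a w) / (S n - a) \<partial>M) =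
      ((\<integral>w. F (S n) w \<partial>M) - (\<integral>w. F a w \<partial>M)) / (S n - a)" for n
    using int by simp
  ultimately have "(\<lambda>n. ((\<integral>w. F (S (n + N)) w \<partial>M) - (\<integral>w. F a w \<partial>M)) / (S (n + N) - a)) \<longlonglongrightarrow> (\<integral>w. F' a w \<partial>M)"
    by (simp only: eqn)
  then show "(\<lambda>n. ((\<integral>w. F (S n) w \<partial>M) - (\<integral>w. F a w \<partial>M)) / (S n - a)) \<longlonglongrightarrow> (\<integral>w. F' a w \<partial>M)"
    by (rule LIMSEQ_offset)
qed

text \<open>Rotation by the angle \<phi> in the plane of the coordinates \<open>j\<close> and
  \<open>k\<close>. The two changed rows are written as sums of conditionals so that a product with
  a vector collapses term by term.\<close>

definition givens :: "nat \<Rightarrow> nat \<Rightarrow> nat \<Rightarrow> real \<Rightarrow> 'a::rcfield mat" where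
  "givens n j k \<phi> = mat n n (\<lambda>(i, m).
     if i = j then (if m = j then of_real (cos \<phi>) else 0) + (if m = k then of_real (- sin \<phi>) else 0)
     else if i = k then (if m = j then of_real (sin \<phi>) else 0) + (if m = k then of_real (cos \<phi>) else 0)
     else if m = i then 1 else 0)"

lemma givens_carrier [simp]: "givens n j k \<phi> \<in> carrier_mat n n"
  by (simp add: givens_def)

lemma givens_mult_vec:
  fixes x :: "'a::rcfield vec"
  assumes jk: "j < n" "k < n" and x: "x \<in> carrier_vec n" and i: "i < n"
  shows "(givens n j k \<phi> *\<^sub>v x) $ i =
    (if i = j then of_real (cos \<phi>) * x $ j + of_real (- sin \<phi>) * x $ k
     else if i = k then of_real (sin \<phi>) * x $ j + of_real (cos \<phi>) * x $ k else x $ i)"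
  unfolding mult_mat_vec_index[OF givens_carrier x i] using jk i
  by (simp add: givens_def distrib_right sum.distrib mult_delta_left del: of_real_minus)

lemma mat_adjoint_givens: "j \<noteq> k \<Longrightarrow> mat_adjoint (givens n j k \<phi>) = (givens n j k (- \<phi>) :: 'a::rcfield mat)"
  by (rule eq_matI) (auto simp: givens_def conjugate_neg)

lemma givens_unitary:
  assumes jk: "j < n" "k < n" "j \<noteq> k"
  shows "(givens n j k \<phi> :: 'a::rcfield mat) \<in> unitary_mats n"
proof -
  define G H :: "'a mat" where "G = givens n j k \<phi>" and "H = givens n j k (- \<phi>)"
  have GH: "G \<in> carrier_mat n n" "H \<in> carrier_mat n n" by (auto simp: G_def H_def)
  have sc: "of_real (cos \<phi>) * (of_real (cos \<phi>) * y) + of_real (sin \<phi>) * (of_real (sin \<phi>) * y) = y" for y :: 'a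
  proof -
    have "of_real (cos \<phi>) * (of_real (cos \<phi>) * y) + of_real (sin \<phi>) * (of_real (sin \<phi>) * y) =
        of_real ((cos \<phi>)\<^sup>2 + (sin \<phi>)\<^sup>2) * y"
      by (simp only: of_real_add of_real_mult power2_eq_square distrib_right mult.assoc)
    then show ?thesis by simp
  qed
  have inv: "H *\<^sub>v (G *\<^sub>v x) = x" if x: "x \<in> carrier_vec n" for x
  proof (rule eq_vecI)
    fix i assume "i < dim_vec x"
    then have i: "i < n" using x by simp
    have Gx: "G *\<^sub>v x \<in> carrier_vec n" using GH x by simp
    show "(H *\<^sub>v (G *\<^sub>v x)) $ i = x $ i"
      unfolding H_def givens_mult_vec[OF jk(1,2) Gx i]
      unfolding G_def givens_mult_vec[OF jk(1,2) x jk(1)] givens_mult_vec[OF jk(1,2) x jk(2)]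
        givens_mult_vec[OF jk(1,2) x i]
      using jk(3) sc[of "x $ j"] sc[of "x $ k"] by (simp add: algebra_simps)
  qed (use x GH in auto)
  have "H * G = 1\<^sub>m n"
  proof (rule mat_col_eqI)
    fix i assume "i < dim_col (1\<^sub>m n :: 'a mat)"
    then have i: "i < n" by simp
    have "col (H * G) i = (H * G) *\<^sub>v unit_vec n i"
      using mat_mult_unit_vec[of "H * G" n i] GH i by (simp add: mult_carrier_mat[of _ n n])
    also have "\<dots> = unit_vec n i"
      using inv[of "unit_vec n i"] GH by (simp add: assoc_mult_mat_vec[of _ n n _ n])
    finally show "col (H * G) i = col (1\<^sub>m n) i" using i by simp
  qed (use GH in auto)
  then show ?thesis
    using GH mat_adjoint_givens[OF jk(3), of n \<phi>, where 'a = 'a] by (simp add: unitary_mats_def G_def H_def)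
qed

section \<open>Invariance and measurability for the Haar measure\<close>

locale haar =
  fixes n :: nat and \<mu> :: "'a::rcfield mat measure"
  assumes haar: "haar_prob n (unitary_mats n) \<mu>"
begin

lemma prob_space_mu: "prob_space \<mu>"
  using haar by (simp add: haar_prob_def)

sublocale prob_space \<mu>
  by (rule prob_space_mu)

lemma sets_mu: "sets \<mu> = sets (restrict_space (mat_borel n) (unitary_mats n))"
  using haar by (simp add: haar_prob_def)

lemma space_mu: "space \<mu> = unitary_mats n"
  unfolding sets_eq_imp_space_eq[OF sets_mu] space_restrict_space
  by (auto simp: mat_borel_def unitary_mats_def)

lemma measurable_entry:
  assumes "i < n" "j < n"
  shows "(\<lambda>U. U $$ (i, j)) \<in> borel_measurable \<mu>"
proof -
  have "(\<lambda>A. \<lambda>ij\<in>{..<n} \<times> {..<n}. A $$ ij) \<in> measurable (mat_borel n) (\<Pi>\<^sub>M ij\<in>{..<n} \<times> {..<n}. (borel :: 'a measure))"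
    unfolding mat_borel_def by (rule measurable_vimage_algebra1) (auto simp: space_PiM)
  from measurable_compose[OF this measurable_component_singleton[of "(i, j)"]]
  have "(\<lambda>A. A $$ (i, j)) \<in> measurable (mat_borel n) (borel :: 'a measure)"
    using assms by simp
  then have "(\<lambda>A. A $$ (i, j)) \<in> measurable (restrict_space (mat_borel n) (unitary_mats n)) (borel :: 'a measure)"
    by (rule measurable_restrict_space1)
  then show ?thesis by (simp cong: measurable_cong_sets add: sets_mu)
qed

text \<open>The sigma-algebra is generated by the entries, so only they have to be checked.\<close>

lemma measurable_into_mu:
  assumes f: "\<And>w. w \<in> space M \<Longrightarrow> f w \<in> unitary_mats n"
    and entry: "\<And>i j. i < n \<Longrightarrow> j < n \<Longrightarrow> (\<lambda>w. f w $$ (i, j)) \<in> borel_measurable M"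
  shows "f \<in> measurable M \<mu>"
proof -
  have "f \<in> measurable M (mat_borel n)"
    unfolding mat_borel_def
  proof (rule measurable_vimage_algebra2)
    show "f \<in> space M \<rightarrow> carrier_mat n n" using f unitary_matsD(1) by blast
    show "(\<lambda>w. \<lambda>ij\<in>{..<n} \<times> {..<n}. f w $$ ij) \<in> measurable M (\<Pi>\<^sub>M ij\<in>{..<n} \<times> {..<n}. borel)"
      by (rule measurable_restrict) (use entry in auto)
  qed
  then have "f \<in> measurable M (restrict_space (mat_borel n) (unitary_mats n))"
    by (intro measurable_restrict_space2) (use f in auto)
  then show ?thesis by (simp cong: measurable_cong_sets add: sets_mu)
qed

lemma measurable_mult:
  assumes A: "A \<in> carrier_mat n n" and B: "B \<in> carrier_mat n n" and ij: "i < n" "j < n"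
  shows "(\<lambda>U. (A * U * B) $$ (i, j)) \<in> borel_measurable \<mu>"
proof -
  have "(A * U * B) $$ (i, j) = (\<Sum>l<n. A $$ (i, l) * (\<Sum>m<n. U $$ (l, m) * B $$ (m, j)))" if "U \<in> space \<mu>" for U
    using that unitary_matsD(1)[of U n] A B ij unfolding space_mu
    by (simp add: scalar_prod_def lessThan_atLeast0)
  moreover have "(\<lambda>U. \<Sum>l<n. A $$ (i, l) * (\<Sum>m<n. U $$ (l, m) * B $$ (m, j))) \<in> borel_measurable \<mu>"
    by (intro borel_measurable_sum borel_measurable_times measurable_entry borel_measurable_const) auto
  ultimately show ?thesis by (simp cong: measurable_cong)
qed

lemma measurable_translate:
  assumes "V \<in> unitary_mats n" "W \<in> unitary_mats n"
  shows "(\<lambda>U. V * U * W) \<in> measurable \<mu> \<mu>"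
  using assms by (intro measurable_into_mu measurable_mult unitary_mats_mult) (auto simp: space_mu unitary_matsD(1))

lemma measurable_left: "V \<in> unitary_mats n \<Longrightarrow> (\<lambda>U. V * U) \<in> measurable \<mu> \<mu>"
  and measurable_right: "V \<in> unitary_mats n \<Longrightarrow> (\<lambda>U. U * V) \<in> measurable \<mu> \<mu>"
proof -
  assume V: "V \<in> unitary_mats n"
  have one: "1\<^sub>m n \<in> unitary_mats n" by (simp add: unitary_mats_def)
  have "V * U * 1\<^sub>m n = V * U" "1\<^sub>m n * U * V = U * V" if "U \<in> space \<mu>" for U
    using that unitary_matsD(1)[of U n] unitary_matsD(1)[OF V] unfolding space_mu
    by (auto simp: mult_carrier_mat[of _ n n])
  then show "(\<lambda>U. V * U) \<in> measurable \<mu> \<mu>" "(\<lambda>U. U * V) \<in> measurable \<mu> \<mu>"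
    using measurable_translate[OF V one] measurable_translate[OF one V] by (simp_all cong: measurable_cong)
qed

lemma distr_left: "V \<in> unitary_mats n \<Longrightarrow> distr \<mu> \<mu> (\<lambda>U. V * U) = \<mu>"
  and distr_right: "V \<in> unitary_mats n \<Longrightarrow> distr \<mu> \<mu> (\<lambda>U. U * V) = \<mu>"
  using haar by (auto simp: haar_prob_def)

lemma integral_left:
  fixes f :: "'a mat \<Rightarrow> real"
  assumes V: "V \<in> unitary_mats n" and f: "f \<in> borel_measurable \<mu>"
  shows "(\<integral>U. f (V * U) \<partial>\<mu>) = (\<integral>U. f U \<partial>\<mu>)"
  using integral_distr[OF measurable_left[OF V] f] distr_left[OF V] by simp

text \<open>Two-sided invariance for events; it is what removes the eigenbases of both matrices
  simultaneously.\<close>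

lemma measure_translate:
  assumes V: "V \<in> unitary_mats n" and W: "W \<in> unitary_mats n" and A: "{U \<in> space \<mu>. P U} \<in> sets \<mu>"
  shows "measure \<mu> {U \<in> space \<mu>. P (V * U * W)} = measure \<mu> {U \<in> space \<mu>. P U}"
proof -
  have P1: "{U \<in> space \<mu>. P (U * W)} = (\<lambda>U. U * W) -` {U \<in> space \<mu>. P U} \<inter> space \<mu>"
    using measurable_space[OF measurable_right[OF W]] by auto
  have A1: "{U \<in> space \<mu>. P (U * W)} \<in> sets \<mu>"
    unfolding P1 by (rule measurable_sets[OF measurable_right[OF W] A])
  have P2: "{U \<in> space \<mu>. P (V * U * W)} = (\<lambda>U. V * U) -` {U \<in> space \<mu>. P (U * W)} \<inter> space \<mu>"
    using measurable_space[OF measurable_left[OF V]] by auto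
  have "measure \<mu> {U \<in> space \<mu>. P (V * U * W)} = measure (distr \<mu> \<mu> (\<lambda>U. V * U)) {U \<in> space \<mu>. P (U * W)}"
    unfolding P2 by (rule measure_distr[OF measurable_left[OF V] A1, symmetric])
  also have "\<dots> = measure (distr \<mu> \<mu> (\<lambda>U. U * W)) {U \<in> space \<mu>. P U}"
    unfolding distr_left[OF V] P1 by (rule measure_distr[OF measurable_right[OF W] A, symmetric])
  finally show ?thesis by (simp add: distr_right[OF W])
qed

end

section \<open>Integration by parts for a centred quadratic form of one vector\<close>

locale haar_vector = haar n \<mu> for n and \<mu> :: "'a::rcfield mat measure" +
  fixes v :: "'a vec" and l :: "nat \<Rightarrow> real" and K :: real
  assumes v: "v \<in> carrier_vec n"
    and l: "\<And>i. i < n \<Longrightarrow> \<bar>l i\<bar> \<le> K" and l_sum: "(\<Sum>i<n. l i) = 0"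
begin

text \<open>Rotating the plane of \<open>j\<close> and \<open>k\<close> at the identity changes
  \<open>w k\<close> at rate \<open>2 * P j k\<close> and \<open>P j k\<close> at rate
  \<open>w j - w k\<close>. This is why \<open>P j k\<close> is the test function in the integration
  by parts.\<close>

definition "w j U = (norm ((U *\<^sub>v v) $ j))\<^sup>2" for j and U :: "'a mat"
definition "P j k U = inner ((U *\<^sub>v v) $ j) ((U *\<^sub>v v) $ k)" for j k and U :: "'a mat"
definition "q U = (\<Sum>i<n. l i * w i U)" for U :: "'a mat"
definition L :: real where "L = rip v v"

lemma carr: "U \<in> space \<mu> \<Longrightarrow> U \<in> carrier_mat n n"
  using space_mu unitary_matsD(1) by blast

lemma L_nonneg: "0 \<le> L"
  by (simp add: L_def)

lemma measurable_coord: "i < n \<Longrightarrow> (\<lambda>U. (U *\<^sub>v v) $ i) \<in> borel_measurable \<mu>"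
proof -
  assume i: "i < n"
  have "(\<lambda>U. \<Sum>j<n. U $$ (i, j) * v $ j) \<in> borel_measurable \<mu>"
    using i by (intro borel_measurable_sum borel_measurable_times measurable_entry borel_measurable_const) auto
  moreover have "(U *\<^sub>v v) $ i = (\<Sum>j<n. U $$ (i, j) * v $ j)" if "U \<in> space \<mu>" for U
    by (rule mult_mat_vec_index[OF carr[OF that] v i])
  ultimately show ?thesis by (simp cong: measurable_cong del: index_mult_mat_vec)
qed

lemma measurable_w [measurable]: "i < n \<Longrightarrow> w i \<in> borel_measurable \<mu>"
  unfolding w_def using measurable_coord[of i] by measurable

lemma measurable_P [measurable]: "i < n \<Longrightarrow> j < n \<Longrightarrow> P i j \<in> borel_measurable \<mu>"
  unfolding P_def using measurable_coord[of i] measurable_coord[of j] by measurable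

lemma measurable_q [measurable]: "q \<in> borel_measurable \<mu>"
  unfolding q_def by measurable

lemma w_nonneg: "0 \<le> w i U"
  by (simp add: w_def)

lemma w_sum: "U \<in> space \<mu> \<Longrightarrow> (\<Sum>i<n. w i U) = L"
  using rip_unitary[of U n v v] v carr[of U] space_mu
  by (simp add: L_def rip_self w_def del: index_mult_mat_vec)

lemma w_le: "U \<in> space \<mu> \<Longrightarrow> i < n \<Longrightarrow> w i U \<le> L"
  using member_le_sum[of i "{..<n}" "\<lambda>i. w i U"] w_sum[of U] w_nonneg by simp

lemma P_bound: "(P j k U)\<^sup>2 \<le> w j U * w k U"
  using Cauchy_Schwarz_ineq[of "(U *\<^sub>v v) $ j" "(U *\<^sub>v v) $ k"]
  by (simp add: P_def w_def power2_norm_eq_inner del: index_mult_mat_vec)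

lemma abs_P_le: "U \<in> space \<mu> \<Longrightarrow> j < n \<Longrightarrow> k < n \<Longrightarrow> \<bar>P j k U\<bar> \<le> L"
proof -
  assume *: "U \<in> space \<mu>" "j < n" "k < n"
  have "(P j k U)\<^sup>2 \<le> L * L"
    using P_bound[of j k U] mult_mono[OF w_le[OF *(1,2)] w_le[OF *(1,3)] L_nonneg w_nonneg] by linarith
  then show ?thesis using L_nonneg by (metis abs_le_square_iff abs_of_nonneg power2_eq_square)
qed

lemma abs_q_le: "U \<in> space \<mu> \<Longrightarrow> \<bar>q U\<bar> \<le> K * L"
proof -
  assume U: "U \<in> space \<mu>"
  have "\<bar>q U\<bar> \<le> (\<Sum>i<n. \<bar>l i * w i U\<bar>)" unfolding q_def by (rule sum_abs)
  also have "\<dots> \<le> (\<Sum>i<n. K * w i U)"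
    by (intro sum_mono) (use l w_nonneg in \<open>auto simp: abs_mult intro: mult_right_mono\<close>)
  finally show ?thesis by (simp add: w_sum[OF U] flip: sum_distrib_left)
qed

lemma integrable_bounded:
  fixes C :: real
  assumes "f \<in> borel_measurable \<mu>" "\<And>U. U \<in> space \<mu> \<Longrightarrow> \<bar>f U\<bar> \<le> C"
  shows "integrable \<mu> f"
  using assms by (intro integrable_const_bound[of _ C]) auto

definition mgf :: "real \<Rightarrow> real" where
  "mgf t = (\<integral>U. exp (t * q U) \<partial>\<mu>)"

lemma exp_q_le: "U \<in> space \<mu> \<Longrightarrow> exp (t * q U) \<le> exp (\<bar>t\<bar> * (K * L))"
proof -
  assume "U \<in> space \<mu>"
  from abs_q_le[OF this] have "\<bar>t * q U\<bar> \<le> \<bar>t\<bar> * (K * L)"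
    by (simp add: abs_mult mult_left_mono)
  then show ?thesis by (simp add: abs_le_iff)
qed

lemma integrable_mult_exp:
  fixes C :: real
  assumes f: "f \<in> borel_measurable \<mu>" "\<And>U. U \<in> space \<mu> \<Longrightarrow> \<bar>f U\<bar> \<le> C"
  shows "integrable \<mu> (\<lambda>U. f U * exp (t * q U))"
proof (rule integrable_bounded)
  show "(\<lambda>U. f U * exp (t * q U)) \<in> borel_measurable \<mu>" using f(1) by measurable
  fix U assume U: "U \<in> space \<mu>"
  show "\<bar>f U * exp (t * q U)\<bar> \<le> C * exp (\<bar>t\<bar> * (K * L))"
    unfolding abs_mult abs_exp_cancel
    using f(2)[OF U] exp_q_le[OF U, of t] by (intro mult_mono) auto
qed

lemma integrable_exp: "integrable \<mu> (\<lambda>U. exp (t * q U))"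
  using integrable_mult_exp[of "\<lambda>_. 1" 1] by simp

lemma mgf_deriv: "(mgf has_real_derivative (\<integral>U. q U * exp (t * q U) \<partial>\<mu>)) (at t)"
  unfolding mgf_def
\<comment> \<open>The constant has \<open>\<bar>t\<bar> + 1\<close> in the exponent since the
  derivative must be bounded on the unit ball around \<open>t\<close>.\<close>
proof (rule has_real_derivative_integral[OF finite_measure_axioms integrable_exp,
      where C = "K * L * exp ((\<bar>t\<bar> + 1) * (K * L))"])
  show "(\<lambda>U. q U * exp (t * q U)) \<in> borel_measurable \<mu>" by measurable
  fix U y assume U: "U \<in> space \<mu>" and y: "y \<in> ball t (1::real)"
  show "((\<lambda>y. exp (y * q U)) has_real_derivative q U * exp (y * q U)) (at y)"
    by (auto intro!: derivative_eq_intros)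
  have "0 \<le> K * L" using abs_q_le[OF U] by linarith
  have "\<bar>y\<bar> \<le> \<bar>t\<bar> + 1" using y by (simp add: dist_real_def)
  then have "exp (y * q U) \<le> exp ((\<bar>t\<bar> + 1) * (K * L))"
    using exp_q_le[OF U, of y] mult_right_mono[OF _ \<open>0 \<le> K * L\<close>, of "\<bar>y\<bar>" "\<bar>t\<bar> + 1"]
    by (meson exp_le_cancel_iff order_trans)
  then show "\<bar>q U * exp (y * q U)\<bar> \<le> K * L * exp ((\<bar>t\<bar> + 1) * (K * L))"
    unfolding abs_mult abs_exp_cancel using abs_q_le[OF U] \<open>0 \<le> K * L\<close> by (intro mult_mono) auto
qed

text \<open>Only the coordinates \<open>j\<close> and \<open>k\<close> move, and the pair
  \<open>(w j - w k) / 2\<close>, \<open>P j k\<close> turns through twice the angle; hence the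
  double-angle form, convenient to differentiate.\<close>

lemma rotated:
  assumes jk: "j < n" "k < n" "j \<noteq> k" and U: "U \<in> space \<mu>"
  shows "P j k (givens n j k \<phi> * U) = (cos (2 * \<phi>)) * P j k U + sin (2 * \<phi>) / 2 * (w j U - w k U)"
    and "q (givens n j k \<phi> * U) =
      q U + (l j - l k) / 2 * ((cos (2 * \<phi>) - 1) * (w j U - w k U) - 2 * sin (2 * \<phi>) * P j k U)"
proof -
  note Uc = carr[OF U]
  define x where "x = U *\<^sub>v v"
  have x: "x \<in> carrier_vec n" using Uc v by (simp add: x_def)
  have gx: "givens n j k \<phi> * U *\<^sub>v v = givens n j k \<phi> *\<^sub>v x"
    unfolding x_def by (rule assoc_mult_mat_vec[OF givens_carrier Uc v])
  define c s where "c = cos \<phi>" and "s = sin \<phi>"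
  have cs2: "cos (2 * \<phi>) = c\<^sup>2 - s\<^sup>2" "sin (2 * \<phi>) = 2 * s * c"
    by (auto simp: c_def s_def cos_double sin_double)
  have cs1: "c\<^sup>2 = 1 - s\<^sup>2" by (simp add: c_def s_def cos_squared_eq)
  have gj: "(givens n j k \<phi> *\<^sub>v x) $ j = of_real c * x $ j + of_real (- s) * x $ k"
    using givens_mult_vec[OF jk(1,2) x jk(1)] jk(3) by (simp add: c_def s_def)
  have gk: "(givens n j k \<phi> *\<^sub>v x) $ k = of_real s * x $ j + of_real c * x $ k"
    using givens_mult_vec[OF jk(1,2) x jk(2)] jk(3) by (simp add: c_def s_def)
  have gi: "(givens n j k \<phi> *\<^sub>v x) $ i = x $ i" if "i < n" "i \<noteq> j" "i \<noteq> k" for i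
    using givens_mult_vec[OF jk(1,2) x that(1)] that by simp
  note ex = inner_add_left inner_add_right inner_of_real_mult inner_commute[of "x $ k" "x $ j"]
  have Pg: "P j k (givens n j k \<phi> * U) = c * s * (w j U - w k U) + (c\<^sup>2 - s\<^sup>2) * P j k U"
    unfolding P_def w_def gx gj gk x_def[symmetric] power2_norm_eq_inner ex
    by (simp add: power2_eq_square algebra_simps)
  show "P j k (givens n j k \<phi> * U) = (cos (2 * \<phi>)) * P j k U + sin (2 * \<phi>) / 2 * (w j U - w k U)"
    unfolding Pg cs2 by (simp add: algebra_simps)
  have wj: "w j (givens n j k \<phi> * U) = w j U - s\<^sup>2 * (w j U - w k U) - 2 * s * c * P j k U"
  proof -
    have "w j (givens n j k \<phi> * U) = c\<^sup>2 * w j U + s\<^sup>2 * w k U - 2 * s * c * P j k U"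
      unfolding P_def w_def gx gj x_def[symmetric] power2_norm_eq_inner ex
      by (simp add: power2_eq_square algebra_simps)
    then show ?thesis unfolding cs1 by (simp add: algebra_simps)
  qed
  have wk: "w k (givens n j k \<phi> * U) = w k U + s\<^sup>2 * (w j U - w k U) + 2 * s * c * P j k U"
  proof -
    have "w k (givens n j k \<phi> * U) = s\<^sup>2 * w j U + c\<^sup>2 * w k U + 2 * s * c * P j k U"
      unfolding P_def w_def gx gk x_def[symmetric] power2_norm_eq_inner ex
      by (simp add: power2_eq_square algebra_simps)
    then show ?thesis unfolding cs1 by (simp add: algebra_simps)
  qed
  have split: "q X = l j * w j X + l k * w k X + (\<Sum>i\<in>{..<n} - {j, k}. l i * w i X)" for X
  proof -
    have "q X = (\<Sum>i\<in>{j, k}. l i * w i X) + (\<Sum>i\<in>{..<n} - {j, k}. l i * w i X)"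
      unfolding q_def using jk by (intro sum.subset_diff[THEN trans[OF _ add.commute]]) auto
    then show ?thesis using jk(3) by simp
  qed
  have rest: "(\<Sum>i\<in>{..<n} - {j, k}. l i * w i (givens n j k \<phi> * U)) = (\<Sum>i\<in>{..<n} - {j, k}. l i * w i U)"
    by (rule sum.cong) (auto simp: w_def gx gi x_def[symmetric] simp del: index_mult_mat_vec)
  have c21: "c\<^sup>2 - s\<^sup>2 - 1 = - 2 * s\<^sup>2" unfolding cs1 by simp
  show "q (givens n j k \<phi> * U) =
      q U + (l j - l k) / 2 * ((cos (2 * \<phi>) - 1) * (w j U - w k U) - 2 * sin (2 * \<phi>) * P j k U)"
    unfolding split[of "givens n j k \<phi> * U"] split[of U] rest wj wk cs2 c21
    by (simp add: field_simps)
qed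

text \<open>Invariance of the Haar measure under rotations in the coordinate plane \<open>(j, k)\<close>,
  differentiated at the identity.\<close>

lemma integration_by_parts:
  assumes jk: "j < n" "k < n"
  shows "(\<integral>U. (w j U - w k U) * exp (t * q U) \<partial>\<mu>) = 2 * t * (l j - l k) * (\<integral>U. (P j k U)\<^sup>2 * exp (t * q U) \<partial>\<mu>)"
proof (cases "j = k")
  case False
  define d where "d U = w j U - w k U" for U
  define b where "b = l j - l k"
  define p where "p \<phi> U = cos (2 * \<phi>) * P j k U + sin (2 * \<phi>) / 2 * d U" for \<phi> U
  define r where "r \<phi> U = q U + b / 2 * ((cos (2 * \<phi>) - 1) * d U - 2 * sin (2 * \<phi>) * P j k U)" for \<phi> U
  define p' where "p' \<phi> U = - 2 * sin (2 * \<phi>) * P j k U + cos (2 * \<phi>) * d U" for \<phi> U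
  define r' where "r' \<phi> U = b / 2 * (- 2 * sin (2 * \<phi>) * d U - 4 * cos (2 * \<phi>) * P j k U)" for \<phi> U
  define F where "F \<phi> U = p \<phi> U * exp (t * r \<phi> U)" for \<phi> U
  define F' where "F' \<phi> U = p' \<phi> U * exp (t * r \<phi> U) + p \<phi> U * (exp (t * r \<phi> U) * (t * r' \<phi> U))" for \<phi> U
  have [measurable]: "w j \<in> borel_measurable \<mu>" "w k \<in> borel_measurable \<mu>" "P j k \<in> borel_measurable \<mu>"
    using jk by auto
  have F_eq: "F \<phi> U = P j k (givens n j k \<phi> * U) * exp (t * q (givens n j k \<phi> * U))" if "U \<in> space \<mu>" for \<phi> U
    unfolding F_def p_def r_def d_def b_def rotated[OF jk False that] ..
  have G: "(givens n j k \<phi> :: 'a mat) \<in> unitary_mats n" for \<phi> using givens_unitary[OF jk False] .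
  have bd: "\<bar>d U\<bar> \<le> L" "\<bar>P j k U\<bar> \<le> L" "\<bar>p \<phi> U\<bar> \<le> L" "\<bar>r \<phi> U\<bar> \<le> K * L" if U: "U \<in> space \<mu>" for U \<phi>
  proof -
    show "\<bar>d U\<bar> \<le> L" using w_le[OF U jk(1)] w_le[OF U jk(2)] w_nonneg[of j U] w_nonneg[of k U] by (simp add: d_def)
    show "\<bar>P j k U\<bar> \<le> L" by (rule abs_P_le[OF U jk])
    have GU: "givens n j k \<phi> * U \<in> space \<mu>" using measurable_space[OF measurable_left[OF G] U] .
    show "\<bar>p \<phi> U\<bar> \<le> L" using abs_P_le[OF GU jk] rotated(1)[OF jk False U] by (simp add: p_def d_def)
    show "\<bar>r \<phi> U\<bar> \<le> K * L" using abs_q_le[OF GU] rotated(2)[OF jk False U] by (simp add: r_def d_def b_def)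
  qed
  \<comment> \<open>\<open>F \<phi>\<close> is the test integrand evaluated at the rotated matrix,
    so left invariance makes its integral independent of \<phi>.\<close>
  have const: "(\<integral>U. F \<phi> U \<partial>\<mu>) = (\<integral>U. P j k U * exp (t * q U) \<partial>\<mu>)" for \<phi>
  proof -
    have "(\<integral>U. F \<phi> U \<partial>\<mu>) = (\<integral>U. P j k (givens n j k \<phi> * U) * exp (t * q (givens n j k \<phi> * U)) \<partial>\<mu>)"
      by (rule Bochner_Integration.integral_cong[OF refl]) (rule F_eq)
    also have "\<dots> = (\<integral>U. P j k U * exp (t * q U) \<partial>\<mu>)"
      by (rule integral_left[OF G]) measurable
    finally show ?thesis .
  qed
  have expb: "exp (t * r \<phi> U) \<le> exp (\<bar>t\<bar> * (K * L))" if "U \<in> space \<mu>" for \<phi> U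
  proof -
    have "\<bar>t * r \<phi> U\<bar> \<le> \<bar>t\<bar> * (K * L)" using bd(4)[OF that, of \<phi>] by (simp add: abs_mult mult_left_mono)
    then show ?thesis by (simp add: abs_le_iff)
  qed
  have "((\<lambda>\<phi>. \<integral>U. F \<phi> U \<partial>\<mu>) has_real_derivative (\<integral>U. F' 0 U \<partial>\<mu>)) (at 0)"
  \<comment> \<open>The dominating constant is the product rule with sines and cosines bounded by 1:
    \<open>3 * L\<close> for \<open>p'\<close>, \<open>L\<close> for \<open>p\<close>, and
    \<open>6 * L\<close> for the bracket in \<open>r'\<close>.\<close>
  proof (rule has_real_derivative_integral[OF finite_measure_axioms,
        where C = "3 * L * exp (\<bar>t\<bar> * (K * L)) + L * (exp (\<bar>t\<bar> * (K * L)) * (\<bar>t\<bar> * (\<bar>b\<bar> / 2 * (6 * L))))"])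
    show "integrable \<mu> (F \<phi>)" for \<phi>
    proof (rule integrable_bounded)
      show "F \<phi> \<in> borel_measurable \<mu>" unfolding F_def p_def r_def d_def by measurable
      fix U assume U: "U \<in> space \<mu>"
      show "\<bar>F \<phi> U\<bar> \<le> L * exp (\<bar>t\<bar> * (K * L))"
        unfolding F_def abs_mult abs_exp_cancel using bd(3)[OF U] expb[OF U] L_nonneg by (intro mult_mono) auto
    qed
    show "F' 0 \<in> borel_measurable \<mu>" unfolding F'_def p_def r_def d_def p'_def r'_def by measurable
    fix U and \<phi> :: real assume U: "U \<in> space \<mu>"
    have dp: "((\<lambda>\<phi>. p \<phi> U) has_real_derivative p' \<phi> U) (at \<phi>)"
      unfolding p_def p'_def by (auto intro!: derivative_eq_intros)
    have dr: "((\<lambda>\<phi>. r \<phi> U) has_real_derivative r' \<phi> U) (at \<phi>)"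
      unfolding r_def r'_def by (auto intro!: derivative_eq_intros simp: algebra_simps)
    show "((\<lambda>\<phi>. F \<phi> U) has_real_derivative F' \<phi> U) (at \<phi>)"
      unfolding F_def F'_def by (auto intro!: derivative_eq_intros dp dr)
    have t1: "\<bar>sin (2 * \<phi>) * X\<bar> \<le> \<bar>X\<bar>" "\<bar>cos (2 * \<phi>) * X\<bar> \<le> \<bar>X\<bar>" for X
      by (simp_all add: abs_mult mult_left_le_one_le)
    have "\<bar>p' \<phi> U\<bar> \<le> 2 * \<bar>sin (2 * \<phi>) * P j k U\<bar> + \<bar>cos (2 * \<phi>) * d U\<bar>"
      unfolding p'_def by linarith
    then have p'b: "\<bar>p' \<phi> U\<bar> \<le> 3 * L"
      using t1[of "P j k U"] t1[of "d U"] bd(1,2)[OF U] by linarith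
    define X where "X = - 2 * sin (2 * \<phi>) * d U - 4 * cos (2 * \<phi>) * P j k U"
    have "\<bar>X\<bar> \<le> 2 * \<bar>sin (2 * \<phi>) * d U\<bar> + 4 * \<bar>cos (2 * \<phi>) * P j k U\<bar>"
      unfolding X_def by linarith
    then have "\<bar>X\<bar> \<le> 6 * L"
      using t1[of "P j k U"] t1[of "d U"] bd(1,2)[OF U] by linarith
    then have "\<bar>b / 2\<bar> * \<bar>X\<bar> \<le> \<bar>b / 2\<bar> * (6 * L)" by (rule mult_left_mono) simp
    then have r'b: "\<bar>r' \<phi> U\<bar> \<le> \<bar>b\<bar> / 2 * (6 * L)"
      unfolding r'_def X_def[symmetric] abs_mult by simp
    have "\<bar>F' \<phi> U\<bar> \<le> \<bar>p' \<phi> U\<bar> * exp (t * r \<phi> U) + \<bar>p \<phi> U\<bar> * (exp (t * r \<phi> U) * (\<bar>t\<bar> * \<bar>r' \<phi> U\<bar>))"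
      unfolding F'_def by (rule order_trans[OF abs_triangle_ineq]) (simp add: abs_mult)
    also have "\<dots> \<le> 3 * L * exp (\<bar>t\<bar> * (K * L)) + L * (exp (\<bar>t\<bar> * (K * L)) * (\<bar>t\<bar> * (\<bar>b\<bar> / 2 * (6 * L))))"
      using p'b r'b bd(3)[OF U] expb[OF U] L_nonneg
      by (intro add_mono mult_mono) auto
    finally show "\<bar>F' \<phi> U\<bar> \<le> 3 * L * exp (\<bar>t\<bar> * (K * L)) + L * (exp (\<bar>t\<bar> * (K * L)) * (\<bar>t\<bar> * (\<bar>b\<bar> / 2 * (6 * L))))" .
  qed
  then have "((\<lambda>\<phi>::real. \<integral>U. P j k U * exp (t * q U) \<partial>\<mu>) has_real_derivative (\<integral>U. F' 0 U \<partial>\<mu>)) (at 0)"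
    unfolding const .
  then have "(\<integral>U. F' 0 U \<partial>\<mu>) = 0" using DERIV_unique DERIV_const by blast
  \<comment> \<open>At angle 0 the values are \<open>p' = d\<close>, \<open>p = P j k\<close> and
    \<open>r' = - 2 * b * P j k\<close>, so the vanishing derivative is the claimed
    identity.\<close>
  moreover have "F' 0 U = d U * exp (t * q U) - 2 * t * b * ((P j k U)\<^sup>2 * exp (t * q U))" for U
    by (simp add: F'_def p'_def p_def r_def r'_def power2_eq_square)
  moreover have "integrable \<mu> (\<lambda>U. d U * exp (t * q U))"
    by (rule integrable_mult_exp[where C = L]) (use bd(1) in \<open>auto simp: d_def\<close>)
  moreover have "integrable \<mu> (\<lambda>U. (P j k U)\<^sup>2 * exp (t * q U))"
  proof (rule integrable_mult_exp[where C = "L\<^sup>2"])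
    fix U assume "U \<in> space \<mu>"
    then show "\<bar>(P j k U)\<^sup>2\<bar> \<le> L\<^sup>2" using bd(2)[of U] L_nonneg by (simp add: power2_le_iff_abs_le)
  qed measurable
  ultimately show ?thesis by (simp add: d_def b_def)
qed simp

end

section \<open>Concentration of quadratic forms\<close>

lemma integral_double_sum:
  fixes f :: "nat \<Rightarrow> nat \<Rightarrow> 'w \<Rightarrow> real"
  assumes "\<And>j k. j < n \<Longrightarrow> k < n \<Longrightarrow> integrable M (f j k)"
  shows "(\<integral>x. (\<Sum>j<n. \<Sum>k<n. f j k x) \<partial>M) = (\<Sum>j<n. \<Sum>k<n. \<integral>x. f j k x \<partial>M)"
proof -
  have "(\<integral>x. (\<Sum>j<n. \<Sum>k<n. f j k x) \<partial>M) = (\<Sum>j<n. \<integral>x. (\<Sum>k<n. f j k x) \<partial>M)"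
    using assms by (intro Bochner_Integration.integral_sum Bochner_Integration.integrable_sum) auto
  also have "\<dots> = (\<Sum>j<n. \<Sum>k<n. \<integral>x. f j k x \<partial>M)"
    using assms by (intro sum.cong refl Bochner_Integration.integral_sum) auto
  finally show ?thesis .
qed

context haar_vector
begin

text \<open>Multiply the integration by parts by \<open>l j\<close> and sum over all pairs. The left
  side becomes \<open>n * q\<close> because the weights sum to zero; on the right, Cauchy-Schwarz
  replaces the square of \<open>P j k\<close> by \<open>w j * w k\<close>, whose double sum is the
  constant \<open>L\<^sup>2\<close>.\<close>

lemma mgf_deriv_le:
  assumes t: "0 \<le> t"
  shows "real n * (\<integral>U. q U * exp (t * q U) \<partial>\<mu>) \<le> 4 * K\<^sup>2 * L\<^sup>2 * t * mgf t"
proof -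
  have int_w: "integrable \<mu> (\<lambda>U. (w j U - w k U) * exp (t * q U))" if "j < n" "k < n" for j k
  proof (rule integrable_mult_exp[where C = L])
    show "(\<lambda>U. w j U - w k U) \<in> borel_measurable \<mu>" using that by measurable
    fix U assume "U \<in> space \<mu>"
    then show "\<bar>w j U - w k U\<bar> \<le> L"
      using w_le[of U j] w_le[of U k] w_nonneg[of j U] w_nonneg[of k U] that by simp
  qed
  have int_P: "integrable \<mu> (\<lambda>U. (P j k U)\<^sup>2 * exp (t * q U))" if "j < n" "k < n" for j k
  proof (rule integrable_mult_exp[where C = "L\<^sup>2"])
    show "(\<lambda>U. (P j k U)\<^sup>2) \<in> borel_measurable \<mu>" using that by measurable
    fix U assume "U \<in> space \<mu>"
    then show "\<bar>(P j k U)\<^sup>2\<bar> \<le> L\<^sup>2"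
      using abs_P_le[of U j k] that L_nonneg by (simp add: power2_le_iff_abs_le)
  qed
  have int_ww: "integrable \<mu> (\<lambda>U. w j U * w k U * exp (t * q U))" if "j < n" "k < n" for j k
  proof (rule integrable_mult_exp[where C = "L * L"])
    show "(\<lambda>U. w j U * w k U) \<in> borel_measurable \<mu>" using that by measurable
    fix U assume "U \<in> space \<mu>"
    then show "\<bar>w j U * w k U\<bar> \<le> L * L"
      using w_le[of U j] w_le[of U k] w_nonneg[of j U] w_nonneg[of k U] that
      by (simp add: abs_mult mult_mono)
  qed
  have nq: "real n * q U = (\<Sum>j<n. \<Sum>k<n. l j * (w j U - w k U))" for U
  proof -
    have "(\<Sum>j<n. \<Sum>k<n. l j * (w j U - w k U)) = (\<Sum>j<n. real n * (l j * w j U)) - (\<Sum>j<n. l j * (\<Sum>k<n. w k U))"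
      by (simp add: right_diff_distrib sum_subtractf sum_distrib_left)
    also have "(\<Sum>j<n. l j * (\<Sum>k<n. w k U)) = 0"
      using l_sum by (simp flip: sum_distrib_right)
    finally show ?thesis by (simp add: q_def sum_distrib_left)
  qed
  have "real n * (\<integral>U. q U * exp (t * q U) \<partial>\<mu>) = (\<integral>U. real n * (q U * exp (t * q U)) \<partial>\<mu>)"
    by simp
  also have "\<dots> = (\<integral>U. (\<Sum>j<n. \<Sum>k<n. l j * ((w j U - w k U) * exp (t * q U))) \<partial>\<mu>)"
    unfolding mult.assoc[symmetric] nq by (simp add: sum_distrib_right)
  also have "\<dots> = (\<Sum>j<n. \<Sum>k<n. l j * (\<integral>U. (w j U - w k U) * exp (t * q U) \<partial>\<mu>))"
    using int_w by (subst integral_double_sum) auto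
  also have "\<dots> \<le> (\<Sum>j<n. \<Sum>k<n. 4 * K\<^sup>2 * t * (\<integral>U. w j U * w k U * exp (t * q U) \<partial>\<mu>))"
  proof (intro sum_mono)
    fix j k assume "j \<in> {..<n}" "k \<in> {..<n}"
    then have jk: "j < n" "k < n" by auto
    define I where "I = (\<integral>U. (P j k U)\<^sup>2 * exp (t * q U) \<partial>\<mu>)"
    have I: "0 \<le> I" unfolding I_def by (rule Bochner_Integration.integral_nonneg) simp
    \<comment> \<open>This factor \<open>2 * K\<^sup>2\<close> and the \<open>2 * t\<close> of the
      integration by parts produce the 4 in the bound.\<close>
    have "\<bar>l j * (l j - l k)\<bar> \<le> K * (2 * K)"
      unfolding abs_mult using l[OF jk(1)] l[OF jk(2)] by (intro mult_mono) auto
    then have ll: "l j * (l j - l k) \<le> 2 * K\<^sup>2" by (simp add: power2_eq_square)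
    have "l j * (\<integral>U. (w j U - w k U) * exp (t * q U) \<partial>\<mu>) = (l j * (l j - l k)) * (2 * t * I)"
      unfolding integration_by_parts[OF jk] I_def by simp
    also have "\<dots> \<le> 2 * K\<^sup>2 * (2 * t * I)"
      using ll I t by (intro mult_right_mono) auto
    also have "\<dots> = 4 * K\<^sup>2 * t * I" by simp
    also have "\<dots> \<le> 4 * K\<^sup>2 * t * (\<integral>U. w j U * w k U * exp (t * q U) \<partial>\<mu>)"
      unfolding I_def using t
      by (intro mult_left_mono integral_mono int_P int_ww jk mult_right_mono P_bound) auto
    finally show "l j * (\<integral>U. (w j U - w k U) * exp (t * q U) \<partial>\<mu>) \<le>
      4 * K\<^sup>2 * t * (\<integral>U. w j U * w k U * exp (t * q U) \<partial>\<mu>)" .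
  qed
  also have "\<dots> = 4 * K\<^sup>2 * t * (\<integral>U. (\<Sum>j<n. \<Sum>k<n. w j U * w k U * exp (t * q U)) \<partial>\<mu>)"
    using int_ww by (subst integral_double_sum) (auto simp: sum_distrib_left)
  also have "(\<integral>U. (\<Sum>j<n. \<Sum>k<n. w j U * w k U * exp (t * q U)) \<partial>\<mu>) = (\<integral>U. L\<^sup>2 * exp (t * q U) \<partial>\<mu>)"
  proof (rule Bochner_Integration.integral_cong[OF refl])
    fix U assume "U \<in> space \<mu>"
    have "(\<Sum>j<n. \<Sum>k<n. w j U * w k U * exp (t * q U)) = (\<Sum>j<n. w j U) * (\<Sum>k<n. w k U) * exp (t * q U)"
      by (subst sum_product) (simp add: sum_distrib_right)
    then show "(\<Sum>j<n. \<Sum>k<n. w j U * w k U * exp (t * q U)) = L\<^sup>2 * exp (t * q U)"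
      using w_sum[OF \<open>U \<in> space \<mu>\<close>] by (simp add: power2_eq_square)
  qed
  finally show ?thesis by (simp add: mgf_def mult_ac)
qed

text \<open>Gronwall's argument: by \<open>mgf_deriv_le\<close> the logarithmic derivative of
  \<open>mgf\<close> is at most \<open>2 * a * x\<close>, so dividing by
  \<open>exp (a * x\<^sup>2)\<close> gives a nonincreasing function.\<close>

lemma mgf_le:
  assumes n: "0 < n" and t: "0 \<le> t"
  shows "mgf t \<le> exp (2 * K\<^sup>2 * L\<^sup>2 / real n * t\<^sup>2)"
proof -
  define a where "a = 2 * K\<^sup>2 * L\<^sup>2 / real n"
  define h where "h x = mgf x * exp (- a * x\<^sup>2)" for x
  have "h t \<le> h 0"
  proof (rule DERIV_nonpos_imp_nonincreasing[OF t])
    fix x :: real assume x: "0 \<le> x" "x \<le> t"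
    define g where "g = (\<integral>U. q U * exp (x * q U) \<partial>\<mu>)"
    have "(h has_real_derivative g * exp (- a * x\<^sup>2) + mgf x * (exp (- a * x\<^sup>2) * (- a * (2 * x)))) (at x)"
      unfolding h_def g_def by (auto intro!: derivative_eq_intros mgf_deriv)
    moreover have "g \<le> 2 * a * x * mgf x"
      using mgf_deriv_le[OF x(1)] n by (simp add: g_def a_def field_simps)
    then have "(g - 2 * a * x * mgf x) * exp (- a * x\<^sup>2) \<le> 0"
      by (intro mult_nonpos_nonneg) auto
    then have "g * exp (- a * x\<^sup>2) + mgf x * (exp (- a * x\<^sup>2) * (- a * (2 * x))) \<le> 0"
      by (simp add: algebra_simps)
    ultimately show "\<exists>y. (h has_real_derivative y) (at x) \<and> y \<le> 0" by blast
  qed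
  moreover have "h 0 = 1" by (simp add: h_def mgf_def prob_space)
  ultimately have "mgf t * exp (- (a * t\<^sup>2)) \<le> 1" by (simp add: h_def)
  then show ?thesis by (simp add: a_def exp_minus field_simps)
qed

text \<open>The majorant \<open>L'\<close> replaces \<open>L\<close> so that one bound covers all
  vectors of the net, including the zero vector, for which \<open>L\<close> vanishes.\<close>

lemma upper_tail:
  assumes n: "0 < n" and K: "0 < K" and L': "0 < L'" "L \<le> L'" and s: "0 < s"
  shows "measure \<mu> {U \<in> space \<mu>. s \<le> q U} \<le> exp (- (real n * s\<^sup>2 / (8 * K\<^sup>2 * L'\<^sup>2)))"
proof -
  \<comment> \<open>This is the minimizer of the Chernoff exponent
    \<open>2 * K\<^sup>2 * L'\<^sup>2 / n * t\<^sup>2 - t * s\<close>.\<close>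
  define t where "t = real n * s / (4 * K\<^sup>2 * L'\<^sup>2)"
  have t: "0 < t" using n K L' s by (simp add: t_def)
  have "{U \<in> space \<mu>. s \<le> q U} = {U \<in> space \<mu>. exp (t * s) \<le> exp (t * q U)}"
    using t by auto
  then have "measure \<mu> {U \<in> space \<mu>. s \<le> q U} \<le> mgf t / exp (t * s)"
    unfolding mgf_def using integral_Markov_inequality_measure[OF integrable_exp[of t], of "{}" "exp (t * s)"]
    by simp
  also have "\<dots> \<le> exp (2 * K\<^sup>2 * L\<^sup>2 / real n * t\<^sup>2) / exp (t * s)"
    using mgf_le[OF n less_imp_le[OF t]] by (intro divide_right_mono) auto
  also have "\<dots> \<le> exp (2 * K\<^sup>2 * L'\<^sup>2 / real n * t\<^sup>2) / exp (t * s)"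
    using L' L_nonneg by (intro divide_right_mono) (auto intro!: divide_right_mono mult_right_mono mult_left_mono power_mono)
  also have "\<dots> = exp (2 * K\<^sup>2 * L'\<^sup>2 / real n * t\<^sup>2 - t * s)" by (simp add: exp_diff)
  also have "2 * K\<^sup>2 * L'\<^sup>2 / real n * t\<^sup>2 - t * s = - (real n * s\<^sup>2 / (8 * K\<^sup>2 * L'\<^sup>2))"
    using n K L' by (simp add: t_def power2_eq_square field_simps)
  finally show ?thesis .
qed

end

context haar
begin

text \<open>Subtracting the mean of the weights centres them and shifts the form by the constant
  \<open>m * rip v v\<close>. The centred weights are bounded by \<open>2 * K\<close>, which turns 8
  into 32; the opposite weights give the other tail.\<close>

lemma quadratic_form_concentration:
  assumes n: "0 < n" and v: "v \<in> carrier_vec n" "rip v v \<le> L" and L: "0 < L"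
    and l: "\<And>i. i < n \<Longrightarrow> \<bar>l i\<bar> \<le> K" and K: "0 < K" and s: "0 < s"
  defines "X \<equiv> \<lambda>U. (\<Sum>i<n. l i * (norm ((U *\<^sub>v v) $ i))\<^sup>2) - (\<Sum>i<n. l i) / real n * rip v v"
  shows "{U \<in> space \<mu>. s \<le> \<bar>X U\<bar>} \<in> sets \<mu>"
    and "measure \<mu> {U \<in> space \<mu>. s \<le> \<bar>X U\<bar>} \<le> 2 * exp (- (real n * s\<^sup>2 / (32 * K\<^sup>2 * L\<^sup>2)))"
proof -
  define m where "m = (\<Sum>i<n. l i) / real n"
  have m: "\<bar>m\<bar> \<le> K"
  proof -
    have "\<bar>\<Sum>i<n. l i\<bar> \<le> (\<Sum>i<n. \<bar>l i\<bar>)" by (rule sum_abs)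
    also have "\<dots> \<le> real n * K" using sum_bounded_above[of "{..<n}" "\<lambda>i. \<bar>l i\<bar>" K] l by simp
    finally show ?thesis using n by (simp add: m_def abs_divide field_simps)
  qed
  have bound: "\<bar>l i - m\<bar> \<le> 2 * K" if "i < n" for i using l[OF that] m by linarith
  have sum0: "(\<Sum>i<n. l i - m) = 0" using n by (simp add: sum_subtractf m_def)
  interpret up: haar_vector n \<mu> v "\<lambda>i. l i - m" "2 * K"
    by unfold_locales (use v bound sum0 in auto)
  interpret lo: haar_vector n \<mu> v "\<lambda>i. m - l i" "2 * K"
    by unfold_locales (use v bound sum0 in \<open>auto simp: abs_minus_commute sum_subtractf\<close>)
  have upq: "up.q U = X U" if "U \<in> space \<mu>" for U
  proof -
    have "up.q U = (\<Sum>i<n. l i * up.w i U) - m * (\<Sum>i<n. up.w i U)"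
      by (simp add: up.q_def left_diff_distrib sum_subtractf sum_distrib_left)
    also have "\<dots> = X U" unfolding up.w_sum[OF that] by (simp add: X_def up.w_def m_def up.L_def del: index_mult_mat_vec)
    finally show ?thesis .
  qed
  have loq: "lo.q U = - X U" if "U \<in> space \<mu>" for U
    unfolding upq[OF that, symmetric] up.q_def lo.q_def up.w_def lo.w_def
    by (simp add: left_diff_distrib sum_subtractf del: index_mult_mat_vec)
  have eq: "{U \<in> space \<mu>. s \<le> \<bar>X U\<bar>} = {U \<in> space \<mu>. s \<le> up.q U} \<union> {U \<in> space \<mu>. s \<le> lo.q U}"
    using upq loq by (auto simp: abs_if)
  have ms: "{U \<in> space \<mu>. s \<le> up.q U} \<in> sets \<mu>" "{U \<in> space \<mu>. s \<le> lo.q U} \<in> sets \<mu>"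
    by measurable
  show "{U \<in> space \<mu>. s \<le> \<bar>X U\<bar>} \<in> sets \<mu>" unfolding eq using ms by auto
  have "measure \<mu> {U \<in> space \<mu>. s \<le> \<bar>X U\<bar>} \<le> measure \<mu> {U \<in> space \<mu>. s \<le> up.q U} + measure \<mu> {U \<in> space \<mu>. s \<le> lo.q U}"
    unfolding eq by (rule measure_subadditive) (use ms in auto)
  also have "\<dots> \<le> exp (- (real n * s\<^sup>2 / (8 * (2 * K)\<^sup>2 * L\<^sup>2))) + exp (- (real n * s\<^sup>2 / (8 * (2 * K)\<^sup>2 * L\<^sup>2)))"
    using n K L s v by (intro add_mono up.upper_tail lo.upper_tail) (auto simp: up.L_def lo.L_def)
  finally show "measure \<mu> {U \<in> space \<mu>. s \<le> \<bar>X U\<bar>} \<le> 2 * exp (- (real n * s\<^sup>2 / (32 * K\<^sup>2 * L\<^sup>2)))"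
    by (simp add: power_mult_distrib)
qed

end

section \<open>Lattice points and nets of the unit sphere\<close>

lemma sum_half_powers_le: "(\<Sum>k\<in>{- int R..int R}. (1/2::real) ^ nat \<bar>k\<bar>) \<le> 3"
proof -
  have "(\<Sum>k\<in>{- int R..int R}. (1/2::real) ^ nat \<bar>k\<bar>) = 3 - 2 * (1/2) ^ R"
  proof (induction R)
    case (Suc R)
    have "{- int (Suc R)..int (Suc R)} = insert (- int (Suc R)) (insert (int (Suc R)) {- int R..int R})"
      by auto
    then show ?case using Suc by (simp add: nat_add_distrib)
  qed simp
  then show ?thesis by simp
qed

text \<open>An exponential Markov bound for counting: an integer is at most its square in modulus,
  so each point of \<open>G\<close> has weight at least 1 under \<open>2 ^ R\<close> times the
  product of \<open>(1/2) ^ \<bar>g i\<bar>\<close>. Over the full box the weights factor into one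
  geometric sum per coordinate, each at most 3.\<close>

lemma int_grid_card:
  fixes I :: "'i set" and R :: nat
  assumes I: "finite I"
  defines "G \<equiv> {g \<in> PiE I (\<lambda>_. UNIV :: int set). (\<Sum>i\<in>I. (g i)\<^sup>2) \<le> int R}"
  shows "finite G" "real (card G) \<le> 2 ^ R * 3 ^ card I"
proof -
  have abs_le: "\<bar>k\<bar> \<le> k\<^sup>2" for k :: int
  proof (cases "k = 0")
    case False
    then have "\<bar>k\<bar> * 1 \<le> \<bar>k\<bar> * \<bar>k\<bar>" by (intro mult_left_mono) auto
    then show ?thesis by (simp add: power2_eq_square abs_mult[symmetric])
  qed simp
  have le: "\<bar>g i\<bar> \<le> int R" if "g \<in> G" "i \<in> I" for g i
  proof -
    have "(g i)\<^sup>2 \<le> (\<Sum>i\<in>I. (g i)\<^sup>2)" using I that by (intro member_le_sum) auto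
    then show ?thesis using abs_le[of "g i"] that by (simp add: G_def)
  qed
  have sub: "G \<subseteq> PiE I (\<lambda>_. {- int R..int R})"
  proof
    fix g assume g: "g \<in> G"
    then have "g \<in> extensional I" by (simp add: G_def PiE_def)
    moreover have "g i \<in> {- int R..int R}" if "i \<in> I" for i using le[OF g that] by auto
    ultimately show "g \<in> PiE I (\<lambda>_. {- int R..int R})" by (auto simp: PiE_def)
  qed
  have fin: "finite (PiE I (\<lambda>_. {- int R..int R}))" using I by (intro finite_PiE) auto
  show "finite G" by (rule finite_subset[OF sub fin])
  have "real (card G) = (\<Sum>g\<in>G. 1)" by simp
  also have "\<dots> \<le> (\<Sum>g\<in>G. 2 ^ R * (\<Prod>i\<in>I. (1/2) ^ nat \<bar>g i\<bar>))"
  proof (rule sum_mono)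
    fix g assume g: "g \<in> G"
    have "int (\<Sum>i\<in>I. nat \<bar>g i\<bar>) = (\<Sum>i\<in>I. \<bar>g i\<bar>)" by simp
    also have "\<dots> \<le> (\<Sum>i\<in>I. (g i)\<^sup>2)" by (intro sum_mono abs_le)
    also have "\<dots> \<le> int R" using g by (simp add: G_def)
    finally have "(\<Sum>i\<in>I. nat \<bar>g i\<bar>) \<le> R" by (simp only: of_nat_le_iff)
    then have "(1/2::real) ^ R \<le> (1/2) ^ (\<Sum>i\<in>I. nat \<bar>g i\<bar>)" by (intro power_decreasing) auto
    then have "2 ^ R * (1/2::real) ^ R \<le> 2 ^ R * (\<Prod>i\<in>I. (1/2) ^ nat \<bar>g i\<bar>)"
      unfolding power_sum by (intro mult_left_mono) auto
    then show "1 \<le> 2 ^ R * (\<Prod>i\<in>I. (1/2::real) ^ nat \<bar>g i\<bar>)" by (simp flip: power_mult_distrib)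
  qed
  also have "\<dots> \<le> (\<Sum>g\<in>PiE I (\<lambda>_. {- int R..int R}). 2 ^ R * (\<Prod>i\<in>I. (1/2) ^ nat \<bar>g i\<bar>))"
    by (intro sum_mono2 fin sub mult_nonneg_nonneg prod_nonneg) auto
  also have "\<dots> = 2 ^ R * (\<Prod>i\<in>I. \<Sum>k\<in>{- int R..int R}. (1/2) ^ nat \<bar>k\<bar>)"
    using I by (subst prod_sum_PiE) (auto simp: sum_distrib_left)
  also have "\<dots> \<le> 2 ^ R * 3 ^ card I"
    using sum_half_powers_le[of R] by (auto intro!: mult_left_mono power_mono sum_nonneg)
  finally show "real (card G) \<le> 2 ^ R * 3 ^ card I" .
qed

lemma rip_add_le:
  fixes x y :: "'a::rcfield vec"
  assumes "x \<in> carrier_vec n" "y \<in> carrier_vec n"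
  shows "rip (x + y) (x + y) \<le> 2 * rip x x + 2 * rip y y"
proof -
  have "(norm (a + b))\<^sup>2 \<le> 2 * (norm a)\<^sup>2 + 2 * (norm b)\<^sup>2" for a b :: 'a
    using power_mono[OF norm_triangle_ineq[of a b], of 2] sum_squares_bound[of "norm a" "norm b"]
    by (simp add: power2_sum)
  then have "(\<Sum>i<n. (norm (x $ i + y $ i))\<^sup>2) \<le> (\<Sum>i<n. 2 * (norm (x $ i))\<^sup>2 + 2 * (norm (y $ i))\<^sup>2)"
    by (intro sum_mono)
  then show ?thesis
    using assms by (simp add: rip_self sum.distrib sum_distrib_left)
qed

text \<open>A grid of mesh \<open>h = 1 / (4 sqrt D)\<close> in the \<open>D\<close> real coordinates indexed by
  \<open>J \<times> Basis\<close> is a \<open>1/4\<close>-net of the unit sphere.  A grid point at distance at most \<open>1/4\<close> from a unit vector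
  has squared norm at most \<open>2 + 2/16 = 17/8\<close>, so its integer coordinates have square sum at most
  \<open>17/8 * 16 D = 34 D\<close>.\<close>

definition grid_vec :: "nat \<Rightarrow> nat set \<Rightarrow> (nat \<times> 'a \<Rightarrow> int) \<Rightarrow> 'a::rcfield vec" where
  "grid_vec n J g = vec n (\<lambda>j. if j \<in> J
     then (\<Sum>b\<in>Basis. (of_int (g (j, b)) / (4 * sqrt (real (card J * DIM('a))))) *\<^sub>R b) else 0)"

definition grid :: "nat set \<Rightarrow> (nat \<times> 'a::rcfield \<Rightarrow> int) set" where
  "grid J = {g \<in> PiE (J \<times> Basis) (\<lambda>_. UNIV). (\<Sum>i\<in>J \<times> Basis. (g i)\<^sup>2) \<le> int (34 * (card J * DIM('a)))}"

lemma grid_card: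
  assumes "finite J"
  shows "finite (grid J :: (nat \<times> 'a::rcfield \<Rightarrow> int) set)"
    "real (card (grid J :: (nat \<times> 'a::rcfield \<Rightarrow> int) set)) \<le> (3 * 2 ^ 34) ^ (card J * DIM('a))"
proof -
  have fin: "finite (J \<times> (Basis :: 'a set))" using assms by simp
  have card: "card (J \<times> (Basis :: 'a set)) = card J * DIM('a)" by (simp add: card_cartesian_product)
  note g = int_grid_card[OF fin, of "34 * (card J * DIM('a))"]
  show "finite (grid J :: (nat \<times> 'a::rcfield \<Rightarrow> int) set)"
    using g(1) unfolding grid_def .
  show "real (card (grid J :: (nat \<times> 'a::rcfield \<Rightarrow> int) set)) \<le> (3 * 2 ^ 34) ^ (card J * DIM('a))"
  proof -
    have "(2::real) ^ (34 * D) * 3 ^ D = (3 * 2 ^ 34) ^ D" for D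
      by (subst power_mult, subst power_mult_distrib[symmetric]) (simp add: mult.commute)
    then show ?thesis using g(2) unfolding grid_def card by (simp only:)
  qed
qed

lemma norm_sum_Basis_squared:
  fixes f :: "'a::euclidean_space \<Rightarrow> real"
  shows "(norm (\<Sum>b\<in>Basis. f b *\<^sub>R b))\<^sup>2 = (\<Sum>b\<in>Basis. (f b)\<^sup>2)"
  unfolding power2_norm_eq_inner by (subst euclidean_inner) (simp add: power2_eq_square)

lemma grid_approximation:
  fixes a :: "'a::rcfield vec"
  assumes J: "J \<subseteq> {..<n}" "J \<noteq> {}" and a: "a \<in> carrier_vec n" "\<And>j. j < n \<Longrightarrow> j \<notin> J \<Longrightarrow> a $ j = 0"
    and a1: "rip a a = 1"
  shows "\<exists>g\<in>grid J. rip (a - grid_vec n J g) (a - grid_vec n J g) \<le> 1 / 16 \<and>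
    rip (grid_vec n J g) (grid_vec n J g) \<le> 3"
proof -
  have finJ: "finite J" using J(1) finite_subset by blast
  define D where "D = card J * DIM('a)"
  have D: "0 < D" using finJ J(2) by (simp add: D_def card_gt_0_iff)
  define h where "h = 1 / (4 * sqrt (real D))"
  have h: "0 < h" using D by (simp add: h_def)
  have h2: "real D * h\<^sup>2 = 1 / 16" using D by (simp add: h_def power_divide power_mult_distrib)
  \<comment> \<open>Each real coordinate is rounded down to the mesh with error at most
    \<open>h\<close>, for a total squared error of at most \<open>D * h\<^sup>2 = 1 / 16\<close>.
    The value outside the index set makes \<open>g\<close> extensional, as membership in the grid
    demands.\<close>
  define g where "g = (\<lambda>(j, b). if j \<in> J \<and> b \<in> Basis then \<lfloor>inner (a $ j) b / h\<rfloor> else undefined)"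
  define u where "u = grid_vec n J g"
  have u: "u \<in> carrier_vec n" by (simp add: u_def grid_vec_def)
  have uj: "u $ j = (\<Sum>b\<in>Basis. (of_int (g (j, b)) * h) *\<^sub>R b)" if "j \<in> J" for j
    using that J(1) by (auto simp: u_def grid_vec_def h_def D_def)
  have u0: "u $ j = 0" if "j < n" "j \<notin> J" for j using that by (simp add: u_def grid_vec_def)
  have diff: "(norm ((a - u) $ j))\<^sup>2 \<le> real DIM('a) * h\<^sup>2" if j: "j \<in> J" for j
  proof -
    have jn: "j < n" using j J(1) by auto
    have "(a - u) $ j = (\<Sum>b\<in>Basis. (inner (a $ j) b - of_int (g (j, b)) * h) *\<^sub>R b)"
      using jn a(1) u uj[OF j] by (simp add: scaleR_diff_left sum_subtractf euclidean_representation)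
    then have "(norm ((a - u) $ j))\<^sup>2 = (\<Sum>b\<in>Basis. (inner (a $ j) b - of_int (g (j, b)) * h)\<^sup>2)"
      by (simp only: norm_sum_Basis_squared)
    also have "\<dots> \<le> (\<Sum>b\<in>(Basis :: 'a set). h\<^sup>2)"
    proof (rule sum_mono)
      fix b :: 'a assume b: "b \<in> Basis"
      define r where "r = inner (a $ j) b / h"
      have "inner (a $ j) b - of_int (g (j, b)) * h = (r - of_int \<lfloor>r\<rfloor>) * h"
        using b j h by (simp add: g_def r_def left_diff_distrib)
      moreover have "\<bar>r - of_int \<lfloor>r\<rfloor>\<bar> \<le> 1" by linarith
      ultimately have "\<bar>inner (a $ j) b - of_int (g (j, b)) * h\<bar> \<le> h"
        using h by (simp add: abs_mult)
      then show "(inner (a $ j) b - of_int (g (j, b)) * h)\<^sup>2 \<le> h\<^sup>2"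
        using h by (simp add: power2_le_iff_abs_le)
    qed
    finally show ?thesis by simp
  qed
  have "rip (a - u) (a - u) = (\<Sum>j<n. (norm ((a - u) $ j))\<^sup>2)" using u by (simp add: rip_self)
  also have "\<dots> = (\<Sum>j\<in>J. (norm ((a - u) $ j))\<^sup>2)"
    using J(1) a u u0 by (intro sum.mono_neutral_right) auto
  also have "\<dots> \<le> (\<Sum>j\<in>J. real DIM('a) * h\<^sup>2)" by (intro sum_mono diff)
  also have "\<dots> = 1 / 16" using h2 by (simp add: D_def)
  finally have close: "rip (a - u) (a - u) \<le> 1 / 16" .
  have "u = a + of_real (- 1) \<cdot>\<^sub>v (a - u)" using a(1) u by (intro eq_vecI) auto
  then have "rip u u = rip (a + of_real (- 1) \<cdot>\<^sub>v (a - u)) (a + of_real (- 1) \<cdot>\<^sub>v (a - u))" by simp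
  also have "\<dots> \<le> 2 * rip a a + 2 * rip (of_real (- 1) \<cdot>\<^sub>v (a - u)) (of_real (- 1) \<cdot>\<^sub>v (a - u))"
    using a(1) u by (intro rip_add_le[of _ n]) auto
  also have "rip (of_real (- 1) \<cdot>\<^sub>v (a - u)) (of_real (- 1) \<cdot>\<^sub>v (a - u)) = rip (a - u) (a - u)"
    using a(1) u by (simp add: rip_self norm_mult del: index_minus_vec)
  finally have uu: "rip u u \<le> 17 / 8" using close a1 by simp
  have "h\<^sup>2 * (\<Sum>i\<in>J \<times> Basis. (real_of_int (g i))\<^sup>2) = (\<Sum>j\<in>J. \<Sum>b\<in>Basis. (of_int (g (j, b)) * h)\<^sup>2)"
    by (simp add: sum.cartesian_product' sum_distrib_left power_mult_distrib mult.commute)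
  also have "\<dots> = (\<Sum>j\<in>J. (norm (u $ j))\<^sup>2)"
    by (simp add: uj norm_sum_Basis_squared)
  also have "\<dots> = rip u u"
    using J(1) u u0 unfolding rip_self by (intro sum.mono_neutral_left) auto
  finally have "real D * h\<^sup>2 * (\<Sum>i\<in>J \<times> Basis. (real_of_int (g i))\<^sup>2) \<le> real D * (17 / 8)"
    using uu D by (simp add: mult.assoc mult_left_mono)
  then have "(\<Sum>i\<in>J \<times> Basis. (real_of_int (g i))\<^sup>2) \<le> 34 * real D" unfolding h2 by simp
  then have "real_of_int (\<Sum>i\<in>J \<times> Basis. (g i)\<^sup>2) \<le> real_of_int (int (34 * D))" by simp
  then have "(\<Sum>i\<in>J \<times> Basis. (g i)\<^sup>2) \<le> int (34 * D)" by (simp only: of_int_le_iff)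
  then have "g \<in> grid J" by (auto simp: grid_def D_def g_def PiE_def extensional_def)
  then show ?thesis using close uu by (auto simp: u_def)
qed

section \<open>Outliers of diagonal models\<close>

context diagonal_perturbation
begin

definition support :: "nat set" where
  "support = {j. j < n \<and> p j \<noteq> 0}"

lemma resolvent_form_smult:
  assumes "a \<in> carrier_vec n"
  shows "resolvent_form z (of_real c \<cdot>\<^sub>v a) = c\<^sup>2 * resolvent_form z a"
  using assms Vc unfolding resolvent_form_def mult_mat_vec[OF Vc assms]
  by (simp add: norm_mult power_mult_distrib sum_distrib_left del: index_mult_mat_vec)

text \<open>Any finite bound will do: it makes the supremum over the unit sphere exist in the
  passage from the net.\<close>

lemma resolvent_form_le:
  assumes z: "\<And>i. i < n \<Longrightarrow> d i < z" and a: "a \<in> carrier_vec n"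
  shows "0 \<le> resolvent_form z a" "resolvent_form z a \<le> (\<Sum>i<n. 1 / (z - d i)) * rip a a"
proof -
  show "0 \<le> resolvent_form z a"
    unfolding resolvent_form_def using z by (intro sum_nonneg divide_nonneg_pos) auto
  have "(norm ((V *\<^sub>v a) $ i))\<^sup>2 \<le> rip a a" if "i < n" for i
    unfolding rip_V[OF a] using that by (intro member_le_sum) auto
  then have "(norm ((V *\<^sub>v a) $ i))\<^sup>2 / (z - d i) \<le> 1 / (z - d i) * rip a a" if "i < n" for i
    using z[OF that] that divide_right_mono[of "(norm ((V *\<^sub>v a) $ i))\<^sup>2" "rip a a" "z - d i"]
    by (simp del: index_mult_mat_vec)
  then show "resolvent_form z a \<le> (\<Sum>i<n. 1 / (z - d i)) * rip a a"
    unfolding resolvent_form_def sum_distrib_right by (intro sum_mono) auto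
qed

text \<open>Passing from the net to all vectors: if the Hermitian form \<open>q\<close> is bounded by \<open>S\<close> on
  the unit sphere, then its increment between points at distance at most \<open>1/4\<close> is at most
  \<open>3 S / 4\<close>, so \<open>S \<le> \<tau> + 3 S / 4\<close>.\<close>

lemma net_bound:
  assumes z: "\<And>i. i < n \<Longrightarrow> d i < z"
    and net: "\<And>g. g \<in> grid support \<Longrightarrow> rip (grid_vec n support g) (grid_vec n support g) \<le> 3 \<Longrightarrow>
      \<bar>resolvent_form z (grid_vec n support g) - m * rip (grid_vec n support g) (grid_vec n support g)\<bar> \<le> \<tau>"
    and a: "supported a"
  shows "\<bar>resolvent_form z a - m * rip a a\<bar> \<le> 4 * \<tau> * rip a a"
proof -
  define q where "q x = resolvent_form z x - m * rip x x" for x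
  have q_smult: "q (of_real c \<cdot>\<^sub>v x) = c\<^sup>2 * q x" if "x \<in> carrier_vec n" for c x
    unfolding q_def using that by (simp add: resolvent_form_smult rip_smult_self algebra_simps)
  have q0: "q (0\<^sub>v n) = 0"
  proof -
    have "(of_real 0 :: 'a) \<cdot>\<^sub>v 0\<^sub>v n = 0\<^sub>v n" by (intro eq_vecI) auto
    then show ?thesis using q_smult[of "0\<^sub>v n" 0] by (metis mult_zero_left zero_carrier_vec zero_power2)
  qed
  define A where "A = {x. supported x \<and> rip x x = 1}"
  define S where "S = (SUP x\<in>A. \<bar>q x\<bar>)"
  have bdd: "bdd_above ((\<lambda>x. \<bar>q x\<bar>) ` A)"
  proof (rule bdd_aboveI2)
    fix x assume "x \<in> A"
    then show "\<bar>q x\<bar> \<le> (\<Sum>i<n. 1 / (z - d i)) + \<bar>m\<bar>"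
      using resolvent_form_le[OF z, of x] by (auto simp: A_def supported_def q_def)
  qed
  have normalize: "\<exists>c y. y \<in> A \<and> x = of_real c \<cdot>\<^sub>v y" if x: "supported x" "x \<noteq> 0\<^sub>v n" for x
  proof -
    obtain b c where "rip (of_real b \<cdot>\<^sub>v x) (of_real b \<cdot>\<^sub>v x) = 1" "x = of_real c \<cdot>\<^sub>v (of_real b \<cdot>\<^sub>v x)"
      using normalize_vec[of x n] x by (auto simp: supported_def)
    moreover have "supported (of_real b \<cdot>\<^sub>v x)" using x by (auto simp: supported_def)
    ultimately show ?thesis by (auto simp: A_def)
  qed
  have qS: "\<bar>q x\<bar> \<le> S * rip x x" if x: "supported x" for x
  proof (cases "x = 0\<^sub>v n")
    case True
    then have "q x = 0" "rip x x = 0"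
      using q0 rip_eq_0_iff[of x n] x by (auto simp: supported_def)
    then show ?thesis by simp
  next
    case False
    then obtain c y where y: "y \<in> A" "x = of_real c \<cdot>\<^sub>v y" using normalize x by blast
    then have yc: "y \<in> carrier_vec n" "rip y y = 1" by (auto simp: A_def supported_def)
    have "\<bar>q y\<bar> \<le> S" unfolding S_def by (rule cSUP_upper[OF y(1) bdd])
    then show ?thesis
      unfolding y(2) q_smult[OF yc(1)] rip_smult_self yc(2)
      by (simp add: abs_mult mult.commute[of S] mult_left_mono)
  qed
  show ?thesis
  proof (cases "a = 0\<^sub>v n")
    case True
    then have "q a = 0" "rip a a = 0"
      using q0 rip_eq_0_iff[of a n] a by (auto simp: supported_def)
    then show ?thesis by (simp add: q_def)
  next
    case False
    then have ne: "A \<noteq> {}" using normalize a by blast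
    have "S \<le> \<tau> + 3 / 4 * S"
      unfolding S_def[of, symmetric]
    proof (subst S_def, rule cSUP_least[OF ne])
      fix x assume "x \<in> A"
      then have x: "supported x" "x \<in> carrier_vec n" "rip x x = 1" by (auto simp: A_def supported_def)
      have supp: "support \<subseteq> {..<n}" by (auto simp: support_def)
      have "support \<noteq> {}"
      proof
        assume "support = {}"
        then have "rip x x = 0" using x by (auto simp: rip_self support_def supported_def)
        then show False using x by simp
      qed
      moreover have "x $ j = 0" if "j < n" "j \<notin> support" for j
        using x(1) that by (auto simp: support_def supported_def)
      ultimately obtain g where g: "g \<in> grid support"
        "rip (x - grid_vec n support g) (x - grid_vec n support g) \<le> 1 / 16"
        "rip (grid_vec n support g) (grid_vec n support g) \<le> 3"
        using grid_approximation[OF supp _ x(2) _ x(3)] by blast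
      define u where "u = grid_vec n support g"
      have uc: "u \<in> carrier_vec n" by (simp add: u_def grid_vec_def)
      have u: "supported u" by (auto simp: supported_def u_def grid_vec_def support_def)
      define f y where "f = x - u" and "y = x + u"
      have fy: "f \<in> carrier_vec n" "y \<in> carrier_vec n" using x(2) uc by (auto simp: f_def y_def)
      have supp_fy: "supported (of_real 11 \<cdot>\<^sub>v f + y)" "supported (of_real 11 \<cdot>\<^sub>v f - y)"
        using x(1) u by (auto simp: supported_def f_def y_def)
      define b where "b = (\<Sum>i<n. inner ((V *\<^sub>v f) $ i) ((V *\<^sub>v y) $ i) / (z - d i)) - m * rip f y"
      have pol: "q (of_real l \<cdot>\<^sub>v f + y) - q (of_real l \<cdot>\<^sub>v f - y) = 4 * l * b" for l
        unfolding q_def rip_polarization[OF fy] b_def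
        using resolvent_form_polarization[OF fy, of z l] by (simp add: algebra_simps)
      \<comment> \<open>With \<open>f = x - u\<close> and \<open>y = x + u\<close>, scale 1 gives
        the increment \<open>q x - q u\<close> as the bilinear form at \<open>f\<close> and
        \<open>y\<close>.\<close>
      have "of_real 1 \<cdot>\<^sub>v f + y = of_real 2 \<cdot>\<^sub>v x" "of_real 1 \<cdot>\<^sub>v f - y = of_real (- 2) \<cdot>\<^sub>v u"
        using x(2) uc by (auto intro!: eq_vecI simp: f_def y_def)
      then have "q x - q u = b"
        using pol[of 1] q_smult[OF x(2), of 2] q_smult[OF uc, of "- 2"] by simp
      \<comment> \<open>The scale 11 nearly balances the short \<open>f\<close> against the long
        \<open>y\<close>: \<open>121 * rip f f\<close> is at most 121/16 and \<open>rip y y\<close>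
        at most 8 + 1/8. Their sum is below 16, whence \<open>\<bar>b\<bar>\<close> is at most 8/11
        of \<open>S\<close>, just under 3/4.\<close>
      moreover have "\<bar>4 * 11 * b\<bar> \<le> S * (2 * (121 * rip f f + rip y y))"
      proof -
        have "\<bar>4 * 11 * b\<bar> \<le> \<bar>q (of_real 11 \<cdot>\<^sub>v f + y)\<bar> + \<bar>q (of_real 11 \<cdot>\<^sub>v f - y)\<bar>"
          using pol[of 11] by linarith
        also have "\<dots> \<le> S * rip (of_real 11 \<cdot>\<^sub>v f + y) (of_real 11 \<cdot>\<^sub>v f + y) +
            S * rip (of_real 11 \<cdot>\<^sub>v f - y) (of_real 11 \<cdot>\<^sub>v f - y)"
          by (intro add_mono qS supp_fy)
        also have "\<dots> = S * (2 * (121 * rip f f + rip y y))"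
          unfolding rip_polarization[OF fy] by (simp add: algebra_simps)
        finally show ?thesis .
      qed
      moreover have S: "0 \<le> S" using qS[OF x(1)] x(3) by simp
      moreover have "121 * rip f f + rip y y \<le> 16"
      proof -
        have "y = of_real 2 \<cdot>\<^sub>v x + of_real (- 1) \<cdot>\<^sub>v f"
          using x(2) uc by (auto intro!: eq_vecI simp: f_def y_def)
        then have "rip y y \<le> 2 * rip (of_real 2 \<cdot>\<^sub>v x) (of_real 2 \<cdot>\<^sub>v x) + 2 * rip (of_real (- 1) \<cdot>\<^sub>v f) (of_real (- 1) \<cdot>\<^sub>v f)"
          using rip_add_le[of "of_real 2 \<cdot>\<^sub>v x" n "of_real (- 1) \<cdot>\<^sub>v f"] x(2) fy by simp
        then have "rip y y \<le> 8 + 2 * rip f f"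
          unfolding rip_smult_self by (simp add: x(3))
        then show ?thesis using g(2) by (simp add: f_def u_def)
      qed
      ultimately have "\<bar>4 * 11 * b\<bar> \<le> S * (2 * 16)" "q x - q u = b"
        using mult_left_mono[of "2 * (121 * rip f f + rip y y)" "2 * 16" S] by auto
      moreover have "\<bar>q u\<bar> \<le> \<tau>" unfolding q_def u_def by (rule net[OF g(1,3)])
      ultimately show "\<bar>q x\<bar> \<le> \<tau> + 3 / 4 * S" using S by linarith
    qed
    then have "S * rip a a \<le> 4 * \<tau> * rip a a" by (intro mult_right_mono) auto
    then show ?thesis using qS[OF a] by (simp add: q_def)
  qed
qed

end

section \<open>Union bound over the net\<close>

lemma borel_measurable_conjugate:
  fixes f :: "'w \<Rightarrow> 'a::rcfield"
  assumes "f \<in> borel_measurable M"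
  shows "(\<lambda>w. conjugate (f w)) \<in> borel_measurable M"
proof -
  have "continuous_on UNIV (conjugate :: 'a \<Rightarrow> 'a)"
    unfolding continuous_on_iff dist_norm conjugate_diff[symmetric] norm_conjugate by blast
  then show ?thesis
    using assms borel_measurable_continuous_onI measurable_compose by blast
qed

context haar
begin

text \<open>The resolvent form is a quadratic form with weights \<open>1 / (z - d i)\<close>,
  bounded by \<open>1 / \<delta>\<close>, and \<open>m\<close> is their mean. The exceptional event
  is produced explicitly so that the deterministic bounds can be applied pointwise outside
  it.\<close>

lemma resolvent_concentration:
  fixes d :: "nat \<Rightarrow> real" and J :: "nat set" and z :: real
  assumes n: "0 < n" and \<delta>: "0 < \<delta>" and z: "\<And>i. i < n \<Longrightarrow> \<delta> \<le> z - d i" and J: "finite J" and \<tau>: "0 < \<tau>"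
  defines "m \<equiv> (\<Sum>i<n. 1 / (z - d i)) / real n"
  shows "\<exists>E\<in>sets \<mu>. measure \<mu> E \<le> 2 * (3 * 2 ^ 34) ^ (card J * DIM('a)) * exp (- (real n * \<tau>\<^sup>2 * \<delta>\<^sup>2 / 288)) \<and>
    (\<forall>U\<in>space \<mu> - E. \<forall>g\<in>grid J. rip (grid_vec n J g) (grid_vec n J g) \<le> 3 \<longrightarrow>
      \<bar>(\<Sum>i<n. (norm ((U *\<^sub>v grid_vec n J g) $ i))\<^sup>2 / (z - d i)) - m * rip (grid_vec n J g) (grid_vec n J g)\<bar> \<le> \<tau>)"
proof -
  define X where "X v U = (\<Sum>i<n. 1 / (z - d i) * (norm ((U *\<^sub>v v) $ i))\<^sup>2) - m * rip v v" for v and U :: "'a mat"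
  define G where "G = {g \<in> grid J. rip (grid_vec n J g) (grid_vec n J g :: 'a vec) \<le> 3}"
  have G: "finite G"
    by (rule finite_subset[OF _ grid_card(1)[OF J, where 'a = 'a]]) (auto simp: G_def)
  define E where "E g = {U \<in> space \<mu>. \<tau> \<le> \<bar>X (grid_vec n J g) U\<bar>}" for g
  have l: "\<bar>1 / (z - d i)\<bar> \<le> 1 / \<delta>" if "i < n" for i
    using z[OF that] \<delta> by (simp add: frac_le)
  have E: "E g \<in> sets \<mu>" "measure \<mu> (E g) \<le> 2 * exp (- (real n * \<tau>\<^sup>2 * \<delta>\<^sup>2 / 288))" if g: "g \<in> G" for g
  proof -
    have v: "grid_vec n J g \<in> carrier_vec n" "rip (grid_vec n J g) (grid_vec n J g :: 'a vec) \<le> 3"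
      using g by (auto simp: G_def grid_vec_def)
    have pos: "(0::real) < 3" "0 < 1 / \<delta>" using \<delta> by auto
    \<comment> \<open>Net vectors have squared norm at most 3 and the weights are bounded by
      \<open>1 / \<delta>\<close>; the denominator 288 is 32 times 9.\<close>
    note c = quadratic_form_concentration[where l = "\<lambda>i. 1 / (z - d i)" and L = 3 and K = "1 / \<delta>",
        OF n v pos(1) l pos(2) \<tau>]
    show "E g \<in> sets \<mu>" unfolding E_def X_def m_def by (rule c(1))
    have "measure \<mu> (E g) \<le> 2 * exp (- (real n * \<tau>\<^sup>2 / (32 * (1 / \<delta>)\<^sup>2 * 3\<^sup>2)))"
      unfolding E_def X_def m_def by (rule c(2))
    also have "real n * \<tau>\<^sup>2 / (32 * (1 / \<delta>)\<^sup>2 * 3\<^sup>2) = real n * \<tau>\<^sup>2 * \<delta>\<^sup>2 / 288"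
      using \<delta> by (simp add: power_divide)
    finally show "measure \<mu> (E g) \<le> 2 * exp (- (real n * \<tau>\<^sup>2 * \<delta>\<^sup>2 / 288))" .
  qed
  show ?thesis
  proof (intro bexI[of _ "\<Union>g\<in>G. E g"] conjI ballI impI)
    show U: "(\<Union>g\<in>G. E g) \<in> sets \<mu>" using G E by (intro sets.finite_UN) auto
    have "measure \<mu> (\<Union>g\<in>G. E g) \<le> (\<Sum>g\<in>G. measure \<mu> (E g))"
      using G E by (intro finite_measure_subadditive_finite) auto
    also have "\<dots> \<le> real (card G) * (2 * exp (- (real n * \<tau>\<^sup>2 * \<delta>\<^sup>2 / 288)))"
      using sum_bounded_above[of G "\<lambda>g. measure \<mu> (E g)"] E by simp
    also have "\<dots> \<le> (3 * 2 ^ 34) ^ (card J * DIM('a)) * (2 * exp (- (real n * \<tau>\<^sup>2 * \<delta>\<^sup>2 / 288)))"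
    proof (rule mult_right_mono)
      have "card G \<le> card (grid J :: (nat \<times> 'a \<Rightarrow> int) set)"
        unfolding G_def by (rule card_mono[OF grid_card(1)[OF J]]) auto
      then show "real (card G) \<le> (3 * 2 ^ 34) ^ (card J * DIM('a))"
        using grid_card(2)[OF J, where 'a = 'a] by linarith
    qed simp
    finally show "measure \<mu> (\<Union>g\<in>G. E g) \<le> 2 * (3 * 2 ^ 34) ^ (card J * DIM('a)) * exp (- (real n * \<tau>\<^sup>2 * \<delta>\<^sup>2 / 288))"
      by (simp only: mult_ac)
    fix U g assume U: "U \<in> space \<mu> - (\<Union>g\<in>G. E g)" and g: "g \<in> grid J" "rip (grid_vec n J g) (grid_vec n J g :: 'a vec) \<le> 3"
    then have "U \<in> space \<mu>" "U \<notin> E g" by (auto simp: G_def)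
    then show "\<bar>(\<Sum>i<n. (norm ((U *\<^sub>v grid_vec n J g) $ i))\<^sup>2 / (z - d i)) - m * rip (grid_vec n J g) (grid_vec n J g)\<bar> \<le> \<tau>"
      by (auto simp: E_def X_def simp del: index_mult_mat_vec)
  qed
qed

lemma measurable_perturbed_eigval:
  assumes k: "1 \<le> k" "k \<le> n"
  shows "(\<lambda>U. nth_eigval k (mat_adjoint U * real_diag n d * U + real_diag n p)) \<in> borel_measurable \<mu>"
proof (rule borel_measurable_nth_eigval[OF _ _ k])
  fix U assume "U \<in> space \<mu>"
  then have "U \<in> carrier_mat n n" using space_mu unitary_matsD(1) by blast
  then show "mat_adjoint U * real_diag n d * U + real_diag n p \<in> selfadjoint_mats n"
    by (intro selfadjoint_add selfadjoint_congruence selfadjoint_real_diag)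
next
  fix i j assume ij: "i < n" "j < n"
  have "(\<lambda>U. (\<Sum>l<n. conjugate (U $$ (l, i)) * (of_real (d l) * U $$ (l, j))) + real_diag n p $$ (i, j)) \<in> borel_measurable \<mu>"
    using ij by (intro borel_measurable_add borel_measurable_sum borel_measurable_times
        borel_measurable_conjugate measurable_entry borel_measurable_const) auto
  moreover have "(mat_adjoint U * real_diag n d * U + real_diag n p) $$ (i, j) =
      (\<Sum>l<n. conjugate (U $$ (l, i)) * (of_real (d l) * U $$ (l, j))) + real_diag n p $$ (i, j)"
    if "U \<in> space \<mu>" for U
  proof -
    have U: "U \<in> carrier_mat n n" using that space_mu unitary_matsD(1) by blast
    have D: "(real_diag n d * U) $$ (l, j) = of_real (d l) * U $$ (l, j)" if "l < n" for l
    proof -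
      have "(real_diag n d * U) $$ (l, j) = (\<Sum>m<n. (if l = m then of_real (d m) * U $$ (m, j) else 0))"
        using U that ij by (simp add: scalar_prod_def lessThan_atLeast0 real_diag_def mult_delta_left)
      then show ?thesis using that by simp
    qed
    have "mat_adjoint U * real_diag n d * U = mat_adjoint U * (real_diag n d * U)"
      using U by (intro assoc_mult_mat[of _ n n _ n _ n]) auto
    moreover have "(mat_adjoint U * (real_diag n d * U)) $$ (i, j) =
        (\<Sum>l<n. mat_adjoint U $$ (i, l) * (real_diag n d * U) $$ (l, j))"
      using U ij by (simp add: scalar_prod_def lessThan_atLeast0 del: index_mult_mat(1))
        (simp add: scalar_prod_def lessThan_atLeast0)
    ultimately show ?thesis
      using U ij by (simp add: D del: index_mult_mat(1))
  qed
  ultimately show "(\<lambda>U. (mat_adjoint U * real_diag n d * U + real_diag n p) $$ (i, j)) \<in> borel_measurable \<mu>"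
    by (simp cong: measurable_cong)
qed

end

text \<open>The accuracy demanded of the resolvent form is \<open>net_ratio \<delta> B * \<epsilon>\<close>.  The constant
  \<open>1 / (3 B (3 B + \<delta>))\<close> bounds the slope of the Stieltjes transform from below between
  \<open>\<rho> - \<epsilon>\<close> and \<open>\<rho> + \<epsilon>\<close>.\<close>

definition net_ratio :: "real \<Rightarrow> real \<Rightarrow> real" where
  "net_ratio \<delta> B = min (1 / \<delta>) (1 / (3 * B * (3 * B + \<delta>)) / (1 + 2 * B / \<delta> + B))"

lemma net_ratio_pos: "0 < \<delta> \<Longrightarrow> 0 < B \<Longrightarrow> 0 < net_ratio \<delta> B"
  by (auto simp: net_ratio_def intro!: divide_pos_pos mult_pos_pos add_pos_pos)

text \<open>The averages \<open>mp\<close> and \<open>mm\<close> at \<rho> + \<epsilon> and \<rho> -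
  \<epsilon> lie below and above 1/\<theta> by at least \<open>c0 * \<epsilon>\<close>. Outside two
  small events the resolvent forms follow these averages up to \<eta>, which places the eigenvalue
  between the two points. The factor 4 counts two events with two tails each.\<close>

lemma (in haar) diagonal_outlier:
  fixes d p :: "nat \<Rightarrow> real"
  assumes B: "0 < B" and \<delta>: "0 < \<delta>" and \<epsilon>: "0 < \<epsilon>" "\<epsilon> \<le> \<delta>"
    and d: "\<And>i j. i \<le> j \<Longrightarrow> j < n \<Longrightarrow> d j \<le> d i" "\<And>i. i < n \<Longrightarrow> \<bar>d i\<bar> \<le> B"
    and p: "\<And>i j. i \<le> j \<Longrightarrow> j < n \<Longrightarrow> p j \<le> p i" "\<And>i. i < n \<Longrightarrow> \<bar>p i\<bar> \<le> B"
    and k: "1 \<le> k" "k \<le> n" and \<theta>: "\<theta> = p (k - 1)" "0 < \<theta>"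
    and \<rho>: "d 0 + 2 * \<delta> \<le> \<rho>" "(\<Sum>i<n. 1 / (\<rho> - d i)) / real n = 1 / \<theta>"
  shows "1 - 4 * (3 * 2 ^ 34) ^ (card {j. j < n \<and> p j \<noteq> 0} * DIM('a)) *
      exp (- (real n * (net_ratio \<delta> B * \<epsilon> / 4)\<^sup>2 * \<delta>\<^sup>2 / 288)) \<le>
    measure \<mu> {U \<in> space \<mu>. nth_eigval k (mat_adjoint U * real_diag n d * U + real_diag n p) \<in> {\<rho> - \<epsilon>..\<rho> + \<epsilon>}}"
proof -
  have n: "0 < n" using k by simp
  define J where "J = {j. j < n \<and> p j \<noteq> 0}"
  have J: "finite J" by (simp add: J_def)
  define c0 where "c0 = 1 / (3 * B * (3 * B + \<delta>))"
  define \<kappa> where "\<kappa> = net_ratio \<delta> B"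
  have c0: "0 < c0" using B \<delta> by (simp add: c0_def add_pos_pos)
  have \<kappa>: "0 < \<kappa>" unfolding \<kappa>_def by (rule net_ratio_pos[OF \<delta> B])
  have den: "1 \<le> 1 + 2 * B / \<delta> + B" using B \<delta> by simp
  have \<kappa>1: "\<kappa> * \<delta> \<le> 1"
  proof -
    have "\<kappa> \<le> 1 / \<delta>" by (simp add: \<kappa>_def net_ratio_def)
    then show ?thesis using \<delta> by (simp add: field_simps)
  qed
  have \<kappa>2: "\<kappa> * (1 + 2 * B / \<delta> + B) \<le> c0"
  proof -
    have "\<kappa> \<le> c0 / (1 + 2 * B / \<delta> + B)" by (simp add: \<kappa>_def net_ratio_def c0_def)
    then show ?thesis using den by (subst (asm) pos_le_divide_eq) auto
  qed
  have \<kappa>3: "\<kappa> \<le> c0" using \<kappa>2 mult_left_mono[OF den, of \<kappa>] \<kappa> by linarith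
  have d0: "d i \<le> d 0" if "i < n" for i using d(1)[of 0 i] that by simp
  \<comment> \<open>The mean of \<open>1 / (\<rho> - d i)\<close> is 1/\<theta> and each term is at
    most \<open>1 / (\<rho> - d 0)\<close>, so \<rho> cannot be further than \<theta> from
    \<open>d 0\<close>.\<close>
  have gap0: "\<rho> - d 0 \<le> B"
  proof -
    have "(\<Sum>i<n. 1 / (\<rho> - d i)) \<le> (\<Sum>i<n. 1 / (\<rho> - d 0))"
      using d0 \<rho>(1) \<delta> by (intro sum_mono frac_le) auto
    then have "1 / \<theta> \<le> 1 / (\<rho> - d 0)"
      unfolding \<rho>(2)[symmetric] using n by (simp add: field_simps)
    then have "\<rho> - d 0 \<le> \<theta>" using \<theta>(2) \<rho>(1) \<delta> by (simp add: field_simps)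
    also have "\<theta> \<le> B" using p(2)[of "k - 1"] k \<theta>(1) by force
    finally show ?thesis .
  qed
  have r: "2 * \<delta> \<le> \<rho> - d i" "\<rho> - d i \<le> 3 * B" if "i < n" for i
    using d0[OF that] d(2)[OF that] d(2)[OF n] gap0 \<rho>(1) by auto
  define mp where "mp = (\<Sum>i<n. 1 / (\<rho> + \<epsilon> - d i)) / real n"
  define mm where "mm = (\<Sum>i<n. 1 / (\<rho> - \<epsilon> - d i)) / real n"
  \<comment> \<open>The difference of the reciprocals is \<epsilon> divided by
    \<open>u * (u + \<epsilon>)\<close>; the bounds on both factors are where \<open>c0\<close>
    originates.\<close>
  have decay: "1 / (u + \<epsilon>) + c0 * \<epsilon> \<le> 1 / u" if u: "0 < u" "u \<le> 3 * B" "u + \<epsilon> \<le> 3 * B + \<delta>" for u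
  proof -
    have "c0 * \<epsilon> = \<epsilon> / (3 * B * (3 * B + \<delta>))" by (simp add: c0_def)
    also have "\<dots> \<le> \<epsilon> / (u * (u + \<epsilon>))"
      using u \<epsilon> B by (intro divide_left_mono mult_mono mult_pos_pos) auto
    also have "\<dots> = 1 / u - 1 / (u + \<epsilon>)" using u \<epsilon> by (simp add: field_simps)
    finally show ?thesis by simp
  qed
  have average: "(\<Sum>i<n. f i) / real n + c \<le> (\<Sum>i<n. g i) / real n" if "\<And>i. i < n \<Longrightarrow> f i + c \<le> g i" for f g c
  proof -
    have "(\<Sum>i<n. f i + c) \<le> (\<Sum>i<n. g i)" using that by (intro sum_mono) auto
    then have "(\<Sum>i<n. f i + c) / real n \<le> (\<Sum>i<n. g i) / real n" by (rule divide_right_mono) simp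
    then show ?thesis using n by (simp add: sum.distrib add_divide_distrib)
  qed
  have "mp + c0 * \<epsilon> \<le> (\<Sum>i<n. 1 / (\<rho> - d i)) / real n"
    unfolding mp_def
  proof (rule average)
    show "1 / (\<rho> + \<epsilon> - d i) + c0 * \<epsilon> \<le> 1 / (\<rho> - d i)" if "i < n" for i
      using decay[of "\<rho> - d i"] r[OF that] \<delta> \<epsilon> by (simp add: algebra_simps)
  qed
  then have mp: "mp \<le> 1 / \<theta> - c0 * \<epsilon>" unfolding \<rho>(2) by simp
  have "(\<Sum>i<n. 1 / (\<rho> - d i)) / real n + c0 * \<epsilon> \<le> mm"
    unfolding mm_def
  proof (rule average)
    show "1 / (\<rho> - d i) + c0 * \<epsilon> \<le> 1 / (\<rho> - \<epsilon> - d i)" if "i < n" for i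
      using decay[of "\<rho> - \<epsilon> - d i"] r[OF that] \<delta> \<epsilon> by (simp add: algebra_simps)
  qed
  then have mm: "1 / \<theta> + c0 * \<epsilon> \<le> mm" unfolding \<rho>(2) .
  have mm_le: "mm \<le> 1 / \<delta>"
  proof -
    have "(\<Sum>i<n. 1 / (\<rho> - \<epsilon> - d i)) \<le> (\<Sum>i<n. 1 / \<delta>)"
    proof (rule sum_mono)
      fix i assume "i \<in> {..<n}"
      then show "1 / (\<rho> - \<epsilon> - d i) \<le> 1 / \<delta>" using r[of i] \<delta> \<epsilon> by (intro frac_le) auto
    qed
    then show ?thesis using n by (simp add: mm_def field_simps)
  qed
  have mp_pos: "0 < mp"
    unfolding mp_def using n r \<delta> \<epsilon> by (intro divide_pos_pos sum_pos) (auto, smt (verit))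
  have mm_pos: "0 < mm" using mm \<theta>(2) c0 \<epsilon> by (smt (verit) divide_pos_pos mult_pos_pos)
  define \<eta> where "\<eta> = \<kappa> * \<epsilon>"
  have "0 < \<eta>" using \<kappa> \<epsilon> by (simp add: \<eta>_def)
  \<comment> \<open>The cap \<open>1 / \<delta>\<close> in \<open>net_ratio\<close> provides this;
    it allows \<eta> squared to be bounded by \<eta> below.\<close>
  moreover have "\<eta> \<le> 1"
    using mult_left_mono[OF \<epsilon>(2) less_imp_le[OF \<kappa>]] \<kappa>1 unfolding \<eta>_def by linarith
  ultimately have \<eta>: "0 < \<eta>" "\<eta> \<le> 1" by simp_all
  \<comment> \<open>A quarter of \<eta>, because passing from the net to all vectors loses a factor
    4.\<close>
  define \<tau> where "\<tau> = \<eta> / 4"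
  have \<tau>: "0 < \<tau>" using \<eta> by (simp add: \<tau>_def)
  obtain E1 where E1: "E1 \<in> sets \<mu>"
      "measure \<mu> E1 \<le> 2 * (3 * 2 ^ 34) ^ (card J * DIM('a)) * exp (- (real n * \<tau>\<^sup>2 * \<delta>\<^sup>2 / 288))"
    and net1: "\<And>U g. U \<in> space \<mu> - E1 \<Longrightarrow> g \<in> grid J \<Longrightarrow> rip (grid_vec n J g) (grid_vec n J g :: 'a vec) \<le> 3 \<Longrightarrow>
      \<bar>(\<Sum>i<n. (norm ((U *\<^sub>v grid_vec n J g) $ i))\<^sup>2 / (\<rho> + \<epsilon> - d i)) - mp * rip (grid_vec n J g) (grid_vec n J g)\<bar> \<le> \<tau>"
    using resolvent_concentration[OF n \<delta> _ J \<tau>, of "\<rho> + \<epsilon>" d] r \<epsilon> \<delta> unfolding mp_def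
    by (smt (verit))
  \<comment> \<open>A distance of \<delta> to the spectrum survives the shift down by \<epsilon>;
    this is the purpose of the separation by \<open>2 * \<delta>\<close>.\<close>
  obtain E2 where E2: "E2 \<in> sets \<mu>"
      "measure \<mu> E2 \<le> 2 * (3 * 2 ^ 34) ^ (card J * DIM('a)) * exp (- (real n * \<tau>\<^sup>2 * \<delta>\<^sup>2 / 288))"
    and net2: "\<And>U g. U \<in> space \<mu> - E2 \<Longrightarrow> g \<in> grid J \<Longrightarrow> rip (grid_vec n J g) (grid_vec n J g :: 'a vec) \<le> 3 \<Longrightarrow>
      \<bar>(\<Sum>i<n. (norm ((U *\<^sub>v grid_vec n J g) $ i))\<^sup>2 / (\<rho> - \<epsilon> - d i)) - mm * rip (grid_vec n J g) (grid_vec n J g)\<bar> \<le> \<tau>"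
    using resolvent_concentration[OF n \<delta> _ J \<tau>, of "\<rho> - \<epsilon>" d] r \<epsilon> \<delta> unfolding mm_def
    by (smt (verit))
  define S where "S = {U \<in> space \<mu>. nth_eigval k (mat_adjoint U * real_diag n d * U + real_diag n p) \<in> {\<rho> - \<epsilon>..\<rho> + \<epsilon>}}"
  have S: "S \<in> sets \<mu>"
    unfolding S_def using measurable_perturbed_eigval[OF k, of d p] by measurable
  have "space \<mu> - (E1 \<union> E2) \<subseteq> S"
  proof
    fix U assume U: "U \<in> space \<mu> - (E1 \<union> E2)"
    interpret dp: diagonal_perturbation n U d p k \<theta>
      by unfold_locales (use U space_mu p k \<theta> in auto)
    have supp: "dp.support = J" by (simp add: dp.support_def J_def)
    have zp: "d i < \<rho> + \<epsilon>" "d i < \<rho> - \<epsilon>" if "i < n" for i using r[OF that] \<delta> \<epsilon> by auto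
    have f1: "\<bar>dp.resolvent_form (\<rho> + \<epsilon>) a - mp * rip a a\<bar> \<le> \<eta> * rip a a" if "dp.supported a" for a
      using dp.net_bound[OF zp(1) _ that, of mp \<tau>] net1[of U] U unfolding supp
      by (simp add: dp.resolvent_form_def \<tau>_def del: index_mult_mat_vec)
    have f2: "\<bar>dp.resolvent_form (\<rho> - \<epsilon>) a - mm * rip a a\<bar> \<le> \<eta> * rip a a" if "dp.supported a" for a
      using dp.net_bound[OF zp(2) _ that, of mm \<tau>] net2[of U] U unfolding supp
      by (simp add: dp.resolvent_form_def \<tau>_def del: index_mult_mat_vec)
    have "nth_eigval k dp.W \<le> \<rho> + \<epsilon>"
    proof (rule dp.nth_eigval_upper[OF zp(1)])
      show "0 < mp + \<eta>" using mp_pos \<eta> by simp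
      have "mp + \<eta> \<le> 1 / \<theta>"
        using mp mult_right_mono[OF \<kappa>3 less_imp_le[OF \<epsilon>(1)]] unfolding \<eta>_def by linarith
      then show "\<theta> * (mp + \<eta>) \<le> 1" using \<theta>(2) by (simp add: field_simps)
      show "dp.resolvent_form (\<rho> + \<epsilon>) a \<le> (mp + \<eta>) * rip a a" if "dp.supported a" for a
        using f1[OF that] by (simp add: abs_le_iff algebra_simps)
    qed
    moreover have "\<rho> - \<epsilon> \<le> nth_eigval k dp.W"
    proof (rule dp.nth_eigval_lower[OF zp(2) p(2) mm_pos \<eta>(1) f2])
      have "1 + c0 * \<epsilon> * \<theta> \<le> mm * \<theta>"
        using mult_right_mono[OF mm, of \<theta>] \<theta>(2) by (simp add: distrib_right)
      \<comment> \<open>Multiplying the excess of \<open>mm * \<theta>\<close> over 1 by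
        \<open>mm\<close>, and using that \<open>mm * \<theta>\<close> is at least 1, yields the
        full gain \<open>c0 * \<epsilon>\<close> without a factor \<theta>.\<close>
      then have "mm * (c0 * \<epsilon> * \<theta>) \<le> mm * (mm * \<theta> - 1)" using mm_pos by (intro mult_left_mono) auto
      moreover have "1 * (c0 * \<epsilon>) \<le> (mm * \<theta>) * (c0 * \<epsilon>)"
        using \<open>1 + c0 * \<epsilon> * \<theta> \<le> mm * \<theta>\<close> c0 \<epsilon> \<theta>(2)
        by (intro mult_right_mono) (auto, smt (verit) mult_pos_pos)
      ultimately have gain: "c0 * \<epsilon> \<le> mm\<^sup>2 * \<theta> - mm" by (simp add: power2_eq_square algebra_simps)
      \<comment> \<open>The three error terms sum to at most
        \<open>\<eta> * (1 + 2 * B / \<delta> + B)\<close>; the denominator in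
        \<open>net_ratio\<close> was chosen to keep this below the gain.\<close>
      have "\<eta> * (2 * mm * B) \<le> \<eta> * (2 * (1 / \<delta>) * B)"
        using mm_le \<eta> B by (intro mult_left_mono mult_right_mono) auto
      moreover have "B * \<eta>\<^sup>2 \<le> B * \<eta>"
        using \<eta> B by (intro mult_left_mono) (auto simp: power2_eq_square mult_left_le)
      moreover have "\<eta> * (1 + 2 * B / \<delta> + B) \<le> c0 * \<epsilon>"
        using mult_right_mono[OF \<kappa>2 less_imp_le[OF \<epsilon>(1)]] unfolding \<eta>_def by (simp only: mult_ac)
      ultimately show "mm + \<eta> + 2 * mm * B * \<eta> + B * \<eta>\<^sup>2 \<le> mm\<^sup>2 * \<theta>"
        using gain by (simp add: algebra_simps)
    qed
    ultimately show "U \<in> S" using U by (simp add: S_def dp.W_def)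
  qed
  then have "measure \<mu> (space \<mu> - (E1 \<union> E2)) \<le> measure \<mu> S" by (intro finite_measure_mono S)
  moreover have "measure \<mu> (space \<mu> - (E1 \<union> E2)) = 1 - measure \<mu> (E1 \<union> E2)"
    using E1(1) E2(1) by (intro prob_compl) auto
  moreover have "measure \<mu> (E1 \<union> E2) \<le> measure \<mu> E1 + measure \<mu> E2"
    using E1(1) E2(1) by (intro measure_subadditive) auto
  ultimately show ?thesis
    using E1(2) E2(2) unfolding S_def[symmetric] J_def[symmetric] \<tau>_def \<eta>_def \<kappa>_def by linarith
qed

section \<open>Outliers in general\<close>

lemma (in haar) outlier_positive:
  fixes H P :: "'a mat"
  assumes B: "0 < B" and \<delta>: "0 < \<delta>" and \<epsilon>: "0 < \<epsilon>" "\<epsilon> \<le> \<delta>"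
    and H: "H \<in> selfadjoint_mats n" "\<And>j. 1 \<le> j \<Longrightarrow> j \<le> n \<Longrightarrow> \<bar>nth_eigval j H\<bar> \<le> B"
    and P: "P \<in> selfadjoint_mats n" "\<And>j. 1 \<le> j \<Longrightarrow> j \<le> n \<Longrightarrow> \<bar>nth_eigval j P\<bar> \<le> B"
    and k: "1 \<le> k" "k \<le> n" and \<theta>: "\<theta> = nth_eigval k P" "0 < \<theta>"
    and \<rho>: "nth_eigval 1 H + 2 * \<delta> \<le> \<rho>" "(\<Sum>x\<leftarrow>eigvals H. 1 / (\<rho> - x)) / real n = 1 / \<theta>"
    and M: "M = length (filter (\<lambda>x. x \<noteq> 0) (eigvals P))"
  shows "1 - 4 * (3 * 2 ^ 34) ^ (M * DIM('a)) * exp (- (real n * (net_ratio \<delta> B * \<epsilon> / 4)\<^sup>2 * \<delta>\<^sup>2 / 288)) \<le>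
    measure \<mu> {U \<in> space \<mu>. nth_eigval k (mat_adjoint U * H * U + P) \<in> {\<rho> - \<epsilon>..\<rho> + \<epsilon>}}"
proof -
  have n: "0 < n" using k by simp
  obtain Q d where Q: "Q \<in> unitary_mats n" and d: "\<And>i j. i \<le> j \<Longrightarrow> j < n \<Longrightarrow> d j \<le> d i"
    and HQ: "H = Q * real_diag n d * mat_adjoint Q" and evH: "eigvals H = map d [0..<n]"
    and nH: "\<And>k. 1 \<le> k \<Longrightarrow> k \<le> n \<Longrightarrow> nth_eigval k H = d (k - 1)"
    using spectral_nth_eigval[OF H(1)] by metis
  obtain R p where R: "R \<in> unitary_mats n" and p: "\<And>i j. i \<le> j \<Longrightarrow> j < n \<Longrightarrow> p j \<le> p i"
    and PR: "P = R * real_diag n p * mat_adjoint R" and evP: "eigvals P = map p [0..<n]"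
    and nP: "\<And>k. 1 \<le> k \<Longrightarrow> k \<le> n \<Longrightarrow> nth_eigval k P = p (k - 1)"
    using spectral_nth_eigval[OF P(1)] by metis
  note Qc = unitary_matsD(1)[OF Q] and Rc = unitary_matsD(1)[OF R]
  have dB: "\<bar>d i\<bar> \<le> B" if "i < n" for i using H(2)[of "Suc i"] nH[of "Suc i"] that by simp
  have pB: "\<bar>p i\<bar> \<le> B" if "i < n" for i using P(2)[of "Suc i"] nP[of "Suc i"] that by simp
  have cardM: "card {j. j < n \<and> p j \<noteq> 0} = M"
    unfolding M evP by (simp add: length_filter_conv_card) (intro arg_cong[where f = card], auto)
  have \<rho>1: "d 0 + 2 * \<delta> \<le> \<rho>" using \<rho>(1) nH[of 1] n by simp
  have \<rho>2: "(\<Sum>i<n. 1 / (\<rho> - d i)) / real n = 1 / \<theta>"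
    using \<rho>(2) unfolding evH by (simp add: sum_list_sum_nth lessThan_atLeast0)
  have \<theta>1: "\<theta> = p (k - 1)" using \<theta>(1) nP[OF k] by simp
  define F where "F V = nth_eigval k (mat_adjoint V * real_diag n d * V + real_diag n p)" for V :: "'a mat"
  have main: "1 - 4 * (3 * 2 ^ 34) ^ (M * DIM('a)) * exp (- (real n * (net_ratio \<delta> B * \<epsilon> / 4)\<^sup>2 * \<delta>\<^sup>2 / 288)) \<le>
    measure \<mu> {U \<in> space \<mu>. F U \<in> {\<rho> - \<epsilon>..\<rho> + \<epsilon>}}"
    unfolding F_def using diagonal_outlier[where d = d and p = p, OF B \<delta> \<epsilon> d dB p pB k \<theta>1 \<theta>(2) \<rho>1 \<rho>2] unfolding cardM .
  have meas: "{U \<in> space \<mu>. F U \<in> {\<rho> - \<epsilon>..\<rho> + \<epsilon>}} \<in> sets \<mu>"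
    unfolding F_def using measurable_perturbed_eigval[OF k, of d p] by measurable
  have eq: "F (mat_adjoint Q * U * R) = nth_eigval k (mat_adjoint U * H * U + P)" if "U \<in> space \<mu>" for U
  proof -
    have U: "U \<in> unitary_mats n" using that space_mu by simp
    note Uc = unitary_matsD(1)[OF U]
    \<comment> \<open>For this \<open>V\<close>, conjugating the diagonal model by \<open>R\<close>
      restores the original one: \<open>R\<close> cancels against its adjoint inside
      \<open>V\<close>, and the factor from \<open>Q\<close> reassembles \<open>H\<close>.\<close>
    define V where "V = mat_adjoint Q * U * R"
    have V: "V \<in> unitary_mats n"
      unfolding V_def by (intro unitary_mats_mult unitary_mats_adjoint Q U R)
    note Vc = unitary_matsD(1)[OF V]
    note sq = mult_carrier_mat[of _ n n _ n] assoc_mult_mat[of _ n n _ n _ n]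
    have cancel: "R * (mat_adjoint R * X) = X" if "X \<in> carrier_mat n n" for X
      using unitary_matsD(3)[OF R] Rc that by (simp flip: assoc_mult_mat[of R n n "mat_adjoint R" n X n])
    have RV: "R * mat_adjoint V = mat_adjoint U * Q"
    proof -
      have "mat_adjoint V = mat_adjoint R * (mat_adjoint U * Q)"
        unfolding V_def using Qc Uc Rc
        by (subst mat_adjoint_mult[of _ n n _ n]; (subst mat_adjoint_mult[of _ n n _ n])?)
          (simp_all add: sq)
      then show ?thesis using cancel[of "mat_adjoint U * Q"] Uc Qc by (simp add: sq)
    qed
    have VR: "V * mat_adjoint R = mat_adjoint Q * U"
    proof -
      have "V * mat_adjoint R = mat_adjoint Q * U * (R * mat_adjoint R)"
        unfolding V_def using Qc Uc Rc by (simp add: sq)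
      then show ?thesis using unitary_matsD(3)[OF R] Qc Uc by (simp add: sq)
    qed
    interpret dp: diagonal_perturbation n V d p k \<theta>
      by unfold_locales (use V p k \<theta>1 \<theta>(2) in auto)
    have "R * dp.W * mat_adjoint R = R * (mat_adjoint V * real_diag n d * V) * mat_adjoint R + P"
      unfolding dp.W_def PR using Vc Rc
      by (simp add: mult_add_distrib_mat[of _ n n _ n] add_mult_distrib_mat[of _ n n _ _ n] sq(1))
    also have "R * (mat_adjoint V * real_diag n d * V) * mat_adjoint R = (R * mat_adjoint V) * real_diag n d * (V * mat_adjoint R)"
      using Vc Rc by (simp add: sq)
    also have "\<dots> = mat_adjoint U * H * U"
      unfolding RV VR HQ using Uc Qc by (simp add: sq)
    finally have "mat_adjoint U * H * U + P = R * dp.W * mat_adjoint R" by simp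
    then have "eigvals (mat_adjoint U * H * U + P) = eigvals dp.W"
      using eigvals_unitary_conj[OF dp.W_selfadjoint R] by simp
    then show ?thesis unfolding F_def nth_eigval_def V_def[symmetric] dp.W_def[symmetric] by simp
  qed
  have "measure \<mu> {U \<in> space \<mu>. nth_eigval k (mat_adjoint U * H * U + P) \<in> {\<rho> - \<epsilon>..\<rho> + \<epsilon>}} =
      measure \<mu> {U \<in> space \<mu>. F (mat_adjoint Q * U * R) \<in> {\<rho> - \<epsilon>..\<rho> + \<epsilon>}}"
    using eq by (intro arg_cong[where f = "measure \<mu>"]) auto
  also have "\<dots> = measure \<mu> {U \<in> space \<mu>. F U \<in> {\<rho> - \<epsilon>..\<rho> + \<epsilon>}}"
    by (rule measure_translate[OF unitary_mats_adjoint[OF Q] R meas])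
  finally show ?thesis using main by simp
qed

section \<open>The inverse Stieltjes transform\<close>

lemma average_resolvent_surj:
  fixes d :: "nat \<Rightarrow> real"
  assumes le: "\<And>i. i < n \<Longrightarrow> d i \<le> D" and j: "j < n" "d j = D" and y: "0 < y"
  shows "\<exists>z>D. (\<Sum>i<n. 1 / (z - d i)) / real n = y"
proof -
  define s where "s z = (\<Sum>i<n. 1 / (z - d i)) / real n" for z
  have n: "1 \<le> real n" using j by simp
  \<comment> \<open>At \<open>z1\<close> the single term with \<open>d j = D\<close> already
    contributes \<open>n * y\<close>, so the mean is at least \<open>y\<close>; at \<open>z2\<close>
    no term exceeds \<open>y\<close>. The intermediate value theorem applies in between.\<close>
  define z1 where "z1 = D + 1 / (real n * y)"
  define z2 where "z2 = D + 1 / y"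
  have z1: "D < z1" using n y by (simp add: z1_def)
  have z2: "D < z2" using y by (simp add: z2_def)
  have "1 / (real n * y) \<le> 1 / y" using n y by (intro frac_le) auto
  then have z12: "z1 \<le> z2" by (simp add: z1_def z2_def)
  have "1 / (z1 - d j) \<le> (\<Sum>i<n. 1 / (z1 - d i))"
  proof (rule member_le_sum)
    fix i assume "i \<in> {..<n} - {j}"
    then show "0 \<le> 1 / (z1 - d i)" using le[of i] z1 by simp
  qed (use j in auto)
  then have "real n * y \<le> (\<Sum>i<n. 1 / (z1 - d i))" using j(2) by (simp add: z1_def)
  then have s1: "y \<le> s z1" using n by (simp add: s_def field_simps)
  have "(\<Sum>i<n. 1 / (z2 - d i)) \<le> (\<Sum>i<n. 1 / (z2 - D))"
    using le z2 by (intro sum_mono frac_le) auto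
  then have s2: "s z2 \<le> y" using n y by (simp add: s_def z2_def field_simps)
  have "continuous_on {z1..z2} s"
    unfolding s_def using le z1 j by (intro continuous_intros) (auto, smt (verit))
  from IVT2'[OF s2 s1 z12 this] obtain z where "z1 \<le> z" "s z = y" by blast
  then show ?thesis using z1 by (intro exI[of _ z]) (auto simp: s_def)
qed

text \<open>\<open>the_inv_into\<close> is meaningful once the transform is injective on both
  intervals together and attains \<open>y\<close>. On each interval it decreases strictly, and its
  sign separates the intervals.\<close>

lemma stieltjes_inv_characterization:
  fixes H :: "'a::rcfield mat"
  assumes H: "H \<in> selfadjoint_mats n" and n: "0 < n" and y: "y \<noteq> 0"
  defines "\<rho> \<equiv> stieltjes_inv H y"
  shows "(\<Sum>x\<leftarrow>eigvals H. 1 / (\<rho> - x)) / real n = y"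
proof -
  obtain d where d: "\<And>i j. i \<le> j \<Longrightarrow> j < n \<Longrightarrow> d j \<le> d i"
    and ev: "eigvals H = map d [0..<n]"
    and nH: "\<And>k. 1 \<le> k \<Longrightarrow> k \<le> n \<Longrightarrow> nth_eigval k H = d (k - 1)"
    using spectral_nth_eigval[OF H] by metis
  have dim: "dim_row H = n" using selfadjointD(1)[OF H] by simp
  have dom: "stieltjes_dom H = {..<d (n - 1)} \<union> {d 0<..}"
    using nH[of 1] nH[of n] n by (simp add: stieltjes_dom_def dim)
  have st: "stieltjes H z = (\<Sum>i<n. 1 / (z - d i)) / real n" for z
  proof -
    have "(\<Sum>k = 1..n. 1 / (z - nth_eigval k H)) = (\<Sum>i<n. 1 / (z - nth_eigval (Suc i) H))"
      by (rule sum.reindex_bij_witness[of _ Suc "\<lambda>k. k - 1"]) auto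
    also have "\<dots> = (\<Sum>i<n. 1 / (z - d i))" using nH by (intro sum.cong) auto
    finally show ?thesis by (simp add: stieltjes_def dim)
  qed
  have lo: "d (n - 1) \<le> d i" "d i \<le> d 0" if "i < n" for i
    using d[of i "n - 1"] d[of 0 i] that by auto
  have ne: "{..<n} \<noteq> {}" using n by auto
  have pos: "0 < stieltjes H z" if "d 0 < z" for z
    unfolding st using lo that n by (intro divide_pos_pos sum_pos ne) (auto, smt (verit))
  have neg: "stieltjes H z < 0" if "z < d (n - 1)" for z
  proof -
    have "0 < (\<Sum>i<n. 1 / (d i - z))"
      using lo that by (intro sum_pos ne) (auto, smt (verit))
    moreover have "(\<Sum>i<n. 1 / (z - d i)) = - (\<Sum>i<n. 1 / (d i - z))"
      unfolding sum_negf[symmetric] by (intro sum.cong refl) (metis minus_diff_eq minus_divide_right)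
    ultimately show ?thesis using n by (simp add: st divide_neg_pos)
  qed
  have decr: "stieltjes H z' < stieltjes H z" if "z < z'" "d 0 < z \<or> z' < d (n - 1)" for z z'
    unfolding st
  proof (intro divide_strict_right_mono sum_strict_mono ne)
    fix i assume "i \<in> {..<n}"
    then have "0 < (z - d i) * (z' - d i)"
      using lo[of i] that by (auto simp: zero_less_mult_iff)
    then show "1 / (z' - d i) < 1 / (z - d i)"
      using that(1) by (auto simp: zero_less_mult_iff divide_simps mult.commute)
  qed (use n in auto)
  have inj: "inj_on (stieltjes H) (stieltjes_dom H)"
  proof (rule inj_onI)
    fix z z' assume z: "z \<in> stieltjes_dom H" "z' \<in> stieltjes_dom H" "stieltjes H z = stieltjes H z'"
    show "z = z'"
    proof (rule ccontr)
      assume "z \<noteq> z'"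
      then consider "z < z'" | "z' < z" by linarith
      then show False
        using z pos[of z] pos[of z'] neg[of z] neg[of z'] decr[of z z'] decr[of z' z]
        unfolding dom by cases auto
    qed
  qed
  have "y \<in> stieltjes H ` stieltjes_dom H"
  proof (cases "0 < y")
    case True
    then obtain z where "d 0 < z" "(\<Sum>i<n. 1 / (z - d i)) / real n = y"
      using average_resolvent_surj[of n d "d 0" 0 y] lo n by blast
    then show ?thesis by (intro image_eqI[of _ _ z]) (auto simp: st dom)
  next
    case False
    \<comment> \<open>Negative values are obtained by reflecting the spectrum, which exchanges the
      two intervals.\<close>
    then obtain z where z: "- d (n - 1) < z" "(\<Sum>i<n. 1 / (z - - d i)) / real n = - y"
      using average_resolvent_surj[of n "\<lambda>i. - d i" "- d (n - 1)" "n - 1" "- y"] lo n y by auto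
    have "(\<Sum>i<n. 1 / (- z - d i)) = - (\<Sum>i<n. 1 / (z - - d i))"
      unfolding sum_negf[symmetric]
      by (intro sum.cong refl) (metis minus_add_distrib diff_minus_eq_add minus_divide_right uminus_add_conv_diff add.commute)
    then have "stieltjes H (- z) = y" using z(2) by (simp add: st)
    then show ?thesis using z(1) by (intro image_eqI[of _ _ "- z"]) (auto simp: dom)
  qed
  then have "stieltjes H \<rho> = y"
    unfolding \<rho>_def stieltjes_inv_def by (rule f_the_inv_into_f[OF inj])
  then show ?thesis unfolding st ev by (simp add: sum_list_sum_nth lessThan_atLeast0)
qed

section \<open>Positions of the nonzero eigenvalues\<close>

lemma sorted_desc_split:
  fixes xs :: "real list"
  assumes "sorted_wrt (\<ge>) xs"
  shows "xs = filter (\<lambda>x. 0 < x) xs @ filter (\<lambda>x. x = 0) xs @ filter (\<lambda>x. x < 0) xs"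
  using assms
proof (induction xs)
  case (Cons a xs)
  then have IH: "xs = filter (\<lambda>x. 0 < x) xs @ filter (\<lambda>x. x = 0) xs @ filter (\<lambda>x. x < 0) xs" by simp
  have le: "\<And>x. x \<in> set xs \<Longrightarrow> x \<le> a" using Cons.prems by auto
  have "filter (\<lambda>x. 0 < x) xs = []" if "a \<le> 0" using le that by (force simp: filter_empty_conv)
  moreover have "filter (\<lambda>x. x = 0) xs = []" if "a < 0" using le that by (force simp: filter_empty_conv)
  ultimately show ?case using IH by (cases a "0 :: real" rule: linorder_cases) auto
qed simp

text \<open>In decreasing order the zeros sit between the positive and the negative entries.
  Deleting them keeps the positions of the former and moves the latter up by their number,
  \<open>length xs - M\<close>. Positions are counted from 0 here.\<close>

lemma nonzero_eigval_index:
  fixes xs :: "real list"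
  assumes sorted: "sorted_wrt (\<ge>) xs" and M: "M = length (filter (\<lambda>x. x \<noteq> 0) xs)" and i: "i < M"
  defines "\<theta> \<equiv> filter (\<lambda>x. x \<noteq> 0) xs ! i"
  shows "\<theta> \<noteq> 0" "0 < \<theta> \<Longrightarrow> xs ! i = \<theta>" "\<theta> < 0 \<Longrightarrow> xs ! (length xs - M + i) = \<theta>"
proof -
  define ps zs ns where "ps = filter (\<lambda>x. 0 < x) xs" and "zs = filter (\<lambda>x. x = 0) xs"
    and "ns = filter (\<lambda>x. x < 0) xs"
  have xs: "xs = ps @ zs @ ns"
    using sorted_desc_split[OF sorted] by (simp add: ps_def zs_def ns_def)
  have p: "\<And>x. x \<in> set ps \<Longrightarrow> 0 < x" and z: "\<And>x. x \<in> set zs \<Longrightarrow> x = 0" and ng: "\<And>x. x \<in> set ns \<Longrightarrow> x < 0"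
    by (auto simp: ps_def zs_def ns_def)
  have "filter (\<lambda>x. x \<noteq> 0) ps = ps" using p by (auto intro!: filter_True)
  moreover have "filter (\<lambda>x. x \<noteq> 0) zs = []" using z by (auto simp: filter_empty_conv)
  moreover have "filter (\<lambda>x. x \<noteq> 0) ns = ns" using ng by (auto intro!: filter_True)
  ultimately have f: "filter (\<lambda>x. x \<noteq> 0) xs = ps @ ns" by (subst xs) simp
  then have M': "M = length ps + length ns" using M by simp
  have len: "length xs = length ps + length zs + length ns" by (subst xs) simp
  have \<theta>: "\<theta> = (ps @ ns) ! i" by (simp add: \<theta>_def f)
  show "\<theta> \<noteq> 0" using p ng nth_mem[of i "ps @ ns"] i M' unfolding \<theta> by fastforce
  show "xs ! i = \<theta>" if "0 < \<theta>"
  proof -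
    have "i < length ps"
    proof (rule ccontr)
      assume "\<not> i < length ps"
      then have "\<theta> \<in> set ns" using i M' by (simp add: \<theta> nth_append)
      then show False using ng that by force
    qed
    then show ?thesis unfolding \<theta> by (subst xs) (simp add: nth_append)
  qed
  show "xs ! (length xs - M + i) = \<theta>" if "\<theta> < 0"
  proof -
    have "length ps \<le> i"
    proof (rule ccontr)
      assume "\<not> length ps \<le> i"
      then have "\<theta> \<in> set ps" by (simp add: \<theta> nth_append)
      then show False using p that by force
    qed
    then have "length xs - M + i = length ps + (length zs + (i - length ps))" "i = length ps + (i - length ps)"
      unfolding len M' by auto
    then show ?thesis unfolding \<theta> xs by (metis nth_append_length_plus)
  qed
qed

lemma nth_eigval_uminus:
  fixes A :: "'a::rcfield mat"
  assumes A: "A \<in> selfadjoint_mats n" and k: "1 \<le> k" "k \<le> n"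
  shows "nth_eigval k (- A) = - nth_eigval (n + 1 - k) A"
proof -
  have len: "length (eigvals A) = n" using spectral_nth_eigval[OF A] by (metis length_map length_upt minus_nat.diff_0)
  then show ?thesis using k by (simp add: nth_eigval_def eigvals_uminus[OF A] rev_nth Suc_diff_le)
qed

lemma selfadjoint_uminus: "A \<in> selfadjoint_mats n \<Longrightarrow> - A \<in> selfadjoint_mats n"
  by (simp add: selfadjoint_mats_def mat_adjoint_uminus)

text \<open>For negative \<theta> the positive case is applied to \<open>- H\<close> and
  \<open>- P\<close>, with \<open>- \<rho>\<close> as the predicted location.\<close>

lemma (in haar) outlier:
  fixes H P :: "'a mat"
  assumes B: "0 < B" and \<delta>: "0 < \<delta>" and \<epsilon>: "0 < \<epsilon>" "\<epsilon> \<le> \<delta>"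
    and H: "H \<in> selfadjoint_mats n" "op_norm H \<le> B"
    and P: "P \<in> selfadjoint_mats n" "op_norm P \<le> B"
    and M: "vec_space.rank n P = M" and i: "1 \<le> i" "i \<le> M"
    and \<theta>: "\<theta> = nth_nonzero_eigval i P" and \<rho>: "\<rho> = stieltjes_inv H (1 / \<theta>)"
    and pos: "0 < \<theta> \<Longrightarrow> nth_eigval 1 H + 2 * \<delta> \<le> \<rho>"
    and neg: "\<theta> < 0 \<Longrightarrow> \<rho> \<le> nth_eigval n H - 2 * \<delta>"
  shows "1 - 4 * (3 * 2 ^ 34) ^ (M * DIM('a)) * exp (- (real n * (net_ratio \<delta> B * \<epsilon> / 4)\<^sup>2 * \<delta>\<^sup>2 / 288)) \<le>
    measure \<mu> {U \<in> space \<mu>. nth_eigval (if 0 < \<theta> then i else n - M + i) (mat_adjoint U * H * U + P) \<in> {\<rho> - \<epsilon>..\<rho> + \<epsilon>}}"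
proof -
  have M': "M = length (filter (\<lambda>x. x \<noteq> 0) (eigvals P))"
    using rank_eq_card_nonzero_eigvals[OF P(1)] M by simp
  obtain p where p: "\<And>i j. i \<le> j \<Longrightarrow> j < n \<Longrightarrow> p j \<le> p i" and evP: "eigvals P = map p [0..<n]"
    using spectral_nth_eigval[OF P(1)] by metis
  have sortedP: "sorted_wrt (\<ge>) (eigvals P)"
    unfolding evP using p by (auto simp: sorted_wrt_iff_nth_less)
  have lenP: "length (eigvals P) = n" by (simp add: evP)
  have Mn: "M \<le> n" unfolding M' using length_filter_le[of _ "eigvals P"] lenP by metis
  have n: "0 < n" using Mn i by simp
  have i1: "i - 1 < M" using i by simp
  note idx = nonzero_eigval_index[OF sortedP M' i1]
  have \<theta>': "\<theta> = filter (\<lambda>x. x \<noteq> 0) (eigvals P) ! (i - 1)" by (simp add: \<theta> nth_nonzero_eigval_def)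
  have \<theta>0: "\<theta> \<noteq> 0" unfolding \<theta>' by (rule idx(1))
  have st: "(\<Sum>x\<leftarrow>eigvals H. 1 / (\<rho> - x)) / real n = 1 / \<theta>"
    unfolding \<rho> by (rule stieltjes_inv_characterization[OF H(1) n]) (use \<theta>0 in simp)
  have HB: "\<bar>nth_eigval j H\<bar> \<le> B" if "1 \<le> j" "j \<le> n" for j
    using abs_nth_eigval_le_op_norm[OF H(1) that] H(2) by simp
  have PB: "\<bar>nth_eigval j P\<bar> \<le> B" if "1 \<le> j" "j \<le> n" for j
    using abs_nth_eigval_le_op_norm[OF P(1) that] P(2) by simp
  show ?thesis
  proof (cases "0 < \<theta>")
    case True
    have "\<theta> = nth_eigval i P" using idx(2) True by (simp add: nth_eigval_def \<theta>')
    then show ?thesis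
      using outlier_positive[OF B \<delta> \<epsilon> H(1) HB P(1) PB i(1) _ _ True pos[OF True] st M'] True i Mn by simp
  next
    case False
    then have \<theta>neg: "\<theta> < 0" using \<theta>0 by simp
    \<comment> \<open>The \<open>i\<close>-th of the \<open>M\<close> nonzero eigenvalues of
      \<open>P\<close> is, up to sign, the \<open>k\<close>-th of those of \<open>- P\<close>;
      counted among all eigenvalues of \<open>P\<close>, its position is
      \<open>n + 1 - k = n - M + i\<close>.\<close>
    define k where "k = M - i + 1"
    have k: "1 \<le> k" "k \<le> n" using i Mn by (auto simp: k_def)
    have nk: "n + 1 - k = n - M + i" using i Mn by (simp add: k_def)
    have "\<theta> = nth_eigval (n - M + i) P"
      using idx(3) \<theta>neg i lenP by (simp add: nth_eigval_def \<theta>')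
    then have \<theta>k: "- \<theta> = nth_eigval k (- P)" using nth_eigval_uminus[OF P(1) k] nk by simp
    have HB': "\<bar>nth_eigval j (- H)\<bar> \<le> B" if "1 \<le> j" "j \<le> n" for j
      using nth_eigval_uminus[OF H(1) that] HB[of "n + 1 - j"] that by simp
    have PB': "\<bar>nth_eigval j (- P)\<bar> \<le> B" if "1 \<le> j" "j \<le> n" for j
      using nth_eigval_uminus[OF P(1) that] PB[of "n + 1 - j"] that by simp
    have \<rho>1: "nth_eigval 1 (- H) + 2 * \<delta> \<le> - \<rho>"
      using nth_eigval_uminus[OF H(1), of 1] n neg[OF \<theta>neg] by simp
    have \<rho>2: "(\<Sum>x\<leftarrow>eigvals (- H). 1 / (- \<rho> - x)) / real n = 1 / - \<theta>"
    proof -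
      have flip: "1 / (- \<rho> - - x) = - (1 / (\<rho> - x))" for x
        by (metis minus_diff_eq minus_divide_right diff_minus_eq_add uminus_add_conv_diff)
      have "(\<Sum>x\<leftarrow>eigvals (- H). 1 / (- \<rho> - x)) = (\<Sum>x\<leftarrow>eigvals H. 1 / (- \<rho> - - x))"
        unfolding eigvals_uminus[OF H(1)] rev_map[symmetric] sum_list_rev by (simp add: comp_def)
      also have "\<dots> = - (\<Sum>x\<leftarrow>eigvals H. 1 / (\<rho> - x))"
        unfolding flip by (simp add: uminus_sum_list_map comp_def)
      finally show ?thesis using st by simp
    qed
    have Mk: "M = length (filter (\<lambda>x. x \<noteq> 0) (eigvals (- P)))"
      unfolding eigvals_uminus[OF P(1)] M' by (simp add: filter_map comp_def rev_filter[symmetric])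
    have ev: "nth_eigval k (mat_adjoint U * - H * U + - P) = - nth_eigval (n - M + i) (mat_adjoint U * H * U + P)"
      if "U \<in> space \<mu>" for U
    proof -
      have U: "U \<in> carrier_mat n n" using that space_mu unitary_matsD(1) by blast
      note Hc = selfadjointD[OF H(1)] and Pc = selfadjointD[OF P(1)]
      have c: "mat_adjoint U \<in> carrier_mat n n" "mat_adjoint U * H \<in> carrier_mat n n" "mat_adjoint U * H * U \<in> carrier_mat n n"
        using U Hc by (auto intro: mult_carrier_mat[of _ n n])
      have W: "mat_adjoint U * H * U + P \<in> selfadjoint_mats n"
        by (intro selfadjoint_add selfadjoint_congruence H(1) P(1) U)
      have "mat_adjoint U * - H * U = - (mat_adjoint U * H * U)"
        using c U Hc by (subst uminus_mult_right_mat; (subst uminus_mult_left_mat)?) auto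
      then have "mat_adjoint U * - H * U + - P = - (mat_adjoint U * H * U + P)"
        using c Pc by (intro eq_matI) auto
      then show ?thesis using nth_eigval_uminus[OF W k] nk by simp
    qed
    have "{U \<in> space \<mu>. nth_eigval k (mat_adjoint U * - H * U + - P) \<in> {- \<rho> - \<epsilon>..- \<rho> + \<epsilon>}} =
        {U \<in> space \<mu>. nth_eigval (n - M + i) (mat_adjoint U * H * U + P) \<in> {\<rho> - \<epsilon>..\<rho> + \<epsilon>}}"
      using ev by auto
    then show ?thesis
      using outlier_positive[OF B \<delta> \<epsilon> selfadjoint_uminus[OF H(1)] HB' selfadjoint_uminus[OF P(1)] PB' k \<theta>k _ \<rho>1 \<rho>2 Mk]
        \<theta>neg False by simp
  qed
qed

section \<open>Explicit constants\<close>

lemma outlier_bound_constants: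
  assumes "DIM('a::euclidean_space) \<le> 2"
  shows "1 - 4 * exp (- ((net_ratio \<delta> B)\<^sup>2 * \<delta>\<^sup>2 / 4608) * real n * \<epsilon>\<^sup>2 + 2 * ln (3 * 2 ^ 34) * real M) \<le>
    1 - 4 * (3 * 2 ^ 34) ^ (M * DIM('a)) * exp (- (real n * (net_ratio \<delta> B * \<epsilon> / 4)\<^sup>2 * \<delta>\<^sup>2 / 288))"
proof -
  \<comment> \<open>The larger real dimension 2 covers both fields and supplies the factor 2 in
    front of the logarithm. The 4608 is 288 times 16, the square of the 4 dividing the
    accuracy.\<close>
  have "(3 * 2 ^ 34 :: real) ^ (M * DIM('a)) \<le> (3 * 2 ^ 34) ^ (M * 2)"
    using assms by (intro power_increasing) auto
  also have "\<dots> = exp (real (M * 2) * ln (3 * 2 ^ 34))"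
    by (subst exp_of_nat_mult) simp
  also have "\<dots> = exp (2 * ln (3 * 2 ^ 34) * real M)" by (simp add: mult_ac)
  finally have "4 * (3 * 2 ^ 34) ^ (M * DIM('a)) * exp (- (real n * (net_ratio \<delta> B * \<epsilon> / 4)\<^sup>2 * \<delta>\<^sup>2 / 288)) \<le>
      4 * exp (2 * ln (3 * 2 ^ 34) * real M) * exp (- (real n * (net_ratio \<delta> B * \<epsilon> / 4)\<^sup>2 * \<delta>\<^sup>2 / 288))"
    by (intro mult_right_mono) auto
  also have "\<dots> = 4 * exp (- ((net_ratio \<delta> B)\<^sup>2 * \<delta>\<^sup>2 / 4608) * real n * \<epsilon>\<^sup>2 + 2 * ln (3 * 2 ^ 34) * real M)"
    by (simp add: power_mult_distrib power_divide mult_ac flip: exp_add)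
  finally show ?thesis by simp
qed

lemma (in haar) outlier_exp_bound:
  fixes H P :: "'a mat"
  assumes "0 < B" "0 < \<delta>" "0 < \<epsilon>" "\<epsilon> \<le> \<delta>" "DIM('a) \<le> 2"
    and "H \<in> selfadjoint_mats n" "op_norm H \<le> B" "P \<in> selfadjoint_mats n" "op_norm P \<le> B"
    and "vec_space.rank n P = M" "1 \<le> i" "i \<le> M"
    and "\<theta> = nth_nonzero_eigval i P" "\<rho> = stieltjes_inv H (1 / \<theta>)"
    and "0 < \<theta> \<longrightarrow> nth_eigval 1 H + 2 * \<delta> \<le> \<rho>" "\<theta> < 0 \<longrightarrow> \<rho> \<le> nth_eigval n H - 2 * \<delta>"
  shows "1 - 4 * exp (- ((net_ratio \<delta> B)\<^sup>2 * \<delta>\<^sup>2 / 4608) * real n * \<epsilon>\<^sup>2 + 2 * ln (3 * 2 ^ 34) * real M) \<le>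
    measure \<mu> {U \<in> space \<mu>. nth_eigval (if 0 < \<theta> then i else n - M + i) (mat_adjoint U * H * U + P) \<in> {\<rho> - \<epsilon>..\<rho> + \<epsilon>}}"
  by (rule order_trans[OF outlier_bound_constants outlier]) (use assms in auto)

lemma orthogonal_group_eq: "orthogonal_group n = unitary_mats n"
  by (simp add: orthogonal_group_def unitary_mats_def mat_adjoint_real)

lemma unitary_group_eq: "unitary_group n = unitary_mats n"
  by (simp add: unitary_group_def unitary_mats_def)

lemma symmetric_mats_eq: "symmetric_mats n = selfadjoint_mats n"
  by (simp add: symmetric_mats_def selfadjoint_mats_def mat_adjoint_real)

lemma hermitian_mats_eq: "hermitian_mats n = selfadjoint_mats n"
  by (simp add: hermitian_mats_def selfadjoint_mats_def)

theorem theorem2p1: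
  fixes \<delta> B :: real
  assumes "\<delta> > 0" and "B > 0"
  shows "\<exists>c1 c2 C :: real. c1 > 0 \<and> c2 > 0 \<and> C > 0 \<and>
    (\<forall>(H :: nat \<Rightarrow> real mat) (P :: nat \<Rightarrow> real mat) (M :: nat \<Rightarrow> nat).
      (\<forall>N\<ge>1. H N \<in> symmetric_mats N \<and> P N \<in> symmetric_mats N \<and>
              vec_space.rank N (P N) = M N \<and> op_norm (H N) \<le> B \<and> op_norm (P N) \<le> B) \<longrightarrow>
      (\<lambda>N. real (M N)) \<in> o(\<lambda>N. real N) \<longrightarrow>
      (\<forall>N\<ge>1. \<forall>\<mu> \<epsilon> i \<theta> \<rho>.
        haar_prob N (orthogonal_group N) \<mu> \<longrightarrow> 0 < \<epsilon> \<longrightarrow> \<epsilon> \<le> \<delta> \<longrightarrow> 1 \<le> i \<longrightarrow> i \<le> M N \<longrightarrow>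
        \<theta> = nth_nonzero_eigval i (P N) \<longrightarrow> \<rho> = stieltjes_inv (H N) (1 / \<theta>) \<longrightarrow>
        (\<theta> > 0 \<longrightarrow> \<rho> \<ge> nth_eigval 1 (H N) + 2 * \<delta>) \<longrightarrow>
        (\<theta> < 0 \<longrightarrow> \<rho> \<le> nth_eigval N (H N) - 2 * \<delta>) \<longrightarrow>
        measure \<mu> {U \<in> space \<mu>.
            nth_eigval (if \<theta> > 0 then i else N - M N + i) (transpose_mat U * H N * U + P N)
              \<in> {\<rho> - \<epsilon>..\<rho> + \<epsilon>}}
          \<ge> 1 - C * exp (- c1 * real N * \<epsilon>\<^sup>2 + c2 * real (M N)))) \<and>
    (\<forall>(H :: nat \<Rightarrow> complex mat) (P :: nat \<Rightarrow> complex mat) (M :: nat \<Rightarrow> nat).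
      (\<forall>N\<ge>1. H N \<in> hermitian_mats N \<and> P N \<in> hermitian_mats N \<and>
              vec_space.rank N (P N) = M N \<and> op_norm (H N) \<le> B \<and> op_norm (P N) \<le> B) \<longrightarrow>
      (\<lambda>N. real (M N)) \<in> o(\<lambda>N. real N) \<longrightarrow>
      (\<forall>N\<ge>1. \<forall>\<mu> \<epsilon> i \<theta> \<rho>.
        haar_prob N (unitary_group N) \<mu> \<longrightarrow> 0 < \<epsilon> \<longrightarrow> \<epsilon> \<le> \<delta> \<longrightarrow> 1 \<le> i \<longrightarrow> i \<le> M N \<longrightarrow>
        \<theta> = nth_nonzero_eigval i (P N) \<longrightarrow> \<rho> = stieltjes_inv (H N) (1 / \<theta>) \<longrightarrow>
        (\<theta> > 0 \<longrightarrow> \<rho> \<ge> nth_eigval 1 (H N) + 2 * \<delta>) \<longrightarrow>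
        (\<theta> < 0 \<longrightarrow> \<rho> \<le> nth_eigval N (H N) - 2 * \<delta>) \<longrightarrow>
        measure \<mu> {U \<in> space \<mu>.
            nth_eigval (if \<theta> > 0 then i else N - M N + i) (mat_adjoint U * H N * U + P N)
              \<in> {\<rho> - \<epsilon>..\<rho> + \<epsilon>}}
          \<ge> 1 - C * exp (- c1 * real N * \<epsilon>\<^sup>2 + c2 * real (M N))))"
proof -
  \<comment> \<open>These depend only on \<delta> and \<open>B\<close>; together with the constant 4
    they serve the real and the complex case alike.\<close>
  define c1 where "c1 = (net_ratio \<delta> B)\<^sup>2 * \<delta>\<^sup>2 / 4608"
  define c2 :: real where "c2 = 2 * ln (3 * 2 ^ 34)"
  have pos: "0 < c1" "0 < c2" "0 < (4::real)"
    using net_ratio_pos[OF assms] assms by (auto simp: c1_def c2_def)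
  show ?thesis
  proof (rule exI[of _ c1], rule exI[of _ c2], rule exI[of _ 4], intro conjI pos allI impI, goal_cases)
    case (1 H P M N \<mu> \<epsilon> i \<theta> \<rho>)
    interpret haar N \<mu> by unfold_locales (use 1 in \<open>simp add: orthogonal_group_eq\<close>)
    show ?case
      unfolding c1_def c2_def mat_adjoint_real[symmetric]
      by (rule outlier_exp_bound) (use 1 assms symmetric_mats_eq in auto)
  next
    case (2 H P M N \<mu> \<epsilon> i \<theta> \<rho>)
    interpret haar N \<mu> by unfold_locales (use 2 in \<open>simp add: unitary_group_eq\<close>)
    show ?case
      unfolding c1_def c2_def
      by (rule outlier_exp_bound) (use 2 assms hermitian_mats_eq in auto)
  qed
qed

end
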